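(* Consider the ANIL algorithm (see context), with $z=(w,\phi)\in\mathbb{R}^n$, and assume for every task $i$: (A1) $\nabla L_{\mathcal{S}_i}$ and $\nabla L_{\mathcal{D}_i}$ are $L$-Lipschitz in $z$, and $L_{\mathcal{D}_i}$ is $M$-Lipschitz in $z$; (A2) $\nabla_w^2L_{\mathcal{S}_i}$ is $\rho$-Lipschitz and $\nabla_\phi\nabla_wL_{\mathcal{S}_i}$ is $\tau$-Lipschitz in $z$; (A3) $L_{\mathcal{S}_i}(\cdot,\phi)$ is $\mu$-strongly convex for every $\phi$. Let the inner stepsize be $\alpha=\frac{\mu}{L^2}$ and take suitable outer stepsizes of the form $\beta_w=\mathrm{poly}(\rho,\tau,L,M)\,\mu^2(1-\frac{\mu^2}{L^2})^{-N/2}$ and $\beta_\phi=\mathrm{poly}(\rho,\tau,L,M)\,\mu^3$. Then ANIL finds a point $(w,\phi)\in\{(w_k,\phi_k):k=0,\dots,K-1\}$ such that $$\mathbb{E}\Big\|\frac{\partial L^{meta}(w,\phi)}{\partial w}\Big\|^2\le\mathcal{O}\Bigg(\frac{\frac{1}{\mu^2}\big(1-\frac{\mu^2}{L^2}\big)^{N/2}}{K}+\frac{\frac1\mu\big(1-\frac{\mu^2}{L^2}\big)^{N/2}}{B}\Bigg),$$ $$\mathbb{E}\Big\|\frac{\partial L^{meta}(w,\phi)}{\partial\phi}\Big\|^2\le\mathcal{O}\Bigg(\frac{\frac{1}{\mu^2}\big(1-\frac{\mu^2}{L^2}\big)^{N/2}+\frac{1}{\mu^3}}{K}+\frac{\frac1\mu\big(1-\frac{\mu^2}{L^2}\big)^{3N/2}+\frac{1}{\mu^2}}{B}\Bigg).$$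 To achieve an $\epsilon$-accurate point, ANIL requires at most $\mathcal{O}\big(\frac{N}{\mu^4}(1-\frac{\mu^2}{L^2})^{N/2}+\frac{N}{\mu^5}\big)\epsilon^{-2}$ gradient evaluations in $w$, $\mathcal{O}\big(\frac{1}{\mu^4}(1-\frac{\mu^2}{L^2})^{N/2}+\frac{1}{\mu^5}\big)\epsilon^{-2}$ gradient evaluations in $\phi$, and $\mathcal{O}\big(\frac{N}{\mu^4}(1-\frac{\mu^2}{L^2})^{N/2}+\frac{N}{\mu^5}\big)\epsilon^{-2}$ evaluations of the second-order derivatives $\nabla_w^2L_{\mathcal{S}_i}$ and $\nabla_\phi\nabla_wL_{\mathcal{S}_i}$.
   Context: Tasks $\mathcal{T}_i$ are sampled from a distribution $p_{\mathcal{T}}$; task $i$ has a training loss $L_{\mathcal{S}_i}(w,\phi)$ and a test loss $L_{\mathcal{D}_i}(w,\phi)$ (finite sums over fixed datasets $\mathcal{S}_i,\mathcal{D}_i$). Meta objective: $L^{meta}(w,\phi)=\mathbb{E}_{i\sim p_{\mathcal{T}}}L_{\mathcal{D}_i}(w_N^i(w,\phi),\phi)$ (generally nonconvex), where $w_0^i=w$ and $w_{m+1}^i=w_m^i-\alpha\nabla_wL_{\mathcal{S}_i}(w_m^i,\phi)$, $m=0,\dots,N-1$. Partial derivatives of $L^{meta}$ are with respect to the arguments $w$ (initialization) and $\phi$, including the dependence through $w_N^i$. ANIL (initial $w_0,\phi_0$): for $k=0,1,\dots$, sample a batch $\mathcal{B}_k$ of $B$ i.i.d. tasks from $p_{\mathcal{T}}$;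 for each $i\in\mathcal{B}_k$ run $w_{k,0}^i=w_k$, $w_{k,m+1}^i=w_{k,m}^i-\alpha\nabla_wL_{\mathcal{S}_i}(w_{k,m}^i,\phi_k)$, $m=0,\dots,N-1$; then set $w_{k+1}=w_k-\frac{\beta_w}{B}\sum_{i\in\mathcal{B}_k}\frac{\partial L_{\mathcal{D}_i}(w_{k,N}^i,\phi_k)}{\partial w_k}$ and $\phi_{k+1}=\phi_k-\frac{\beta_\phi}{B}\sum_{i\in\mathcal{B}_k}\frac{\partial L_{\mathcal{D}_i}(w_{k,N}^i,\phi_k)}{\partial\phi_k}$, where the derivatives are total derivatives through the inner loop ($w_k$ and $\phi_k$ treated as independent variables). A (random) point $(\bar w,\bar\phi)$ is $\epsilon$-accurate if $\mathbb{E}\|\frac{\partial L^{meta}(\bar w,\bar\phi)}{\partial\bar w}\|^2<\epsilon$ and $\mathbb{E}\|\frac{\partial L^{meta}(\bar w,\bar\phi)}{\partial\bar\phi}\|^2<\epsilon$. The selected point may be an iterate with random index. $\mathcal{O}$ hides constants depending on $L,M,\rho,\tau$ and $L^{meta}(w_0,\phi_0)-\inf L^{meta}$, not on $\mu,N,K,B,\epsilon$; $\mathrm{poly}(\cdot)$ denotes a positive factor depending (polynomially) on the listed parameters.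
   Formalization: For N=1 the formal theorem assumes μ≤θL for some θ in (0,1), with stepsize factor and constants depending on θ, since uniform constants fail as μ→L; it also takes N≥1, μ<L (stepsize undefined at μ=L) and states the complexity for 0<ε≤1. *)

theory Defs
  imports "HOL-Probability.Probability"
begin

text \<open>
  A loss is a function of \<open>z = (w, \<phi>)\<close> in \<open>'w \<times> 'p\<close>, whose norm is the
  Euclidean norm of the concatenated vector.
\<close>

definition grad :: "('a::real_inner \<Rightarrow> real) \<Rightarrow> 'a \<Rightarrow> 'a" where
  "grad f x = (THE D. GDERIV f x :> D)"

definition grad_w :: "('w::real_inner \<times> 'p::real_inner \<Rightarrow> real) \<Rightarrow> 'w \<times> 'p \<Rightarrow> 'w" where
  "grad_w f z = grad (\<lambda>w. f (w, snd z)) (fst z)"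

definition grad_phi :: "('w::real_inner \<times> 'p::real_inner \<Rightarrow> real) \<Rightarrow> 'w \<times> 'p \<Rightarrow> 'p" where
  "grad_phi f z = grad (\<lambda>\<phi>. f (fst z, \<phi>)) (snd z)"

text \<open>
  The second-order derivatives \<open>\<nabla>\<^sub>w\<^sup>2 f\<close> and \<open>\<nabla>\<^sub>\<phi>\<nabla>\<^sub>w f\<close> are derivatives of \<open>grad_w f\<close>, as bounded
  operators; their Lipschitz continuity is thus measured in the operator norm.
\<close>

definition hess_ww :: "('w::euclidean_space \<times> 'p::euclidean_space \<Rightarrow> real) \<Rightarrow> 'w \<times> 'p \<Rightarrow> 'w \<Rightarrow>\<^sub>L 'w" where
  "hess_ww f z = Blinfun (frechet_derivative (\<lambda>w. grad_w f (w, snd z)) (at (fst z)))"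

definition hess_phiw :: "('w::euclidean_space \<times> 'p::euclidean_space \<Rightarrow> real) \<Rightarrow> 'w \<times> 'p \<Rightarrow> 'p \<Rightarrow>\<^sub>L 'w" where
  "hess_phiw f z = Blinfun (frechet_derivative (\<lambda>\<phi>. grad_w f (fst z, \<phi>)) (at (snd z)))"

definition strongly_convex :: "real \<Rightarrow> ('a::real_inner \<Rightarrow> real) \<Rightarrow> bool" where
  "strongly_convex \<mu> f \<longleftrightarrow> convex_on UNIV (\<lambda>x. f x - \<mu> / 2 * (norm x)\<^sup>2)"

definition smooth :: "real \<Rightarrow> ('a::real_inner \<Rightarrow> real) \<Rightarrow> bool" where
  "smooth L f \<longleftrightarrow> (\<forall>x. f differentiable at x) \<and> L-lipschitz_on UNIV (grad f)"

definition second_order_smooth ::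
  "real \<Rightarrow> real \<Rightarrow> ('w::euclidean_space \<times> 'p::euclidean_space \<Rightarrow> real) \<Rightarrow> bool" where
  "second_order_smooth \<rho> \<tau> f \<longleftrightarrow>
     (\<forall>w \<phi>. (\<lambda>v. grad_w f (v, \<phi>)) differentiable at w \<and> (\<lambda>\<psi>. grad_w f (w, \<psi>)) differentiable at \<phi>) \<and>
     \<rho>-lipschitz_on UNIV (hess_ww f) \<and> \<tau>-lipschitz_on UNIV (hess_phiw f)"

primrec inner_iter ::
  "real \<Rightarrow> ('w::real_inner \<times> 'p::real_inner \<Rightarrow> real) \<Rightarrow> 'w \<times> 'p \<Rightarrow> nat \<Rightarrow> 'w" where
  "inner_iter \<alpha> f z 0 = fst z"
| "inner_iter \<alpha> f z (Suc m) =
     inner_iter \<alpha> f z m - \<alpha> *\<^sub>R grad_w f (inner_iter \<alpha> f z m, snd z)"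

text \<open>
  Test loss \<open>g\<close> after \<open>N\<close> inner steps on the training loss \<open>f\<close>, as a function of the
  initialization and \<open>\<phi>\<close>. Its partial gradients are the total derivatives through the inner loop.
\<close>

definition adapted_loss ::
  "real \<Rightarrow> nat \<Rightarrow> ('w::real_inner \<times> 'p::real_inner \<Rightarrow> real) \<Rightarrow> ('w \<times> 'p \<Rightarrow> real) \<Rightarrow> 'w \<times> 'p \<Rightarrow> real" where
  "adapted_loss \<alpha> N f g z = g (inner_iter \<alpha> f z N, snd z)"

definition meta_loss ::
  "'i measure \<Rightarrow> real \<Rightarrow> nat \<Rightarrow> ('i \<Rightarrow> 'w::real_inner \<times> 'p::real_inner \<Rightarrow> real) \<Rightarrow>
   ('i \<Rightarrow> 'w \<times> 'p \<Rightarrow> real) \<Rightarrow> 'w \<times> 'p \<Rightarrow> real" where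
  "meta_loss T \<alpha> N LS LD z = (\<integral>i. adapted_loss \<alpha> N (LS i) (LD i) z \<partial>T)"

text \<open>\<open>\<xi> (k, b)\<close> is the \<open>b\<close>-th task of the batch drawn in iteration \<open>k\<close>.\<close>

definition task_draws :: "'i measure \<Rightarrow> (nat \<times> nat \<Rightarrow> 'i) measure" where
  "task_draws T = PiM UNIV (\<lambda>_. T)"

primrec anil ::
  "real \<Rightarrow> nat \<Rightarrow> real \<Rightarrow> real \<Rightarrow> ('i \<Rightarrow> 'w::real_inner \<times> 'p::real_inner \<Rightarrow> real) \<Rightarrow>
   ('i \<Rightarrow> 'w \<times> 'p \<Rightarrow> real) \<Rightarrow> 'w \<times> 'p \<Rightarrow> nat \<Rightarrow> (nat \<times> nat \<Rightarrow> 'i) \<Rightarrow> nat \<Rightarrow> 'w \<times> 'p" where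
  "anil \<alpha> N \<beta>w \<beta>\<phi> LS LD z0 B \<xi> 0 = z0"
| "anil \<alpha> N \<beta>w \<beta>\<phi> LS LD z0 B \<xi> (Suc k) =
     (let z = anil \<alpha> N \<beta>w \<beta>\<phi> LS LD z0 B \<xi> k;
          F = (\<lambda>b. adapted_loss \<alpha> N (LS (\<xi> (k, b))) (LD (\<xi> (k, b))))
      in (fst z - (\<beta>w / B) *\<^sub>R (\<Sum>b<B. grad_w (F b) z),
          snd z - (\<beta>\<phi> / B) *\<^sub>R (\<Sum>b<B. grad_phi (F b) z)))"

text \<open>
  Cost model: the same algorithm executed with access to derivatives of the task losses only,
  the total derivatives being assembled by the chain rule (reverse mode) along the inner loop.
  Every evaluation of a derivative of a task loss is recorded in a multiset.
\<close>

datatype eval_kind = Grad_w | Grad_phi | Hess_ww | Hess_phiw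

primrec task_grad ::
  "real \<Rightarrow> ('w::euclidean_space \<times> 'p::euclidean_space \<Rightarrow> real) \<Rightarrow> ('w \<times> 'p \<Rightarrow> real) \<Rightarrow> 'p \<Rightarrow> nat \<Rightarrow> 'w \<Rightarrow>
   ('w \<times> 'p) \<times> eval_kind multiset" where
  "task_grad \<alpha> f g \<phi> 0 w = ((grad_w g (w, \<phi>), grad_phi g (w, \<phi>)), {#Grad_w, Grad_phi#})"
| "task_grad \<alpha> f g \<phi> (Suc n) w =
     (let ((u, v), c) = task_grad \<alpha> f g \<phi> n (w - \<alpha> *\<^sub>R grad_w f (w, \<phi>))
      in ((u - \<alpha> *\<^sub>R blinfun_apply (hess_ww f (w, \<phi>)) u,
           v - \<alpha> *\<^sub>R adjoint (blinfun_apply (hess_phiw f (w, \<phi>))) u),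
          c + {#Grad_w, Hess_ww, Hess_phiw#}))"

primrec anil_exec ::
  "real \<Rightarrow> nat \<Rightarrow> real \<Rightarrow> real \<Rightarrow> ('i \<Rightarrow> 'w::euclidean_space \<times> 'p::euclidean_space \<Rightarrow> real) \<Rightarrow>
   ('i \<Rightarrow> 'w \<times> 'p \<Rightarrow> real) \<Rightarrow> 'w \<times> 'p \<Rightarrow> nat \<Rightarrow> (nat \<times> nat \<Rightarrow> 'i) \<Rightarrow> nat \<Rightarrow>
   ('w \<times> 'p) \<times> eval_kind multiset" where
  "anil_exec \<alpha> N \<beta>w \<beta>\<phi> LS LD z0 B \<xi> 0 = (z0, {#})"
| "anil_exec \<alpha> N \<beta>w \<beta>\<phi> LS LD z0 B \<xi> (Suc k) =
     (let (z, c) = anil_exec \<alpha> N \<beta>w \<beta>\<phi> LS LD z0 B \<xi> k;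
          r = (\<lambda>b. task_grad \<alpha> (LS (\<xi> (k, b))) (LD (\<xi> (k, b))) (snd z) N (fst z))
      in ((fst z - (\<beta>w / B) *\<^sub>R (\<Sum>b<B. fst (fst (r b))),
           snd z - (\<beta>\<phi> / B) *\<^sub>R (\<Sum>b<B. snd (fst (r b)))),
          c + (\<Sum>b<B. snd (r b))))"

definition mean_square :: "'s measure \<Rightarrow> ('s \<Rightarrow> 'a::real_normed_vector) \<Rightarrow> real" where
  "mean_square P X = (\<integral>s. (norm (X s))\<^sup>2 \<partial>P)"

definition square_integrable :: "'s measure \<Rightarrow> ('s \<Rightarrow> 'a::real_normed_vector) \<Rightarrow> bool" where
  "square_integrable P X \<longleftrightarrow> integrable P (\<lambda>s. (norm (X s))\<^sup>2)"

text \<open>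
  \<open>Z\<close> is a random point on the probability space \<open>P\<close>. Integrability is demanded because the
  integral of a non-integrable function is \<open>0\<close> by convention.
\<close>

definition accurate_point ::
  "real \<Rightarrow> ('w::real_inner \<times> 'p::real_inner \<Rightarrow> real) \<Rightarrow> 's measure \<Rightarrow> ('s \<Rightarrow> 'w \<times> 'p) \<Rightarrow> bool" where
  "accurate_point \<epsilon> F P Z \<longleftrightarrow>
     square_integrable P (\<lambda>s. grad_w F (Z s)) \<and> mean_square P (\<lambda>s. grad_w F (Z s)) < \<epsilon> \<and>
     square_integrable P (\<lambda>s. grad_phi F (Z s)) \<and> mean_square P (\<lambda>s. grad_phi F (Z s)) < \<epsilon>"

text \<open>
  Explicit choices for the factor in the outer stepsizes and for the constants hidden in the
  \<open>\<O>\<close>-notation. They are far from optimal. Being explicit, they visibly do not depend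
  on \<open>\<mu>\<close>, \<open>N\<close>, \<open>K\<close>, \<open>B\<close>, \<open>\<epsilon>\<close>, nor on the dimensions or the task distribution.
  The parameter \<open>\<theta> \<in> (0, 1)\<close> is a bound on \<open>\<mu> / L\<close> that is required only for \<open>N = 1\<close>:
  in this case no constants are uniform as \<open>\<mu>\<close> tends to \<open>L\<close>. For \<open>N \<ge> 2\<close>
  it is an arbitrary number, such as \<open>1/2\<close>.
\<close>

definition step_factor :: "real \<Rightarrow> real \<Rightarrow> real \<Rightarrow> real \<Rightarrow> real \<Rightarrow> real" where
  "step_factor \<theta> \<rho> \<tau> L M = (1 - \<theta>\<^sup>2) / (10 ^ 4 * (1 + \<rho> + \<tau> + L + M) ^ 6)"

definition rate_const :: "real \<Rightarrow> real \<Rightarrow> real \<Rightarrow> real \<Rightarrow> real \<Rightarrow> real \<Rightarrow> real" where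
  "rate_const \<theta> \<rho> \<tau> L M \<Delta> = 10 ^ 5 * (1 + \<rho> + \<tau> + L + M) ^ 8 * (1 + \<Delta>) / (1 - \<theta>\<^sup>2)"

definition cost_const :: "real \<Rightarrow> real \<Rightarrow> real \<Rightarrow> real \<Rightarrow> real \<Rightarrow> real \<Rightarrow> real" where
  "cost_const \<theta> \<rho> \<tau> L M \<Delta> =
     10 ^ 4 * (1 + \<rho> + \<tau> + L + M) ^ 4 * (rate_const \<theta> \<rho> \<tau> L M \<Delta>)\<^sup>2"

end

theory Submission
  imports Defs
begin

text \<open>
  Let \<open>\<kappa> = 1 - \<alpha> \<mu> = 1 - \<mu>\<^sup>2 / L\<^sup>2\<close> and \<open>r = \<kappa>\<^bsup>N/2\<^esup>\<close>. Since the Hessian \<open>H\<close> of the training loss is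
  symmetric with spectrum in \<open>[\<mu>, L]\<close>, the operator \<open>I - \<alpha> H\<close> has norm at most \<open>\<kappa>\<close>. Hence the derivative
  of \<open>N\<close> inner steps is at most \<open>\<kappa>\<^sup>N = r\<^sup>2\<close> in the direction of \<open>w\<close> and at most \<open>L / \<mu>\<close> in the direction of
  \<open>\<phi>\<close>. Differences of this derivative obey a linear recursion, whose solution involves \<open>\<kappa>\<^bsup>N-1\<^esup> / \<mu>\<close>,
  \<open>N \<kappa>\<^bsup>N-1\<^esup> \<alpha>\<close> and \<open>1 / \<mu>\<^sup>3\<close>. The first two are \<open>O(r / \<mu>)\<close>; for \<open>N = 1\<close> this needs \<open>\<kappa>\<close> to stay away
  from \<open>0\<close>. So the meta objective has smoothness constants \<open>O(r / \<mu>)\<close>, \<open>O(r / \<mu>\<^sup>2)\<close> and \<open>O(1 / \<mu>\<^sup>3)\<close> in the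
  blocks \<open>ww\<close>, \<open>w\<phi>\<close> and \<open>\<phi>\<phi>\<close>, and the outer stepsizes are proportional to their inverses up to
  factors of \<open>\<mu>\<close>. The usual descent argument for stochastic gradients, with the second moment of a
  batch mean bounded by \<open>V\<^sup>2 / B\<close> plus the square of the mean, telescopes over the outer
  iterations and bounds the average of the squared gradients; a uniformly random index attains it.
\<close>

subsection \<open>Gradients, Hessians and directional derivatives\<close>

text \<open>The stepsizes are chosen to balance the Taylor remainder of the meta objective. Steps of
  length proportional to \<open>\<mu>\<^sup>2 / r\<close> in \<open>w\<close> and
  \<open>\<mu> ^ 3\<close> in \<phi> turn the block constants \<open>r / \<mu>\<close>,
  \<open>r / \<mu>\<^sup>2\<close>, \<open>1 / \<mu> ^ 3\<close> into \<open>\<mu> ^ 3 / r\<close>,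
  \<open>\<mu> ^ 3\<close>, \<open>\<mu> ^ 3\<close>. The mixed block is then dominated by the other
  two, and these are small multiples of \<beta>w and \<beta>\<phi>. One descent inequality serves
  both variables, so they share one noise term. Its larger part, of order \<mu>, comes from the
  \<phi>-gradients; it also enters the rate for \<open>w\<close>, where the factor \<open>r\<close>
  comes only from dividing by \<beta>w. The delicate point is to gain \<open>r\<close> in second
  derivatives: they decay like \<open>\<kappa> ^ (N - 1)\<close>, one power less than the first
  derivative. For \<open>N \<ge> 2\<close> half of this power is still \<open>r\<close> because
  \<open>2 * (N - 1) \<ge> N\<close>; for \<open>N = 1\<close> nothing is left, which \<theta> and
  \<open>c = 1 / sqrt (1 - \<theta>\<^sup>2)\<close> compensate. The second derivatives are given
  only as partial derivatives of \<open>grad_w\<close>. Joint differentiability and the symmetry of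
  the Hessian are both extracted from their Lipschitz continuity.\<close>

lemma GDERIV_unique:
  assumes "GDERIV f x :> D" "GDERIV f x :> D'"
  shows "D = D'"
proof -
  have "(\<lambda>h. h \<bullet> D) = (\<lambda>h. h \<bullet> D')"
    using assms has_derivative_unique unfolding gderiv_def by blast
  then show ?thesis
    by (metis vector_eq_ldot)
qed

lemma grad_eqI: "GDERIV f x :> D \<Longrightarrow> grad f x = D"
  unfolding grad_def using GDERIV_unique by blast

text \<open>The Riesz vector of a linear functional is its adjoint applied to
  \<open>1\<close>.\<close>

lemma differentiable_GDERIV:
  fixes f :: "'a::euclidean_space \<Rightarrow> real"
  assumes "f differentiable at x"
  shows "GDERIV f x :> grad f x"
proof -
  obtain f' where f': "(f has_derivative f') (at x)"
    using assms by (auto simp: differentiable_def)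
  then have "linear f'"
    by (simp add: has_derivative_linear)
  then have "f' = (\<lambda>h. h \<bullet> adjoint f' 1)"
    by (simp add: adjoint_works fun_eq_iff)
  then have "GDERIV f x :> adjoint f' 1"
    using f' by (simp add: gderiv_def)
  then show ?thesis
    using grad_eqI by fastforce
qed

lemma GDERIV_partials:
  assumes "GDERIV f z :> D"
  shows "GDERIV (\<lambda>w. f (w, snd z)) (fst z) :> fst D" and "GDERIV (\<lambda>\<phi>. f (fst z, \<phi>)) (snd z) :> snd D"
proof -
  have f: "(f has_derivative (\<lambda>h. h \<bullet> D)) (at (fst z, snd z))"
    using assms by (simp add: gderiv_def)
  have "((\<lambda>w. f (w, snd z)) has_derivative (\<lambda>h. (h, 0) \<bullet> D)) (at (fst z))"
    by (rule has_derivative_compose[where g=f and f="\<lambda>w. (w, snd z)", OF _ f]) (auto intro!: derivative_eq_intros)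
  then show "GDERIV (\<lambda>w. f (w, snd z)) (fst z) :> fst D"
    by (simp add: gderiv_def inner_prod_def)
  have "((\<lambda>\<phi>. f (fst z, \<phi>)) has_derivative (\<lambda>h. (0, h) \<bullet> D)) (at (snd z))"
    by (rule has_derivative_compose[where g=f and f="\<lambda>\<phi>. (fst z, \<phi>)", OF _ f]) (auto intro!: derivative_eq_intros)
  then show "GDERIV (\<lambda>\<phi>. f (fst z, \<phi>)) (snd z) :> snd D"
    by (simp add: gderiv_def inner_prod_def)
qed

lemma GDERIV_grad_w: "GDERIV f z :> D \<Longrightarrow> grad_w f z = fst D"
  and GDERIV_grad_phi: "GDERIV f z :> D \<Longrightarrow> grad_phi f z = snd D"
  unfolding grad_w_def grad_phi_def by (metis GDERIV_partials grad_eqI)+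

text \<open>Sequential form of the directional derivative. It carries inequalities over to
  derivatives in the limit (norm bounds, convexity), and it exhibits gradients as limits of
  measurable functions.\<close>

lemma has_derivative_LIMSEQ:
  fixes f :: "'a::real_normed_vector \<Rightarrow> 'b::real_normed_vector"
  assumes "(f has_derivative f') (at x)"
  shows "(\<lambda>n. real (Suc n) *\<^sub>R (f (x + (1 / real (Suc n)) *\<^sub>R u) - f x)) \<longlonglongrightarrow> f' u"
proof (cases "u = 0")
  case True
  then show ?thesis
    using linear_0[OF has_derivative_linear[OF assms]] by simp
next
  \<comment> \<open>The increments \<open>h n\<close> have to avoid \<open>0\<close> in order to
    converge in the filter \<open>at 0\<close>.\<close>
  case False
  define h where "h n = (1 / real (Suc n)) *\<^sub>R u" for n
  have "((\<lambda>h. norm (f (x + h) - f x - f' h) / norm h) \<longlongrightarrow> 0) (at 0)"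
    using assms by (simp add: has_derivative_at)
  moreover have "filterlim h (at 0) sequentially"
  proof -
    have "h \<longlonglongrightarrow> 0 *\<^sub>R u"
      unfolding h_def using LIMSEQ_inverse_real_of_nat[unfolded inverse_eq_divide]
      by (intro tendsto_intros)
    then show ?thesis
      using False by (simp add: filterlim_at h_def)
  qed
  ultimately have "(\<lambda>n. norm (f (x + h n) - f x - f' (h n)) / norm (h n)) \<longlonglongrightarrow> 0"
    by (rule filterlim_compose)
  from tendsto_mult_left[OF this, of "norm u"]
  have "(\<lambda>n. norm u * (norm (f (x + h n) - f x - f' (h n)) / norm (h n))) \<longlonglongrightarrow> 0"
    by simp
  moreover have "norm u * (norm (f (x + h n) - f x - f' (h n)) / norm (h n))
      = norm (real (Suc n) *\<^sub>R (f (x + h n) - f x) - f' u)" for n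
  proof -
    have "f' u = real (Suc n) *\<^sub>R f' (h n)"
      using linear_scale[OF has_derivative_linear[OF assms], of "1 / real (Suc n)" u] by (simp add: h_def)
    then have "real (Suc n) *\<^sub>R (f (x + h n) - f x) - f' u = real (Suc n) *\<^sub>R (f (x + h n) - f x - f' (h n))"
      by (simp only: scaleR_diff_right)
    then show ?thesis
      using False by (simp add: h_def)
  qed
  ultimately show ?thesis
    unfolding h_def by (simp add: tendsto_norm_zero_iff LIM_zero_iff)
qed

lemma has_derivative_norm_le:
  fixes f :: "'a::real_normed_vector \<Rightarrow> 'b::real_normed_vector"
  assumes f: "(f has_derivative f') (at x)" and C: "\<And>y. norm (f y - f x) \<le> C * norm (y - x)"
  shows "norm (f' u) \<le> C * norm u"
proof (rule LIMSEQ_le_const2[OF tendsto_norm[OF has_derivative_LIMSEQ[OF f]]], intro exI allI impI)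
  fix n :: nat
  have "norm (real (Suc n) *\<^sub>R (f (x + (1 / real (Suc n)) *\<^sub>R u) - f x))
      \<le> real (Suc n) * (C * norm ((1 / real (Suc n)) *\<^sub>R u))"
    unfolding norm_scaleR real_norm_def abs_of_nat
    using C[of "x + (1 / real (Suc n)) *\<^sub>R u"] by (intro mult_left_mono) (simp_all del: of_nat_Suc)
  also have "\<dots> = C * norm u"
    by simp
  finally show "norm (real (Suc n) *\<^sub>R (f (x + (1 / real (Suc n)) *\<^sub>R u) - f x)) \<le> C * norm u" .
qed

lemma GDERIV_norm_le:
  fixes f :: "'a::real_inner \<Rightarrow> real"
  assumes "GDERIV f x :> D" and C: "C-lipschitz_on UNIV f"
  shows "norm D \<le> C"
proof -
  have "norm (D \<bullet> D) \<le> C * norm D"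
    using assms(1) unfolding gderiv_def
    by (rule has_derivative_norm_le) (use lipschitz_onD[OF C] in \<open>simp add: dist_norm\<close>)
  then have "norm D * norm D \<le> C * norm D"
    by (simp add: power2_norm_eq_inner flip: power2_eq_square)
  then show ?thesis
    using lipschitz_on_nonneg[OF C] by (cases "D = 0") auto
qed

text \<open>Subtracting \<open>\<mu> / 2 * (norm x)\<^sup>2\<close> leaves a convex function, which
  lies above its tangents. Adding the tangent inequalities at two points makes \<open>G\<close>
  strongly monotone; applied to \<open>x + t *\<^sub>R u\<close> and \<open>x\<close> and divided by
  the square of \<open>t\<close>, this becomes the claim in the limit.\<close>

lemma strongly_convex_derivative_ge:
  fixes h :: "'a::real_inner \<Rightarrow> real"
  assumes h: "strongly_convex \<mu> h" and G: "\<And>x. GDERIV h x :> G x"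
    and H: "(G has_derivative H) (at x)"
  shows "\<mu> * (norm u)\<^sup>2 \<le> H u \<bullet> u"
proof -
  define h1 where "h1 x = h x - \<mu> / 2 * (norm x)\<^sup>2" for x
  have conv: "convex_on UNIV h1"
    using h by (simp add: strongly_convex_def h1_def[abs_def])
  have h1: "(h1 has_derivative (\<lambda>d. d \<bullet> (G x - \<mu> *\<^sub>R x))) (at x)" for x
    unfolding h1_def power2_norm_eq_inner
    using G[of x, unfolded gderiv_def]
    by (auto intro!: derivative_eq_intros simp: fun_eq_iff inner_diff_right inner_commute)
  have tangent: "(y - x) \<bullet> (G x - \<mu> *\<^sub>R x) \<le> h1 y - h1 x" for x y
  proof (rule LIMSEQ_le_const2[OF has_derivative_LIMSEQ[OF h1]], intro exI allI impI)
    fix n :: nat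
    define t where "t = 1 / real (Suc n)"
    have t: "0 < t" "t \<le> 1" "real (Suc n) = 1 / t"
      by (auto simp: t_def)
    have "h1 ((1 - t) *\<^sub>R x + t *\<^sub>R y) \<le> (1 - t) * h1 x + t * h1 y"
      using convex_onD[OF conv, of t x y] t by simp
    then have "h1 (x + t *\<^sub>R (y - x)) - h1 x \<le> t * (h1 y - h1 x)"
      by (simp add: algebra_simps)
    then show "real (Suc n) *\<^sub>R (h1 (x + (1 / real (Suc n)) *\<^sub>R (y - x)) - h1 x) \<le> h1 y - h1 x"
      unfolding t_def[symmetric] t(3) using t(1) by (simp add: field_simps)
  qed
  have mono: "0 \<le> (y - x) \<bullet> (G y - G x) - \<mu> * (norm (y - x))\<^sup>2" for x y
    using tangent[of x y] tangent[of y x] by (simp add: power2_norm_eq_inner algebra_simps inner_commute)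
  have "(\<lambda>n. (real (Suc n) *\<^sub>R (G (x + (1 / real (Suc n)) *\<^sub>R u) - G x)) \<bullet> u - \<mu> * (norm u)\<^sup>2)
          \<longlonglongrightarrow> H u \<bullet> u - \<mu> * (norm u)\<^sup>2"
    by (intro tendsto_intros has_derivative_LIMSEQ H)
  then have "0 \<le> H u \<bullet> u - \<mu> * (norm u)\<^sup>2"
  proof (rule LIMSEQ_le_const, intro exI allI impI)
    fix n :: nat
    define t where "t = 1 / real (Suc n)"
    have t: "0 < t" "real (Suc n) = 1 / t"
      by (auto simp: t_def)
    have "0 \<le> t * ((G (x + t *\<^sub>R u) - G x) \<bullet> u) - \<mu> * t\<^sup>2 * (norm u)\<^sup>2"
      using mono[of "x + t *\<^sub>R u" x] t by (simp add: inner_commute power_mult_distrib)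
    also have "\<dots> = t\<^sup>2 * (((1/t) *\<^sub>R (G (x + t *\<^sub>R u) - G x)) \<bullet> u - \<mu> * (norm u)\<^sup>2)"
      using t by (simp add: power2_eq_square right_diff_distrib inner_scaleR_left del: scaleR_diff_right)
    finally show "0 \<le> (real (Suc n) *\<^sub>R (G (x + (1 / real (Suc n)) *\<^sub>R u) - G x)) \<bullet> u - \<mu> * (norm u)\<^sup>2"
      unfolding t_def[symmetric] t(2) using t(1) by (simp add: zero_le_mult_iff)
  qed
  then show ?thesis
    by simp
qed

text \<open>
  Both \<open>H x u \<bullet> v\<close> and \<open>H x v \<bullet> u\<close> are limits of the same second difference quotient of \<open>h\<close>.
\<close>

lemma lipschitz_hessian_symmetric:
  fixes h :: "'a::real_inner \<Rightarrow> real"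
  assumes G: "\<And>x. GDERIV h x :> G x"
    and H: "\<And>x. (G has_derivative H x) (at x)"
    and C: "\<And>x y u. norm (H y u - H x u) \<le> C * norm (y - x) * norm u"
  shows "H x u \<bullet> v = u \<bullet> H x v"
proof -
  have est: "\<bar>h (x + t *\<^sub>R u + t *\<^sub>R v) - h (x + t *\<^sub>R u) - h (x + t *\<^sub>R v) + h x - t\<^sup>2 * (H x v \<bullet> u)\<bar>
     \<le> t^3 * (\<bar>C\<bar> * (norm u + norm v) * norm u * norm v)" if t: "0 < t" for t u v
  proof -
    \<comment> \<open>Two mean value theorems: first along \<open>u\<close> for the difference of
      \<open>h\<close> in direction \<open>v\<close>, then along \<open>v\<close> for
      \<open>G \<bullet> u\<close>. The point reached is within \<open>t * (norm u + norm v)\<close>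
      of \<open>x\<close>, so replacing its Hessian by \<open>H x\<close> costs one more power of
      \<open>t\<close>.\<close>
    have "\<exists>s\<in>{0<..<t}. (h (x + t *\<^sub>R u + t *\<^sub>R v) - h (x + t *\<^sub>R u)) - (h (x + 0 *\<^sub>R u + t *\<^sub>R v) - h (x + 0 *\<^sub>R u)) =
        ((t - 0) *\<^sub>R u) \<bullet> G (x + s *\<^sub>R u + t *\<^sub>R v) - ((t - 0) *\<^sub>R u) \<bullet> G (x + s *\<^sub>R u)"
      using t G unfolding gderiv_def
      by (intro mvt_simple[of 0 t "\<lambda>s. h (x + s *\<^sub>R u + t *\<^sub>R v) - h (x + s *\<^sub>R u)"])
        (auto intro!: derivative_eq_intros has_derivative_compose[OF _ G[unfolded gderiv_def]])
    then obtain s where s: "0 < s" "s < t"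
      and 1: "h (x + t *\<^sub>R u + t *\<^sub>R v) - h (x + t *\<^sub>R u) - h (x + t *\<^sub>R v) + h x
         = t * (u \<bullet> (G (x + s *\<^sub>R u + t *\<^sub>R v) - G (x + s *\<^sub>R u)))"
      by (auto simp: algebra_simps)
    have "\<exists>s'\<in>{0<..<t}. G (x + s *\<^sub>R u + t *\<^sub>R v) \<bullet> u - G (x + s *\<^sub>R u + 0 *\<^sub>R v) \<bullet> u =
        H (x + s *\<^sub>R u + s' *\<^sub>R v) ((t - 0) *\<^sub>R v) \<bullet> u"
      using t
      by (intro mvt_simple[of 0 t "\<lambda>s'. G (x + s *\<^sub>R u + s' *\<^sub>R v) \<bullet> u"])
        (auto intro!: derivative_eq_intros has_derivative_compose[OF _ H])
    then obtain s' where s': "0 < s'" "s' < t"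
      and 2: "u \<bullet> (G (x + s *\<^sub>R u + t *\<^sub>R v) - G (x + s *\<^sub>R u)) = t * (H (x + s *\<^sub>R u + s' *\<^sub>R v) v \<bullet> u)"
      using linear_scale[OF has_derivative_linear[OF H]] by (auto simp: algebra_simps inner_commute)
    have "norm (s *\<^sub>R u + s' *\<^sub>R v) \<le> s * norm u + s' * norm v"
      using norm_triangle_ineq[of "s *\<^sub>R u" "s' *\<^sub>R v"] s s' by simp
    also have "\<dots> \<le> t * (norm u + norm v)"
      using s s' unfolding distrib_left by (intro add_mono mult_right_mono) auto
    finally have n: "norm (s *\<^sub>R u + s' *\<^sub>R v) \<le> t * (norm u + norm v)" .
    have "\<bar>H (x + s *\<^sub>R u + s' *\<^sub>R v) v \<bullet> u - H x v \<bullet> u\<bar> \<le> norm (H (x + s *\<^sub>R u + s' *\<^sub>R v) v - H x v) * norm u"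
      by (metis Cauchy_Schwarz_ineq2 inner_diff_left)
    also have "\<dots> \<le> (C * norm (s *\<^sub>R u + s' *\<^sub>R v) * norm v) * norm u"
      using C[of "x + s *\<^sub>R u + s' *\<^sub>R v" v x] by (intro mult_right_mono) (auto simp: add.assoc)
    also have "\<dots> \<le> (\<bar>C\<bar> * (t * (norm u + norm v)) * norm v) * norm u"
      using n by (intro mult_right_mono mult_mono) auto
    finally have "t\<^sup>2 * \<bar>H (x + s *\<^sub>R u + s' *\<^sub>R v) v \<bullet> u - H x v \<bullet> u\<bar>
        \<le> t\<^sup>2 * (\<bar>C\<bar> * (t * (norm u + norm v)) * norm v * norm u)"
      by (intro mult_left_mono) auto
    moreover have "t * (t * (H (x + s *\<^sub>R u + s' *\<^sub>R v) v \<bullet> u)) - t\<^sup>2 * (H x v \<bullet> u)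
       = t\<^sup>2 * (H (x + s *\<^sub>R u + s' *\<^sub>R v) v \<bullet> u - H x v \<bullet> u)"
      by (simp only: power2_eq_square right_diff_distrib mult.assoc)
    moreover have "t\<^sup>2 * (\<bar>C\<bar> * (t * (norm u + norm v)) * norm v * norm u)
       = t^3 * (\<bar>C\<bar> * (norm u + norm v) * norm u * norm v)"
      by (simp add: power2_eq_square power3_eq_cube)
    ultimately show ?thesis
      unfolding 1 2 by (simp add: abs_mult)
  qed
  define D where "D = H x v \<bullet> u - H x u \<bullet> v"
  define A where "A = 2 * (\<bar>C\<bar> * (norm u + norm v) * norm u * norm v)"
  have D_le: "\<bar>D\<bar> \<le> t * A" if t: "0 < t" for t
  proof -
    have "\<bar>t\<^sup>2 * D\<bar> \<le> t^3 * A"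
    proof -
      \<comment> \<open>Exchanging \<open>u\<close> and \<open>v\<close> leaves the second
        difference unchanged. Its leading terms, of order \<open>t\<^sup>2\<close>, therefore agree
        up to \<open>t ^ 3\<close>.\<close>
      have *: "x + t *\<^sub>R v + t *\<^sub>R u = x + t *\<^sub>R u + t *\<^sub>R v"
        by simp
      have "t\<^sup>2 * D = t\<^sup>2 * (H x v \<bullet> u) - t\<^sup>2 * (H x u \<bullet> v)"
        by (simp add: D_def right_diff_distrib)
      moreover have "t^3 * A = t^3 * (\<bar>C\<bar> * (norm u + norm v) * norm u * norm v)
          + t^3 * (\<bar>C\<bar> * (norm v + norm u) * norm v * norm u)"
        by (simp add: A_def mult_ac add.commute)
      ultimately show ?thesis
        using est[OF t, of u v] est[OF t, of v u] unfolding * by linarith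
    qed
    then have "t\<^sup>2 * \<bar>D\<bar> \<le> t\<^sup>2 * (t * A)"
      by (simp add: abs_mult power2_eq_square power3_eq_cube mult_ac)
    then show ?thesis
      using t by simp
  qed
  have "\<bar>D\<bar> \<le> (1 / real (Suc n)) * A" for n
    by (rule D_le) simp
  moreover have "(\<lambda>n. (1 / real (Suc n)) * A) \<longlonglongrightarrow> 0 * A"
    using LIMSEQ_inverse_real_of_nat[unfolded inverse_eq_divide] by (intro tendsto_intros)
  ultimately have "\<bar>D\<bar> \<le> 0 * A"
    by (meson LIMSEQ_le_const)
  then have "D = 0"
    by simp
  then show ?thesis
    by (simp add: D_def inner_commute)
qed

text \<open>The semidefinite form \<open>A u \<bullet> v\<close> satisfies the Cauchy-Schwarz
  inequality. Applied to the pair \<open>u\<close>, \<open>A u\<close>, it bounds the norm by the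
  quadratic form without a spectral decomposition.\<close>

lemma self_adjoint_norm_le:
  fixes A :: "'a::real_inner \<Rightarrow> 'a"
  assumes A: "linear A" and sym: "\<And>u v. A u \<bullet> v = u \<bullet> A v"
    and pos: "\<And>u. 0 \<le> A u \<bullet> u" and le: "\<And>u. A u \<bullet> u \<le> \<kappa> * (norm u)\<^sup>2" and "0 \<le> \<kappa>"
  shows "norm (A u) \<le> \<kappa> * norm u"
proof -
  have CS: "(A u \<bullet> v)\<^sup>2 \<le> (A u \<bullet> u) * (A v \<bullet> v)" for u v
  proof -
    have q: "0 \<le> (A u \<bullet> u) + 2 * t * (A u \<bullet> v) + t\<^sup>2 * (A v \<bullet> v)" for t
    proof -
      have "A (u + t *\<^sub>R v) = A u + t *\<^sub>R A v"
        using A by (simp add: linear_add linear_scale)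
      then show ?thesis
        using pos[of "u + t *\<^sub>R v"] sym[of u v]
        by (simp add: algebra_simps inner_commute power2_eq_square)
    qed
    show ?thesis
    proof (cases "A v \<bullet> v = 0")
      case True
      have "A u \<bullet> v = 0"
      proof (rule ccontr)
        assume n: "A u \<bullet> v \<noteq> 0"
        \<comment> \<open>The quadratic in \<open>t\<close> degenerates to an affine function, and
          this value of \<open>t\<close> makes it \<open>-1\<close>.\<close>
        show False
          using q[of "- (A u \<bullet> u + 1) / (2 * (A u \<bullet> v))"] True n by (simp add: field_simps)
      qed
      then show ?thesis using True by simp
    next
      case False
      then have p: "0 < A v \<bullet> v" using pos[of v] by linarith
      \<comment> \<open>The quadratic in \<open>t\<close> is evaluated at its minimum.\<close>
      have "0 \<le> (A v \<bullet> v) * ((A u \<bullet> u) + 2 * (- (A u \<bullet> v) / (A v \<bullet> v)) * (A u \<bullet> v)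
          + (- (A u \<bullet> v) / (A v \<bullet> v))\<^sup>2 * (A v \<bullet> v))"
        using q[of "- (A u \<bullet> v) / (A v \<bullet> v)"] p by (intro mult_nonneg_nonneg) linarith+
      also have "\<dots> = (A u \<bullet> u) * (A v \<bullet> v) - (A u \<bullet> v)\<^sup>2"
        using p by (simp add: field_simps power2_eq_square)
      finally show ?thesis by simp
    qed
  qed
  have "((norm (A u))\<^sup>2)\<^sup>2 = (A u \<bullet> A u)\<^sup>2"
    by (simp add: power2_norm_eq_inner)
  also have "\<dots> \<le> (A u \<bullet> u) * (A (A u) \<bullet> A u)"
    by (rule CS)
  also have "\<dots> \<le> (\<kappa> * (norm u)\<^sup>2) * (\<kappa> * (norm (A u))\<^sup>2)"
    using le pos \<open>0 \<le> \<kappa>\<close> by (intro mult_mono) auto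
  finally have "(norm (A u))\<^sup>2 * (norm (A u))\<^sup>2 \<le> (\<kappa> * norm u)\<^sup>2 * (norm (A u))\<^sup>2"
    by (simp add: power2_eq_square mult_ac)
  then have le2: "(norm (A u))\<^sup>2 \<le> (\<kappa> * norm u)\<^sup>2" if "A u \<noteq> 0"
    by (rule mult_right_le_imp_le) (use that in simp)
  show ?thesis
  proof (cases "A u = 0")
    case True
    then show ?thesis
      using \<open>0 \<le> \<kappa>\<close> by simp
  next
    case False
    then show ?thesis
      using \<open>0 \<le> \<kappa>\<close> by (intro power2_le_imp_le[OF le2]) auto
  qed
qed

text \<open>Mean value inequality on the segment from \<open>z\<close> to \<open>z + d\<close>. The
  constants \<open>a\<close> and \<open>b\<close> stay separate because the directions
  \<open>w\<close> and \<phi> have different scales in \<mu> and \<open>N\<close>; a single operator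
  norm on the product would lose the decay in \<open>w\<close>.\<close>

lemma has_derivative_seminorm_lipschitz:
  fixes X :: "'a::real_normed_vector \<times> 'b::real_normed_vector \<Rightarrow> 'c::real_normed_vector"
  assumes X: "\<And>z. (X has_derivative X' z) (at z)"
    and le: "\<And>z d. norm (X' z d) \<le> a * norm (fst d) + b * norm (snd d)"
  shows "norm (X (z + d) - X z) \<le> a * norm (fst d) + b * norm (snd d)"
proof -
  have "((\<lambda>t. X (z + t *\<^sub>R d)) has_derivative (\<lambda>t. X' (z + s *\<^sub>R d) (t *\<^sub>R d))) (at s within {0..1})" for s
    by (rule has_derivative_compose[OF _ X]) (auto intro!: derivative_eq_intros)
  moreover have "onorm (\<lambda>t. X' (z + s *\<^sub>R d) (t *\<^sub>R d)) \<le> a * norm (fst d) + b * norm (snd d)" for s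
  proof (rule onorm_bound)
    show "0 \<le> a * norm (fst d) + b * norm (snd d)"
      using le[of z d] norm_ge_zero order_trans by blast
    fix t :: real
    have "X' (z + s *\<^sub>R d) (t *\<^sub>R d) = t *\<^sub>R X' (z + s *\<^sub>R d) d"
      using has_derivative_linear[OF X] by (simp add: linear_scale)
    then show "norm (X' (z + s *\<^sub>R d) (t *\<^sub>R d)) \<le> (a * norm (fst d) + b * norm (snd d)) * norm t"
      using le[of "z + s *\<^sub>R d" d] by (simp add: mult.commute mult_left_mono)
  qed
  ultimately have "norm (X (z + 1 *\<^sub>R d) - X (z + 0 *\<^sub>R d)) \<le> (a * norm (fst d) + b * norm (snd d)) * norm (1 - 0 :: real)"
    by (intro differentiable_bound[of "{0..1}" "\<lambda>t. X (z + t *\<^sub>R d)"]) auto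
  then show ?thesis
    by simp
qed

subsection \<open>The inner loop\<close>

lemma Blinfun_frechet_derivative:
  assumes "f differentiable at x"
  shows "(f has_derivative blinfun_apply (Blinfun (frechet_derivative f (at x)))) (at x)"
  using assms by (metis bounded_linear_Blinfun_apply frechet_derivative_works has_derivative_bounded_linear)

locale inner_loop =
  fixes f :: "'w::euclidean_space \<times> 'p::euclidean_space \<Rightarrow> real" and \<mu> L \<rho> \<tau> \<alpha> \<kappa> :: real
  assumes smooth: "smooth L f" and second_order: "second_order_smooth \<rho> \<tau> f"
    and convex: "\<And>\<phi>. strongly_convex \<mu> (\<lambda>w. f (w, \<phi>))"
    and \<mu>: "0 < \<mu>" "\<mu> < L" and \<alpha>: "\<alpha> = \<mu> / L\<^sup>2" and \<kappa>: "\<kappa> = 1 - \<mu>\<^sup>2 / L\<^sup>2"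
begin

lemma \<alpha>_pos: "0 < \<alpha>" and \<alpha>_L: "\<alpha> * L \<le> 1" and \<kappa>_\<alpha>: "\<kappa> = 1 - \<alpha> * \<mu>" and \<kappa>_pos: "0 < \<kappa>" and \<kappa>_less: "\<kappa> < 1"
proof -
  have L: "0 < L" "\<mu>\<^sup>2 < L\<^sup>2"
    using \<mu> by (auto intro: power_strict_mono)
  show "0 < \<alpha>" "\<alpha> * L \<le> 1" "\<kappa> = 1 - \<alpha> * \<mu>" "0 < \<kappa>" "\<kappa> < 1"
    using L \<mu> by (auto simp: \<alpha> \<kappa> field_simps power2_eq_square)
qed

lemma \<rho>_nonneg: "0 \<le> \<rho>" and \<tau>_nonneg: "0 \<le> \<tau>"
  using second_order lipschitz_on_nonneg unfolding second_order_smooth_def by blast+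

lemma GDERIV_f: "GDERIV f z :> grad f z"
  using smooth unfolding smooth_def by (blast intro: differentiable_GDERIV)

lemma GDERIV_f_w: "GDERIV (\<lambda>w. f (w, \<phi>)) w :> grad_w f (w, \<phi>)"
  using GDERIV_partials(1)[OF GDERIV_f, of "(w, \<phi>)"] GDERIV_grad_w[OF GDERIV_f, of "(w, \<phi>)"] by simp

lemma grad_w_lipschitz: "norm (grad_w f y - grad_w f z) \<le> L * norm (y - z)"
proof -
  have "norm (fst (grad f y - grad f z)) \<le> norm (grad f y - grad f z)"
    by (metis norm_fst_le prod.collapse)
  also have "\<dots> \<le> L * norm (y - z)"
    using smooth unfolding smooth_def by (metis UNIV_I dist_norm lipschitz_onD)
  finally show ?thesis
    by (simp add: GDERIV_grad_w[OF GDERIV_f])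
qed

lemma hess_ww: "((\<lambda>w. grad_w f (w, \<phi>)) has_derivative blinfun_apply (hess_ww f (w, \<phi>))) (at w)"
  using second_order unfolding second_order_smooth_def hess_ww_def
  by (auto intro: Blinfun_frechet_derivative)

lemma hess_phiw: "((\<lambda>\<phi>. grad_w f (w, \<phi>)) has_derivative blinfun_apply (hess_phiw f (w, \<phi>))) (at \<phi>)"
  using second_order unfolding second_order_smooth_def hess_phiw_def
  by (auto intro: Blinfun_frechet_derivative)

lemma hess_ww_lipschitz: "norm (hess_ww f y u - hess_ww f z u) \<le> \<rho> * norm (y - z) * norm u"
proof -
  have "norm ((hess_ww f y - hess_ww f z) u) \<le> norm (hess_ww f y - hess_ww f z) * norm u"
    by (rule norm_blinfun)
  also have "\<dots> \<le> \<rho> * norm (y - z) * norm u"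
    using second_order unfolding second_order_smooth_def
    by (intro mult_right_mono norm_ge_zero) (metis UNIV_I dist_norm lipschitz_onD)
  finally show ?thesis
    by (simp add: blinfun.diff_left)
qed

lemma hess_phiw_lipschitz: "norm (hess_phiw f y u - hess_phiw f z u) \<le> \<tau> * norm (y - z) * norm u"
proof -
  have "norm ((hess_phiw f y - hess_phiw f z) u) \<le> norm (hess_phiw f y - hess_phiw f z) * norm u"
    by (rule norm_blinfun)
  also have "\<dots> \<le> \<tau> * norm (y - z) * norm u"
    using second_order unfolding second_order_smooth_def
    by (intro mult_right_mono norm_ge_zero) (metis UNIV_I dist_norm lipschitz_onD)
  finally show ?thesis
    by (simp add: blinfun.diff_left)
qed

text \<open>Partial derivatives alone do not give a total one; continuity of one of them, here the
  Lipschitz continuous \<open>hess_phiw f\<close>, does.\<close>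

lemma grad_w_has_derivative:
  "(grad_w f has_derivative (\<lambda>d. hess_ww f z (fst d) + hess_phiw f z (snd d))) (at z)"
proof -
  obtain w \<phi> where z: "z = (w, \<phi>)"
    by fastforce
  have "continuous_on UNIV (hess_phiw f)"
    using second_order unfolding second_order_smooth_def by (blast intro: lipschitz_on_continuous_on)
  then have "continuous (at (w, \<phi>) within UNIV \<times> UNIV) (\<lambda>(x, y). hess_phiw f (x, y))"
    by (simp add: continuous_on_eq_continuous_at)
  from has_derivative_partialsI[where f="\<lambda>x y. grad_w f (x, y)", OF hess_ww hess_phiw this]
  show ?thesis
    by (simp add: z case_prod_beta')
qed

lemma hess_phiw_norm_le: "norm (hess_phiw f z u) \<le> L * norm u"
proof -
  obtain w \<phi> where z: "z = (w, \<phi>)"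
    by fastforce
  show ?thesis
    unfolding z
    by (rule has_derivative_norm_le[OF hess_phiw]) (use grad_w_lipschitz[of "(w, _)" "(w, \<phi>)"] in \<open>simp add: norm_Pair\<close>)
qed

lemma hess_ww_symmetric: "hess_ww f z u \<bullet> v = u \<bullet> hess_ww f z v"
proof -
  obtain w \<phi> where z: "z = (w, \<phi>)"
    by fastforce
  show ?thesis
    unfolding z
    using hess_ww_lipschitz[of "(_, \<phi>)" _ "(_, \<phi>)"]
    by (intro lipschitz_hessian_symmetric[where H="\<lambda>w. hess_ww f (w, \<phi>)" and C=\<rho>, OF GDERIV_f_w hess_ww])
      (simp add: norm_Pair)
qed

text \<open>The stepsize gives \<open>\<alpha> * L \<le> 1\<close>, which keeps
  \<open>I - \<alpha> H\<close> positive semidefinite; strong convexity bounds its quadratic form by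
  \<kappa>. So \<open>self_adjoint_norm_le\<close> applies.\<close>

lemma step_contraction: "norm (u - \<alpha> *\<^sub>R hess_ww f z u) \<le> \<kappa> * norm u"
proof (rule self_adjoint_norm_le)
  obtain w \<phi> where z: "z = (w, \<phi>)"
    by fastforce
  have H: "norm (hess_ww f z u) \<le> L * norm u" for u
    unfolding z
    by (rule has_derivative_norm_le[OF hess_ww]) (use grad_w_lipschitz[of "(_, \<phi>)" "(w, \<phi>)"] in \<open>simp add: norm_Pair\<close>)
  show "linear (\<lambda>u. u - \<alpha> *\<^sub>R hess_ww f z u)"
    by (intro linearI) (simp_all add: blinfun.add_right blinfun.scaleR_right algebra_simps)
  show "(u - \<alpha> *\<^sub>R hess_ww f z u) \<bullet> v = u \<bullet> (v - \<alpha> *\<^sub>R hess_ww f z v)" for u v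
    by (simp add: inner_diff_left inner_diff_right hess_ww_symmetric)
  show "0 \<le> (u - \<alpha> *\<^sub>R hess_ww f z u) \<bullet> u" for u
  proof -
    have "hess_ww f z u \<bullet> u \<le> (L * norm u) * norm u"
      using norm_cauchy_schwarz[of "hess_ww f z u" u] H[of u] by (meson mult_right_mono norm_ge_zero order_trans)
    then have "\<alpha> * (hess_ww f z u \<bullet> u) \<le> \<alpha> * (L * norm u * norm u)"
      using \<alpha>_pos by simp
    also have "\<dots> \<le> 1 * (norm u * norm u)"
      using mult_right_mono[OF \<alpha>_L, of "norm u * norm u"] by (simp add: mult_ac)
    finally show ?thesis
      by (simp add: inner_diff_left dot_square_norm power2_eq_square)
  qed
  show "(u - \<alpha> *\<^sub>R hess_ww f z u) \<bullet> u \<le> \<kappa> * (norm u)\<^sup>2" for u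
  proof -
    have "\<mu> * (norm u)\<^sup>2 \<le> hess_ww f z u \<bullet> u"
      using strongly_convex_derivative_ge[OF convex GDERIV_f_w hess_ww] by (simp add: z)
    then have "\<alpha> * (\<mu> * (norm u)\<^sup>2) \<le> \<alpha> * (hess_ww f z u \<bullet> u)"
      using \<alpha>_pos by simp
    then show ?thesis
      by (simp add: \<kappa>_\<alpha> inner_diff_left dot_square_norm algebra_simps)
  qed
  show "0 \<le> \<kappa>"
    using \<kappa>_pos by simp
qed

section \<open>Reverse-mode and forward-mode derivatives of the inner loop\<close>

lemma inner_iter_Suc_front:
  "inner_iter \<alpha> f (w, \<phi>) (Suc n) = inner_iter \<alpha> f (w - \<alpha> *\<^sub>R grad_w f (w, \<phi>), \<phi>) n"
  by (induction n) auto

text \<open>\<open>task_grad\<close> peels off the first inner step, so the induction applies the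
  chain rule to that step and needs the hypothesis at the new starting point. Symmetry of the
  Hessian is what allows \<open>hess_ww\<close> to act on \<open>u\<close> directly, where the chain
  rule asks for its adjoint.\<close>

lemma task_grad_correct:
  assumes g: "smooth L g"
  shows "GDERIV (adapted_loss \<alpha> n f g) (w, \<phi>) :> fst (task_grad \<alpha> f g \<phi> n w)"
proof (induction n arbitrary: w)
  case 0
  have "GDERIV g (w, \<phi>) :> grad g (w, \<phi>)"
    using g by (auto simp: smooth_def intro: differentiable_GDERIV)
  moreover from this have "grad g (w, \<phi>) = (grad_w g (w, \<phi>), grad_phi g (w, \<phi>))"
    by (simp add: GDERIV_grad_w GDERIV_grad_phi)
  moreover have "adapted_loss \<alpha> 0 f g = g"
    by (simp add: adapted_loss_def fun_eq_iff)
  ultimately show ?case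
    by simp
next
  case (Suc n)
  define w' where "w' = w - \<alpha> *\<^sub>R grad_w f (w, \<phi>)"
  obtain u v c where t: "task_grad \<alpha> f g \<phi> n w' = ((u, v), c)"
    by (metis prod.collapse)
  let ?H = "hess_ww f (w, \<phi>)" and ?J = "hess_phiw f (w, \<phi>)"
  have eq: "adapted_loss \<alpha> (Suc n) f g = (\<lambda>z. adapted_loss \<alpha> n f g (fst z - \<alpha> *\<^sub>R grad_w f z, snd z))"
    by (simp add: adapted_loss_def fun_eq_iff inner_iter_Suc_front del: inner_iter.simps)
  have "((\<lambda>z. (fst z - \<alpha> *\<^sub>R grad_w f z, snd z)) has_derivative
      (\<lambda>d. (fst d - \<alpha> *\<^sub>R (?H (fst d) + ?J (snd d)), snd d))) (at (w, \<phi>))"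
    by (auto intro!: derivative_eq_intros grad_w_has_derivative)
  moreover have "(adapted_loss \<alpha> n f g has_derivative (\<lambda>h. h \<bullet> (u, v))) (at (fst (w, \<phi>) - \<alpha> *\<^sub>R grad_w f (w, \<phi>), snd (w, \<phi>)))"
    using Suc[of w'] t by (simp add: gderiv_def w'_def)
  ultimately have "(adapted_loss \<alpha> (Suc n) f g has_derivative
      (\<lambda>d. (fst d - \<alpha> *\<^sub>R (?H (fst d) + ?J (snd d)), snd d) \<bullet> (u, v))) (at (w, \<phi>))"
    unfolding eq by (rule has_derivative_compose)
  moreover have "fst (task_grad \<alpha> f g \<phi> (Suc n) w) = (u - \<alpha> *\<^sub>R ?H u, v - \<alpha> *\<^sub>R adjoint ?J u)"
    using t by (simp add: w'_def)
  moreover have "(fst d - \<alpha> *\<^sub>R (?H (fst d) + ?J (snd d)), snd d) \<bullet> (u, v)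
      = d \<bullet> (u - \<alpha> *\<^sub>R ?H u, v - \<alpha> *\<^sub>R adjoint ?J u)" for d
  proof -
    have "snd d \<bullet> adjoint ?J u = ?J (snd d) \<bullet> u"
      by (simp add: adjoint_works bounded_linear.linear blinfun.bounded_linear_right)
    then show ?thesis
      by (simp add: inner_prod_def inner_diff_left inner_diff_right inner_add_left hess_ww_symmetric algebra_simps)
  qed
  ultimately show ?case
    by (simp add: gderiv_def)
qed

text \<open>Forward-mode counterpart of \<open>task_grad\<close>. Norm estimates use this form: each
  step is a contraction plus a source term in the direction \<phi>.\<close>

primrec inner_deriv :: "nat \<Rightarrow> 'w \<times> 'p \<Rightarrow> 'w \<times> 'p \<Rightarrow> 'w" where
  "inner_deriv 0 z d = fst d"
| "inner_deriv (Suc m) z d =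
     inner_deriv m z d - \<alpha> *\<^sub>R (hess_ww f (inner_iter \<alpha> f z m, snd z) (inner_deriv m z d)
       + hess_phiw f (inner_iter \<alpha> f z m, snd z) (snd d))"

lemma inner_iter_has_derivative:
  "((\<lambda>z. inner_iter \<alpha> f z m) has_derivative inner_deriv m z) (at z)"
proof (induction m)
  case 0
  then show ?case
    by (auto intro!: derivative_eq_intros)
next
  case (Suc m)
  have "((\<lambda>z. (inner_iter \<alpha> f z m, snd z)) has_derivative (\<lambda>d. (inner_deriv m z d, snd d))) (at z)"
    using Suc by (auto intro!: derivative_eq_intros)
  from has_derivative_compose[OF this grad_w_has_derivative] Suc
  show ?case
    by (auto intro!: derivative_eq_intros)
qed

text \<open>Since \<open>1 - \<kappa> = \<alpha> * \<mu>\<close>, the stepsize cancels against the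
  geometric sum. This is why the number of inner steps leaves no trace in the \<phi>
  direction.\<close>

lemma \<alpha>_geometric: "\<alpha> * (\<Sum>j<m. \<kappa> ^ j) \<le> 1 / \<mu>"
proof -
  have "\<alpha> * \<mu> * (\<Sum>j<m. \<kappa> ^ j) = 1 - \<kappa> ^ m"
    using one_diff_power_eq[of \<kappa> m] by (simp add: \<kappa>_\<alpha>)
  also have "\<dots> \<le> 1"
    using \<kappa>_pos by simp
  finally show ?thesis
    using \<mu> by (simp add: field_simps)
qed

lemma inner_deriv_norm_le: "norm (inner_deriv m z d) \<le> \<kappa> ^ m * norm (fst d) + L / \<mu> * norm (snd d)"
proof -
  have "norm (inner_deriv m z d) \<le> \<kappa> ^ m * norm (fst d) + \<alpha> * (\<Sum>j<m. \<kappa> ^ j) * L * norm (snd d)"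
  proof (induction m)
    case (Suc m)
    let ?H = "hess_ww f (inner_iter \<alpha> f z m, snd z)" and ?J = "hess_phiw f (inner_iter \<alpha> f z m, snd z)"
    have "inner_deriv (Suc m) z d = (inner_deriv m z d - \<alpha> *\<^sub>R ?H (inner_deriv m z d)) - \<alpha> *\<^sub>R ?J (snd d)"
      by (simp add: algebra_simps)
    then have "norm (inner_deriv (Suc m) z d)
        \<le> norm (inner_deriv m z d - \<alpha> *\<^sub>R ?H (inner_deriv m z d)) + \<alpha> * norm (?J (snd d))"
      using norm_triangle_ineq4 \<alpha>_pos by (metis abs_of_pos norm_scaleR)
    also have "\<dots> \<le> \<kappa> * norm (inner_deriv m z d) + \<alpha> * (L * norm (snd d))"
      using \<alpha>_pos by (intro add_mono mult_left_mono step_contraction hess_phiw_norm_le) auto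
    also have "\<dots> \<le> \<kappa> * (\<kappa> ^ m * norm (fst d) + \<alpha> * (\<Sum>j<m. \<kappa> ^ j) * L * norm (snd d)) + \<alpha> * (L * norm (snd d))"
      using Suc \<kappa>_pos by simp
    also have "\<dots> = \<kappa> ^ Suc m * norm (fst d) + \<alpha> * (\<Sum>j<Suc m. \<kappa> ^ j) * L * norm (snd d)"
      by (simp add: sum.lessThan_Suc_shift sum_distrib_left algebra_simps del: sum.lessThan_Suc)
    finally show ?case .
  qed simp
  also have "\<dots> \<le> \<kappa> ^ m * norm (fst d) + (1 / \<mu>) * L * norm (snd d)"
    using \<alpha>_geometric \<mu> by (intro add_left_mono mult_right_mono) auto
  finally show ?thesis by simp
qed

text \<open>The pair is the point at which the derivatives of the losses are evaluated. The summand
  \<open>1\<close> beside \<open>L / \<mu>\<close> is the shift of its second component.\<close>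

lemma inner_iter_lipschitz:
  "norm ((inner_iter \<alpha> f (z + d) m, snd (z + d)) - (inner_iter \<alpha> f z m, snd z))
     \<le> \<kappa> ^ m * norm (fst d) + (1 + L / \<mu>) * norm (snd d)"
proof -
  have "norm ((inner_iter \<alpha> f (z + d) m, snd (z + d)) - (inner_iter \<alpha> f z m, snd z))
      \<le> norm (inner_iter \<alpha> f (z + d) m - inner_iter \<alpha> f z m) + norm (snd d)"
    by (simp add: norm_Pair) (meson norm_ge_zero order_trans sqrt_sum_squares_le_sum)
  also have "\<dots> \<le> (\<kappa> ^ m * norm (fst d) + L / \<mu> * norm (snd d)) + norm (snd d)"
    by (intro add_right_mono has_derivative_seminorm_lipschitz[OF inner_iter_has_derivative inner_deriv_norm_le])
  finally show ?thesis
    by (simp add: algebra_simps)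
qed

end

context inner_loop
begin

text \<open>The difference of the derivatives at two points is contracted by \<kappa> in each step
  and receives a source: the shift of the evaluation point, \<open>\<kappa> ^ m * a + l * b\<close>,
  times the size of the derivative, \<open>\<kappa> ^ m * s + L / \<mu> * t\<close>, plus a similar
  \<tau> term. Multiplied out, the sources decay like \<open>\<kappa> ^ (2 * m)\<close>,
  \<open>\<kappa> ^ m\<close> or not at all, which produces the three kinds of summands. The factor
  \<sigma> collects what multiplies \<open>t\<close>.\<close>

lemma inner_deriv_lipschitz:
  fixes z d e m
  defines "a \<equiv> norm (fst e)" and "b \<equiv> norm (snd e)" and "s \<equiv> norm (fst d)" and "t \<equiv> norm (snd d)"
    and "l \<equiv> 1 + L / \<mu>" and "\<sigma> \<equiv> \<rho> * (L / \<mu>) + \<tau>"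
  shows "norm (inner_deriv m (z + e) d - inner_deriv m z d)
    \<le> 1 / \<mu> * \<kappa> ^ (m - 1) * \<rho> * a * s + real m * \<kappa> ^ (m - 1) * \<alpha> * (\<sigma> * a * t + l * \<rho> * b * s)
      + 1 / \<mu> * l * \<sigma> * b * t"
proof -
  \<comment> \<open>\<open>S\<close>, \<open>R\<close> and \<open>Q\<close> solve the recursion
    \<open>x (Suc m) = \<kappa> * x m + source\<close> for the sources \<open>1\<close>,
    \<open>\<kappa> ^ m\<close> and \<open>\<kappa> ^ m * \<kappa> ^ m\<close>. The truncated
    exponent at \<open>m = 0\<close> is harmless, since there \<open>S m\<close> and
    \<open>real m\<close> vanish.\<close>
  define S where "S m = (\<Sum>j<m. \<kappa> ^ j)" for m
  define Q where "Q m = \<kappa> ^ (m - 1) * S m" for m :: nat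
  define R where "R m = real m * \<kappa> ^ (m - 1)" for m
  have S_Suc: "S (Suc m) = \<kappa> * S m + 1" for m
    by (simp add: S_def sum.lessThan_Suc_shift sum_distrib_left del: sum.lessThan_Suc)
  have Q_Suc: "Q (Suc m) = \<kappa> * Q m + \<kappa> ^ m * \<kappa> ^ m" for m
    by (cases m) (simp_all add: Q_def S_def algebra_simps)
  have R_Suc: "R (Suc m) = \<kappa> * R m + \<kappa> ^ m" for m
    by (cases m) (simp_all add: R_def algebra_simps)
  have nn: "0 \<le> a" "0 \<le> b" "0 \<le> s" "0 \<le> t" "0 \<le> l" "0 \<le> \<sigma>"
    using \<mu> \<rho>_nonneg \<tau>_nonneg by (auto simp: a_def b_def s_def t_def l_def \<sigma>_def)
  have "norm (inner_deriv m (z + e) d - inner_deriv m z d)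
    \<le> \<alpha> * (Q m * \<rho> * a * s + R m * (\<sigma> * a * t + l * \<rho> * b * s) + S m * l * \<sigma> * b * t)"
  proof (induction m)
    case 0
    show ?case
      by (simp add: S_def Q_def R_def)
  next
    case (Suc m)
    define y where "y = (inner_iter \<alpha> f z m, snd z)"
    define y' where "y' = (inner_iter \<alpha> f (z + e) m, snd (z + e))"
    define D where "D = inner_deriv m z d"
    define E where "E = inner_deriv m (z + e) d - D"
    have y: "norm (y' - y) \<le> \<kappa> ^ m * a + l * b"
      unfolding y_def y'_def a_def b_def l_def by (rule inner_iter_lipschitz)
    have D: "norm D \<le> \<kappa> ^ m * s + L / \<mu> * t"
      unfolding D_def s_def t_def by (rule inner_deriv_norm_le)
    \<comment> \<open>The Hessian at the shifted point \<open>y'\<close> acts on the whole error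
      \<open>E\<close>, so that \<open>step_contraction\<close> applies. Differences of Hessians
      then meet only the unshifted derivative \<open>D\<close>, whose size is known.\<close>
    have "inner_deriv (Suc m) (z + e) d - inner_deriv (Suc m) z d
        = (E - \<alpha> *\<^sub>R hess_ww f y' E)
          - \<alpha> *\<^sub>R ((hess_ww f y' D - hess_ww f y D) + (hess_phiw f y' (snd d) - hess_phiw f y (snd d)))"
      by (simp add: E_def D_def y_def y'_def blinfun.diff_right algebra_simps)
    also have "norm \<dots> \<le> norm (E - \<alpha> *\<^sub>R hess_ww f y' E)
          + \<alpha> * (norm (hess_ww f y' D - hess_ww f y D) + norm (hess_phiw f y' (snd d) - hess_phiw f y (snd d)))"
      using \<alpha>_pos by (intro norm_triangle_le_diff add_left_mono) (simp add: norm_triangle_ineq)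
    also have "\<dots> \<le> \<kappa> * norm E + \<alpha> * (\<rho> * norm (y' - y) * norm D + \<tau> * norm (y' - y) * norm (snd d))"
      using \<alpha>_pos by (intro add_mono mult_left_mono step_contraction hess_ww_lipschitz hess_phiw_lipschitz) auto
    also have "\<dots> \<le> \<kappa> * norm E
        + \<alpha> * (\<rho> * (\<kappa> ^ m * a + l * b) * (\<kappa> ^ m * s + L / \<mu> * t) + \<tau> * (\<kappa> ^ m * a + l * b) * t)"
      unfolding t_def[symmetric] using y D \<alpha>_pos \<rho>_nonneg \<tau>_nonneg nn \<kappa>_pos
      by (intro add_left_mono mult_left_mono add_mono mult_right_mono mult_mono) auto
    also have "\<dots> \<le> \<kappa> * (\<alpha> * (Q m * \<rho> * a * s + R m * (\<sigma> * a * t + l * \<rho> * b * s) + S m * l * \<sigma> * b * t))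
        + \<alpha> * (\<rho> * (\<kappa> ^ m * a + l * b) * (\<kappa> ^ m * s + L / \<mu> * t) + \<tau> * (\<kappa> ^ m * a + l * b) * t)"
      using Suc \<kappa>_pos by (simp add: E_def D_def)
    also have "\<dots> = \<alpha> * (Q (Suc m) * \<rho> * a * s + R (Suc m) * (\<sigma> * a * t + l * \<rho> * b * s) + S (Suc m) * l * \<sigma> * b * t)"
      unfolding S_Suc Q_Suc R_Suc \<sigma>_def by (simp only: distrib_left distrib_right mult_ac add_ac mult_1_left mult_1_right)
    finally show ?case .
  qed
  also have "\<dots> = (\<alpha> * S m) * (\<kappa> ^ (m - 1) * \<rho> * a * s) + R m * \<alpha> * (\<sigma> * a * t + l * \<rho> * b * s)
      + (\<alpha> * S m) * (l * \<sigma> * b * t)"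
    unfolding Q_def by (simp add: distrib_left mult_ac)
  also have "\<dots> \<le> 1 / \<mu> * (\<kappa> ^ (m - 1) * \<rho> * a * s) + R m * \<alpha> * (\<sigma> * a * t + l * \<rho> * b * s)
      + 1 / \<mu> * (l * \<sigma> * b * t)"
    unfolding S_def using nn \<rho>_nonneg \<kappa>_pos
    by (intro add_mono mult_right_mono \<alpha>_geometric order_refl) auto
  finally show ?thesis
    by (simp add: R_def mult_ac)
qed

end

section \<open>One task: gradient bounds and Taylor remainder of the adapted loss\<close>

locale adapted_task = inner_loop f \<mu> L \<rho> \<tau> \<alpha> \<kappa>
  for f :: "'w::euclidean_space \<times> 'p::euclidean_space \<Rightarrow> real" and \<mu> L \<rho> \<tau> \<alpha> \<kappa> +
  fixes g :: "'w \<times> 'p \<Rightarrow> real" and M :: real and N :: nat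
  assumes smooth_g: "smooth L g" and lipschitz_g: "M-lipschitz_on UNIV g"
begin

abbreviation "A \<equiv> adapted_loss \<alpha> N f g"
abbreviation "\<Gamma> z \<equiv> (grad_w A z, grad_phi A z)"

lemma M_nonneg: "0 \<le> M"
  using lipschitz_g by (rule lipschitz_on_nonneg)

lemma GDERIV_g: "GDERIV g z :> grad g z"
  using smooth_g unfolding smooth_def by (blast intro: differentiable_GDERIV)

lemma grad_g_norm_le: "norm (grad g z) \<le> M"
  using GDERIV_g lipschitz_g by (rule GDERIV_norm_le)

lemma task_grad_eq: "fst (task_grad \<alpha> f g (snd z) N (fst z)) = \<Gamma> z"
  using task_grad_correct[OF smooth_g, of N "fst z" "snd z"] by (simp add: GDERIV_grad_w GDERIV_grad_phi)

lemma GDERIV_adapted: "GDERIV A z :> \<Gamma> z"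
  using task_grad_correct[OF smooth_g, of N "fst z" "snd z"] task_grad_eq[of z] by simp

text \<open>Reverse and forward mode compute the same derivative, hence agree by uniqueness. This
  transfers the estimates for \<open>inner_deriv\<close> to the gradient.\<close>

lemma inner_grad_adapted:
  "d \<bullet> \<Gamma> z = (inner_deriv N z d, snd d) \<bullet> grad g (inner_iter \<alpha> f z N, snd z)"
proof -
  have "((\<lambda>z. (inner_iter \<alpha> f z N, snd z)) has_derivative (\<lambda>d. (inner_deriv N z d, snd d))) (at z)"
    by (auto intro!: derivative_eq_intros inner_iter_has_derivative)
  from has_derivative_compose[OF this GDERIV_g[unfolded gderiv_def]]
  have "(A has_derivative (\<lambda>d. (inner_deriv N z d, snd d) \<bullet> grad g (inner_iter \<alpha> f z N, snd z))) (at z)"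
    by (simp add: adapted_loss_def[abs_def])
  from has_derivative_unique[OF GDERIV_adapted[of z, unfolded gderiv_def] this] show ?thesis
    by (rule fun_cong)
qed

text \<open>Testing the gradient against itself, as \<open>d = (grad_w A z, 0)\<close>, isolates the
  \<open>w\<close> block; one factor of the norm then cancels. The \<phi> block below is treated
  alike.\<close>

lemma norm_grad_w_le: "norm (grad_w A z) \<le> M * \<kappa> ^ N"
proof -
  define d where "d = (grad_w A z, 0 :: 'p)"
  have "norm (grad_w A z) * norm (grad_w A z) = d \<bullet> \<Gamma> z"
    by (simp add: d_def dot_square_norm power2_eq_square)
  also have "\<dots> \<le> norm (inner_deriv N z d, snd d) * norm (grad g (inner_iter \<alpha> f z N, snd z))"
    unfolding inner_grad_adapted by (rule norm_cauchy_schwarz)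
  also have "\<dots> \<le> (\<kappa> ^ N * norm (grad_w A z)) * M"
    using inner_deriv_norm_le[of N z d] grad_g_norm_le \<kappa>_pos M_nonneg
    by (intro mult_mono) (auto simp: d_def)
  finally have "norm (grad_w A z) * norm (grad_w A z) \<le> (M * \<kappa> ^ N) * norm (grad_w A z)"
    by (simp add: mult_ac)
  then show ?thesis
    using M_nonneg \<kappa>_pos by (cases "grad_w A z = 0") auto
qed

lemma norm_grad_phi_le: "norm (grad_phi A z) \<le> M * (1 + L / \<mu>)"
proof -
  define d where "d = (0 :: 'w, grad_phi A z)"
  have "norm (inner_deriv N z d, snd d) \<le> norm (inner_deriv N z d) + norm (snd d)"
    by (rule norm_Pair_le)
  also have "\<dots> \<le> (1 + L / \<mu>) * norm (grad_phi A z)"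
    using inner_deriv_norm_le[of N z d] by (simp add: d_def algebra_simps)
  finally have *: "norm (inner_deriv N z d, snd d) \<le> (1 + L / \<mu>) * norm (grad_phi A z)" .
  have "norm (grad_phi A z) * norm (grad_phi A z) = d \<bullet> \<Gamma> z"
    by (simp add: d_def dot_square_norm power2_eq_square)
  also have "\<dots> \<le> norm (inner_deriv N z d, snd d) * norm (grad g (inner_iter \<alpha> f z N, snd z))"
    unfolding inner_grad_adapted by (rule norm_cauchy_schwarz)
  also have "\<dots> \<le> ((1 + L / \<mu>) * norm (grad_phi A z)) * M"
    using * grad_g_norm_le \<mu> M_nonneg by (intro mult_mono) auto
  finally have "norm (grad_phi A z) * norm (grad_phi A z) \<le> (M * (1 + L / \<mu>)) * norm (grad_phi A z)"
    by (simp add: mult_ac)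
  then show ?thesis
    using M_nonneg \<mu> by (cases "grad_phi A z = 0") auto
qed

text \<open>Product rule for differences: the change of \<open>grad g\<close> is paired with the
  derivative at the shifted point and uses the Lipschitz constant \<open>L\<close>; the change of
  the derivative is paired with \<open>grad g\<close>, of norm at most \<open>M\<close>. The bound
  is bilinear in \<open>(a, b)\<close> and \<open>(s, t)\<close>, so it covers all blocks of the
  second derivative at once.\<close>

lemma grad_adapted_lipschitz:
  fixes z d e
  defines "a \<equiv> norm (fst e)" and "b \<equiv> norm (snd e)" and "s \<equiv> norm (fst d)" and "t \<equiv> norm (snd d)"
    and "l \<equiv> 1 + L / \<mu>" and "\<sigma> \<equiv> \<rho> * (L / \<mu>) + \<tau>"
  shows "\<bar>d \<bullet> \<Gamma> (z + e) - d \<bullet> \<Gamma> z\<bar> \<le> L * (\<kappa> ^ N * a + l * b) * (\<kappa> ^ N * s + l * t)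
    + M * (1 / \<mu> * \<kappa> ^ (N - 1) * \<rho> * a * s + real N * \<kappa> ^ (N - 1) * \<alpha> * (\<sigma> * a * t + l * \<rho> * b * s)
      + 1 / \<mu> * l * \<sigma> * b * t)"
proof -
  define y where "y = (inner_iter \<alpha> f z N, snd z)"
  define y' where "y' = (inner_iter \<alpha> f (z + e) N, snd (z + e))"
  define h where "h = (inner_deriv N (z + e) d, snd d)"
  define E where "E = inner_deriv N (z + e) d - inner_deriv N z d"
  have nn: "0 \<le> a" "0 \<le> b" "0 \<le> s" "0 \<le> t" "0 < l"
    using \<mu> by (auto simp: a_def b_def s_def t_def l_def add_pos_pos)
  have "norm (grad g y' - grad g y) \<le> L * norm (y' - y)"
    using smooth_g unfolding smooth_def by (metis UNIV_I dist_norm lipschitz_onD)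
  also have "\<dots> \<le> L * (\<kappa> ^ N * a + l * b)"
    using inner_iter_lipschitz[of z e N] \<mu> by (simp add: y_def y'_def a_def b_def l_def)
  finally have 1: "norm (grad g y' - grad g y) \<le> L * (\<kappa> ^ N * a + l * b)" .
  have 2: "norm h \<le> \<kappa> ^ N * s + l * t"
    using norm_Pair_le[of "inner_deriv N (z + e) d" "snd d"] inner_deriv_norm_le[of N "z + e" d]
    by (simp add: h_def s_def t_def l_def algebra_simps)
  have "d \<bullet> \<Gamma> (z + e) - d \<bullet> \<Gamma> z = h \<bullet> (grad g y' - grad g y) + (E, 0) \<bullet> grad g y"
    unfolding inner_grad_adapted h_def E_def y_def y'_def
    by (simp add: inner_diff_right inner_prod_def inner_diff_left)
  also have "\<bar>\<dots>\<bar> \<le> \<bar>h \<bullet> (grad g y' - grad g y)\<bar> + \<bar>(E, 0) \<bullet> grad g y\<bar>"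
    by (rule abs_triangle_ineq)
  also have "\<dots> \<le> norm (grad g y' - grad g y) * norm h + M * norm E"
  proof (rule add_mono)
    show "\<bar>h \<bullet> (grad g y' - grad g y)\<bar> \<le> norm (grad g y' - grad g y) * norm h"
      by (metis Cauchy_Schwarz_ineq2 mult.commute)
    have "\<bar>(E, 0) \<bullet> grad g y\<bar> \<le> norm (E, 0::'p) * norm (grad g y)"
      by (rule Cauchy_Schwarz_ineq2)
    also have "\<dots> \<le> norm E * M"
      using grad_g_norm_le by (simp add: mult_left_mono)
    finally show "\<bar>(E, 0) \<bullet> grad g y\<bar> \<le> M * norm E"
      by (simp add: mult.commute)
  qed
  also have "\<dots> \<le> L * (\<kappa> ^ N * a + l * b) * (\<kappa> ^ N * s + l * t)
    + M * (1 / \<mu> * \<kappa> ^ (N - 1) * \<rho> * a * s + real N * \<kappa> ^ (N - 1) * \<alpha> * (\<sigma> * a * t + l * \<rho> * b * s)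
      + 1 / \<mu> * l * \<sigma> * b * t)"
    using M_nonneg nn \<mu> \<kappa>_pos
    by (intro add_mono mult_left_mono mult_mono 1 2)
      (use inner_deriv_lipschitz[of N z e d] in \<open>auto simp: E_def a_def b_def s_def t_def l_def \<sigma>_def\<close>)
  finally show ?thesis .
qed

text \<open>The mean value theorem expresses the increment by the gradient at some
  \<open>z + t *\<^sub>R d\<close>. Bounding \<open>t\<close> by \<open>1\<close> gives up the usual
  factor 1/2.\<close>

lemma adapted_quadratic:
  fixes z d
  defines "a \<equiv> norm (fst d)" and "b \<equiv> norm (snd d)" and "l \<equiv> 1 + L / \<mu>" and "\<sigma> \<equiv> \<rho> * (L / \<mu>) + \<tau>"
  shows "\<bar>A (z + d) - A z - d \<bullet> \<Gamma> z\<bar> \<le> L * (\<kappa> ^ N * a + l * b) * (\<kappa> ^ N * a + l * b)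
    + M * (1 / \<mu> * \<kappa> ^ (N - 1) * \<rho> * a * a + real N * \<kappa> ^ (N - 1) * \<alpha> * (\<sigma> * a * b + l * \<rho> * b * a)
      + 1 / \<mu> * l * \<sigma> * b * b)" (is "_ \<le> ?Q")
proof -
  have "((\<lambda>t. A (z + t *\<^sub>R d)) has_derivative (\<lambda>h. (h *\<^sub>R d) \<bullet> \<Gamma> (z + t *\<^sub>R d))) (at t within {0..1})" for t
    by (rule has_derivative_compose[OF _ GDERIV_adapted[unfolded gderiv_def]]) (auto intro!: derivative_eq_intros)
  then have "\<exists>t\<in>{0<..<1}. A (z + 1 *\<^sub>R d) - A (z + 0 *\<^sub>R d) = ((1 - 0) *\<^sub>R d) \<bullet> \<Gamma> (z + t *\<^sub>R d)"
    by (intro mvt_simple) auto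
  then obtain t :: real where t: "0 < t" "t < 1" and eq: "A (z + d) - A z = d \<bullet> \<Gamma> (z + t *\<^sub>R d)"
    by auto
  have nn: "0 \<le> a" "0 \<le> b" "0 < l" "0 \<le> \<sigma>"
    using \<mu> \<rho>_nonneg \<tau>_nonneg by (auto simp: a_def b_def l_def \<sigma>_def add_pos_pos)
  have ta: "t * a \<le> a" "t * b \<le> b"
    using t nn by (auto simp: mult_left_le_one_le)
  have "\<bar>A (z + d) - A z - d \<bullet> \<Gamma> z\<bar> \<le> L * (\<kappa> ^ N * (t * a) + l * (t * b)) * (\<kappa> ^ N * a + l * b)
    + M * (1 / \<mu> * \<kappa> ^ (N - 1) * \<rho> * (t * a) * a
      + real N * \<kappa> ^ (N - 1) * \<alpha> * (\<sigma> * (t * a) * b + l * \<rho> * (t * b) * a)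
      + 1 / \<mu> * l * \<sigma> * (t * b) * b)"
    unfolding eq using grad_adapted_lipschitz[of d z "t *\<^sub>R d"] t
    by (simp add: a_def b_def l_def \<sigma>_def)
  also have "\<dots> \<le> ?Q"
    using ta nn \<mu> M_nonneg \<rho>_nonneg \<kappa>_pos \<alpha>_pos
    by (intro add_mono mult_left_mono mult_right_mono) auto
  finally show ?thesis .
qed

end

section \<open>Powers of \<kappa> against the rate factor\<close>

lemma Suc_mult_power_le:
  fixes p :: real
  assumes "0 \<le> p" "p \<le> 1"
  shows "real (Suc n) * p ^ n * (1 - p) \<le> 1"
proof -
  \<comment> \<open>Each of the \<open>Suc n\<close> powers in the geometric sum is at least
    \<open>p ^ n\<close>, and \<open>1 - p\<close> telescopes the sum.\<close>
  have "real (Suc n) * p ^ n = (\<Sum>j<Suc n. p ^ n)"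
    by simp
  also have "\<dots> \<le> (\<Sum>j<Suc n. p ^ j)"
    using assms by (intro sum_mono power_decreasing) auto
  finally have "real (Suc n) * p ^ n * (1 - p) \<le> (\<Sum>j<Suc n. p ^ j) * (1 - p)"
    using assms by (intro mult_right_mono) auto
  also have "\<dots> = 1 - p ^ Suc n"
    using one_diff_power_eq[of p "Suc n"] by (simp only: mult.commute)
  also have "\<dots> \<le> 1"
    using assms by simp
  finally show ?thesis .
qed

context inner_loop
begin

context
  fixes \<theta> c p :: real and N :: nat
  assumes \<theta>: "0 < \<theta>" "\<theta> < 1" and N: "1 \<le> N" and \<mu>\<theta>: "N = 1 \<Longrightarrow> \<mu> \<le> \<theta> * L"
    and c: "c = 1 / sqrt (1 - \<theta>\<^sup>2)" and p: "p = sqrt \<kappa>"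
begin

lemma c_ge_1: "1 \<le> c"
proof -
  have "0 < 1 - \<theta>\<^sup>2" "1 - \<theta>\<^sup>2 \<le> 1"
    using \<theta> by (auto simp: power_less_one_iff abs_square_less_1)
  then show ?thesis
    by (auto simp: c)
qed

lemma p_bounds: "0 < p" "p < 1" and p_sq: "p\<^sup>2 = \<kappa>"
  using \<kappa>_pos \<kappa>_less by (auto simp: p)

text \<open>The bound on \<open>\<mu> / L\<close> says that
  \<open>\<kappa> \<ge> 1 - \<theta>\<^sup>2\<close>; this is the origin of
  \<open>c\<close>.\<close>

lemma c_p_ge_1: "1 \<le> c * p" if "N = 1"
proof -
  have L: "0 < L"
    using \<mu> by simp
  have "0 < 1 - \<theta>\<^sup>2"
    using \<theta> by (simp add: abs_square_less_1)
  moreover have "\<mu>\<^sup>2 / L\<^sup>2 \<le> \<theta>\<^sup>2"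
    using power_mono[OF \<mu>\<theta>[OF that], of 2] \<mu> L by (simp add: divide_le_eq power_mult_distrib)
  ultimately have "sqrt (1 - \<theta>\<^sup>2) \<le> p" "0 < sqrt (1 - \<theta>\<^sup>2)"
    by (auto simp: p \<kappa>)
  then show ?thesis
    by (simp add: c)
qed

text \<open>In powers of \<open>p\<close> the exponent on the left is \<open>2 * (N - 1)\<close>,
  which is at least \<open>N\<close> except for \<open>N = 1\<close>. There the left side is
  \<open>1\<close>, and \<open>c\<close> makes up for the missing factor \<open>p\<close>.\<close>

lemma \<kappa>_power_le: "\<kappa> ^ (N - 1) \<le> c * p ^ N"
proof (cases "N = 1")
  case True
  then show ?thesis
    using c_p_ge_1 by simp
next
  case False
  then have "\<kappa> ^ (N - 1) \<le> p ^ N"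
    using N p_bounds unfolding p_sq[symmetric] power_mult[symmetric] by (intro power_decreasing) auto
  also have "\<dots> \<le> c * p ^ N"
    using mult_right_mono[OF c_ge_1, of "p ^ N"] p_bounds by simp
  finally show ?thesis .
qed

text \<open>Since \<open>\<alpha> = (1 - \<kappa>) / \<mu>\<close>, the growth of \<open>N\<close>
  is to be absorbed by \<open>1 - \<kappa>\<close>. With \<open>N = n + 2\<close>,
  \<open>\<kappa> ^ (N - 1)\<close> splits as \<open>p ^ n * p ^ N\<close>: the first factor pays
  for \<open>N * (1 - p)\<close>, the second is the decay to be kept. The constant 4 comes from
  \<open>N \<le> 2 * (n + 1)\<close> and \<open>1 + p \<le> 2\<close>.\<close>

lemma N_\<kappa>_power_le: "real N * \<kappa> ^ (N - 1) * \<alpha> \<le> 4 * c * p ^ N / \<mu>"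
proof -
  have "real N * \<kappa> ^ (N - 1) * (1 - \<kappa>) \<le> 4 * c * p ^ N"
  proof (cases "N = 1")
    case True
    then have "1 \<le> c * p"
      by (rule c_p_ge_1)
    then show ?thesis
      using True \<kappa>_pos by simp
  next
    case False
    then obtain n where n: "N = Suc (Suc n)"
      using N by (metis One_nat_def Suc_le_D not_less_eq_eq le_antisym)
    have "real N * p ^ n * (1 - p) * (1 + p) \<le> (2 * real (Suc n)) * p ^ n * (1 - p) * (1 + p)"
      using p_bounds by (intro mult_right_mono) (auto simp: n)
    also have "\<dots> = 2 * (real (Suc n) * p ^ n * (1 - p)) * (1 + p)"
      by (simp only: mult.assoc)
    also have "\<dots> \<le> 2 * 2"
      using Suc_mult_power_le[of p n] p_bounds by (intro mult_mono) auto
    finally have "(real N * p ^ n * (1 - p) * (1 + p)) * p ^ N \<le> 4 * p ^ N"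
      using p_bounds by (intro mult_right_mono) auto
    moreover have "real N * \<kappa> ^ (N - 1) * (1 - \<kappa>) = (real N * p ^ n * (1 - p) * (1 + p)) * p ^ N"
    proof -
      have "\<kappa> ^ (N - 1) = p ^ n * p ^ N"
        unfolding p_sq[symmetric] power_mult[symmetric] power_add[symmetric] by (simp add: n mult_2)
      moreover have "1 - \<kappa> = (1 - p) * (1 + p)"
        unfolding p_sq[symmetric] by (simp add: algebra_simps power2_eq_square)
      ultimately show ?thesis
        by (simp only: mult_ac)
    qed
    moreover have "4 * p ^ N \<le> 4 * c * p ^ N"
      using mult_right_mono[OF c_ge_1, of "p ^ N"] p_bounds by simp
    ultimately show ?thesis
      by linarith
  qed
  moreover have "\<alpha> = (1 - \<kappa>) / \<mu>"
    using \<mu> by (simp add: \<kappa>_\<alpha>)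
  ultimately show ?thesis
    using \<mu> by (simp add: divide_right_mono)
qed

end
end

context adapted_task
begin

text \<open>Collects the coefficients of the three blocks. Factors \<open>L / \<mu> \<ge> 1\<close>
  raise all contributions to a block to the same power of \<open>1 / \<mu>\<close>, after which
  polynomials in the constants are absorbed by powers of \<open>S\<close>.\<close>

lemma adapted_quadratic_explicit:
  fixes z d :: "'w \<times> 'p" and S \<theta> c r :: real
  assumes \<theta>: "0 < \<theta>" "\<theta> < 1" and N: "1 \<le> N" and \<mu>\<theta>: "N = 1 \<Longrightarrow> \<mu> \<le> \<theta> * L"
  defines "c \<equiv> 1 / sqrt (1 - \<theta>\<^sup>2)" and "r \<equiv> sqrt \<kappa> ^ N" and "S \<equiv> 1 + \<rho> + \<tau> + L + M"
  defines "a \<equiv> norm (fst d)" and "b \<equiv> norm (snd d)"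
  shows "\<bar>A (z + d) - A z - d \<bullet> \<Gamma> z\<bar>
    \<le> c * S\<^sup>2 * r / \<mu> * a\<^sup>2 + 4 * c * S ^ 3 * r / \<mu>\<^sup>2 * (a * b) + 4 * S ^ 4 / \<mu> ^ 3 * b\<^sup>2"
proof -
  define l where "l = 1 + L / \<mu>"
  define \<sigma> where "\<sigma> = \<rho> * (L / \<mu>) + \<tau>"
  have c: "1 \<le> c" and \<kappa>N: "\<kappa> ^ (N - 1) \<le> c * r" and N\<kappa>: "real N * \<kappa> ^ (N - 1) * \<alpha> \<le> 4 * c * r / \<mu>"
    unfolding c_def r_def using c_ge_1 \<kappa>_power_le N_\<kappa>_power_le \<theta> N \<mu>\<theta> by auto
  have r: "0 < r" "r \<le> 1" "\<kappa> ^ N = r\<^sup>2"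
    using \<kappa>_pos \<kappa>_less by (auto simp: r_def power_le_one power_mult power2_eq_square simp flip: power_mult_distrib)
  have nn: "0 < \<mu>" "\<mu> \<le> L" "0 < L" "0 \<le> \<rho>" "0 \<le> \<tau>" "0 \<le> M" "0 \<le> a" "0 \<le> b"
    using \<mu> \<rho>_nonneg \<tau>_nonneg M_nonneg by (auto simp: a_def b_def)
  have q: "1 \<le> L / \<mu>"
    using nn by simp
  have l: "0 < l" "l \<le> 2 * (L / \<mu>)"
    unfolding l_def using q by linarith+
  \<comment> \<open>Here \<open>\<kappa> ^ N\<close> is even \<open>r\<^sup>2\<close>; the factors
    \<open>c\<close> and \<open>L / \<mu>\<close> are inserted to match the terms that come from
    \<open>M\<close>.\<close>
  have \<kappa>_le: "\<kappa> ^ N \<le> c * r * (L / \<mu>)"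
  proof -
    have "r * r \<le> 1 * r"
      using r by (intro mult_right_mono) auto
    also have "\<dots> \<le> (c * (L / \<mu>)) * r"
      using mult_mono[OF c q] r c by (intro mult_right_mono) auto
    finally show ?thesis
      using r by (simp add: power2_eq_square mult_ac)
  qed
  have \<sigma>: "0 \<le> \<sigma>" "\<sigma> \<le> (\<rho> + \<tau>) * (L / \<mu>)"
  proof -
    show "0 \<le> \<sigma>"
      using nn by (auto simp: \<sigma>_def)
    show "\<sigma> \<le> (\<rho> + \<tau>) * (L / \<mu>)"
      unfolding \<sigma>_def distrib_right using mult_left_mono[OF q, of \<tau>] nn by linarith
  qed
  have S: "L \<le> S" "1 \<le> S"
    using nn by (auto simp: S_def)
  \<comment> \<open>The square of \<open>S\<close> contains \<open>M * \<rho>\<close> only twice;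
    the third copy is taken from the squares of \<open>M\<close> and \<rho>, which leave
    \<open>(M - \<rho>)\<^sup>2\<close> after completion.\<close>
  have poly1: "L\<^sup>2 + 3 * M * \<rho> + M * \<tau> \<le> S\<^sup>2"
  proof -
    have "S\<^sup>2 = L\<^sup>2 + 3 * M * \<rho> + M * \<tau> + ((M - \<rho>)\<^sup>2 + M * \<rho> + M * \<tau> + (1 + 2 * \<rho> + 2 * \<tau> + 2 * L + 2 * M + \<tau>\<^sup>2
        + 2 * \<rho> * \<tau> + 2 * \<rho> * L + 2 * \<tau> * L + 2 * L * M))"
      by (simp add: S_def power2_eq_square algebra_simps)
    moreover have "0 \<le> (M - \<rho>)\<^sup>2 + M * \<rho> + M * \<tau> + (1 + 2 * \<rho> + 2 * \<tau> + 2 * L + 2 * M + \<tau>\<^sup>2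
        + 2 * \<rho> * \<tau> + 2 * \<rho> * L + 2 * \<tau> * L + 2 * L * M)"
      using nn by (intro add_nonneg_nonneg mult_nonneg_nonneg) auto
    ultimately show ?thesis by linarith
  qed
  have aa: "L * (\<kappa> ^ N * \<kappa> ^ N) + M * (1 / \<mu> * \<kappa> ^ (N - 1) * \<rho>) \<le> c * S\<^sup>2 * r / \<mu>"
  proof -
    have "\<kappa> ^ N * \<kappa> ^ N \<le> 1 * \<kappa> ^ N"
      using r by (intro mult_right_mono) (auto simp: power_le_one)
    also have "\<dots> \<le> c * r * (L / \<mu>)"
      using \<kappa>_le by simp
    finally have "L * (\<kappa> ^ N * \<kappa> ^ N) \<le> L * (c * r * (L / \<mu>))"
      using nn by (intro mult_left_mono) auto
    moreover have "M * (1 / \<mu> * \<kappa> ^ (N - 1) * \<rho>) \<le> M * (1 / \<mu> * (c * r) * \<rho>)"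
      using nn \<kappa>N by (intro mult_left_mono mult_right_mono) auto
    moreover have "L * (c * r * (L / \<mu>)) + M * (1 / \<mu> * (c * r) * \<rho>) = (c * r / \<mu>) * (L\<^sup>2 + M * \<rho>)"
      by (simp add: algebra_simps power2_eq_square)
    ultimately have "L * (\<kappa> ^ N * \<kappa> ^ N) + M * (1 / \<mu> * \<kappa> ^ (N - 1) * \<rho>) \<le> (c * r / \<mu>) * (L\<^sup>2 + M * \<rho>)"
      by linarith
    also have "\<dots> \<le> (c * r / \<mu>) * S\<^sup>2"
      using poly1 nn r c by (intro mult_left_mono) (auto intro: order_trans[rotated])
    finally show ?thesis by (simp add: mult_ac)
  qed
  have ab: "2 * L * \<kappa> ^ N * l + M * (real N * \<kappa> ^ (N - 1) * \<alpha> * (\<sigma> + l * \<rho>)) \<le> 4 * c * S ^ 3 * r / \<mu>\<^sup>2"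
  proof -
    have "2 * L * \<kappa> ^ N * l \<le> 2 * L * (c * r * (L / \<mu>)) * (2 * (L / \<mu>))"
      using nn l r c \<kappa>_le by (intro mult_mono mult_left_mono) auto
    moreover have "M * (real N * \<kappa> ^ (N - 1) * \<alpha> * (\<sigma> + l * \<rho>))
      \<le> M * ((4 * c * r / \<mu>) * ((\<rho> + \<tau>) * (L / \<mu>) + 2 * (L / \<mu>) * \<rho>))"
      using nn l r c \<sigma> \<alpha>_pos N\<kappa> by (intro mult_left_mono mult_mono add_mono mult_right_mono) auto
    moreover have "2 * L * (c * r * (L / \<mu>)) * (2 * (L / \<mu>)) = (4 * c * r / \<mu>\<^sup>2) * (L * L\<^sup>2)"
      by (simp add: algebra_simps power2_eq_square)
    moreover have "M * ((4 * c * r / \<mu>) * ((\<rho> + \<tau>) * (L / \<mu>) + 2 * (L / \<mu>) * \<rho>))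
       = (4 * c * r / \<mu>\<^sup>2) * (L * (3 * M * \<rho> + M * \<tau>))"
      by (simp add: algebra_simps power2_eq_square add_divide_distrib)
    ultimately have "2 * L * \<kappa> ^ N * l + M * (real N * \<kappa> ^ (N - 1) * \<alpha> * (\<sigma> + l * \<rho>))
      \<le> (4 * c * r / \<mu>\<^sup>2) * (L * (L\<^sup>2 + 3 * M * \<rho> + M * \<tau>))"
      by (simp only: distrib_left add.assoc)
    also have "\<dots> \<le> (4 * c * r / \<mu>\<^sup>2) * (S * S\<^sup>2)"
      using poly1 S nn r c by (intro mult_left_mono mult_mono) auto
    finally show ?thesis by (simp add: mult_ac power3_eq_cube power2_eq_square)
  qed
  have bb: "L * (l * l) + M * (1 / \<mu> * l * \<sigma>) \<le> 4 * S ^ 4 / \<mu> ^ 3"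
  proof -
    have "L * (l * l) \<le> L * ((2 * (L / \<mu>)) * (2 * (L / \<mu>)))"
      using nn l by (intro mult_left_mono mult_mono) auto
    \<comment> \<open>This term is only of order \<open>1 / \<mu>\<^sup>2\<close>; a factor
      \<open>L / \<mu>\<close> lifts it to \<open>1 / \<mu> ^ 3\<close>.\<close>
    also have "\<dots> \<le> L * ((2 * (L / \<mu>)) * (2 * (L / \<mu>))) * (L / \<mu>)"
      using mult_left_mono[OF q, of "L * ((2 * (L / \<mu>)) * (2 * (L / \<mu>)))"] nn by simp
    finally have "L * (l * l) \<le> 4 * L\<^sup>2 * L\<^sup>2 / \<mu> ^ 3"
      by (simp add: power2_eq_square power3_eq_cube mult_ac)
    moreover have "M * (1 / \<mu> * l * \<sigma>) \<le> M * (1 / \<mu> * (2 * (L / \<mu>)) * ((\<rho> + \<tau>) * (L / \<mu>)))"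
      using nn l \<sigma> by (intro mult_left_mono mult_mono) auto
    then have "M * (1 / \<mu> * l * \<sigma>) \<le> 2 * M * (\<rho> + \<tau>) * L\<^sup>2 / \<mu> ^ 3"
      by (simp add: power2_eq_square power3_eq_cube mult_ac)
    moreover have "4 * L\<^sup>2 * L\<^sup>2 / \<mu> ^ 3 + 2 * M * (\<rho> + \<tau>) * L\<^sup>2 / \<mu> ^ 3
       = (4 / \<mu> ^ 3) * (L\<^sup>2 * (L\<^sup>2 + M * \<rho> / 2 + M * \<tau> / 2))"
      by (simp add: algebra_simps add_divide_distrib)
    ultimately have "L * (l * l) + M * (1 / \<mu> * l * \<sigma>) \<le> (4 / \<mu> ^ 3) * (L\<^sup>2 * (L\<^sup>2 + M * \<rho> / 2 + M * \<tau> / 2))"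
      by linarith
    also have "\<dots> \<le> (4 / \<mu> ^ 3) * (S\<^sup>2 * S\<^sup>2)"
    proof (intro mult_left_mono mult_mono)
      have "0 \<le> M * \<rho>" "0 \<le> M * \<tau>"
        using nn by auto
      then show "L\<^sup>2 + M * \<rho> / 2 + M * \<tau> / 2 \<le> S\<^sup>2"
        using poly1 by (simp add: mult.assoc)
      show "L\<^sup>2 \<le> S\<^sup>2" using S nn by (intro power_mono) auto
    qed (use nn in auto)
    finally show ?thesis by (simp add: mult_ac flip: power_add)
  qed
  have "\<bar>A (z + d) - A z - d \<bullet> \<Gamma> z\<bar> \<le> L * (\<kappa> ^ N * a + l * b) * (\<kappa> ^ N * a + l * b)
    + M * (1 / \<mu> * \<kappa> ^ (N - 1) * \<rho> * a * a + real N * \<kappa> ^ (N - 1) * \<alpha> * (\<sigma> * a * b + l * \<rho> * b * a)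
      + 1 / \<mu> * l * \<sigma> * b * b)"
    unfolding a_def b_def l_def \<sigma>_def by (rule adapted_quadratic)
  also have "\<dots> = (L * (\<kappa> ^ N * \<kappa> ^ N) + M * (1 / \<mu> * \<kappa> ^ (N - 1) * \<rho>)) * a\<^sup>2
     + (2 * L * \<kappa> ^ N * l + M * (real N * \<kappa> ^ (N - 1) * \<alpha> * (\<sigma> + l * \<rho>))) * (a * b)
     + (L * (l * l) + M * (1 / \<mu> * l * \<sigma>)) * b\<^sup>2"
    by (simp add: distrib_left distrib_right power2_eq_square)
  also have "\<dots> \<le> c * S\<^sup>2 * r / \<mu> * a\<^sup>2 + 4 * c * S ^ 3 * r / \<mu>\<^sup>2 * (a * b) + 4 * S ^ 4 / \<mu> ^ 3 * b\<^sup>2"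
    using aa ab bb nn by (intro add_mono mult_right_mono) auto
  finally show ?thesis .
qed

end

subsection \<open>Measurability and batches of independent draws\<close>

text \<open>The gradient is the pointwise limit of difference quotients along the basis vectors, and
  these are jointly measurable in the task and the point.\<close>

lemma borel_measurable_grad:
  fixes f :: "'i \<Rightarrow> 'a::euclidean_space \<Rightarrow> real"
  assumes f: "(\<lambda>(i, z). f i z) \<in> borel_measurable (T \<Otimes>\<^sub>M borel)"
    and diff: "\<And>i z. i \<in> space T \<Longrightarrow> f i differentiable at z"
  shows "(\<lambda>(i, z). grad (f i) z) \<in> borel_measurable (T \<Otimes>\<^sub>M borel)"
proof (rule borel_measurable_LIMSEQ_metric)
  let ?q = "\<lambda>n (i, z). \<Sum>b\<in>Basis. (real (Suc n) * (f i (z + (1 / real (Suc n)) *\<^sub>R b) - f i z)) *\<^sub>R b"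
  fix n
  have "(\<lambda>(i, z). f i (z + c)) \<in> borel_measurable (T \<Otimes>\<^sub>M borel)" for c
  proof -
    have "(\<lambda>x. (fst x, snd x + c)) \<in> T \<Otimes>\<^sub>M borel \<rightarrow>\<^sub>M T \<Otimes>\<^sub>M borel"
      by measurable
    from measurable_compose[OF this f] show ?thesis
      by (simp add: case_prod_beta')
  qed
  note this[unfolded case_prod_beta', measurable]
  note f[unfolded case_prod_beta', measurable]
  show "?q n \<in> borel_measurable (T \<Otimes>\<^sub>M borel)"
    unfolding case_prod_beta' by measurable
next
  let ?q = "\<lambda>n (i, z). \<Sum>b\<in>Basis. (real (Suc n) * (f i (z + (1 / real (Suc n)) *\<^sub>R b) - f i z)) *\<^sub>R b"
  fix x assume x: "x \<in> space (T \<Otimes>\<^sub>M (borel :: 'a measure))"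
  obtain i z where [simp]: "x = (i, z)" and i: "i \<in> space T"
    using x by (auto simp: space_pair_measure)
  have "(f i has_derivative (\<lambda>h. h \<bullet> grad (f i) z)) (at z)"
    using differentiable_GDERIV[OF diff[OF i]] by (simp add: gderiv_def)
  from has_derivative_LIMSEQ[OF this]
  have "(\<lambda>n. ?q n x) \<longlonglongrightarrow> (\<Sum>b\<in>Basis. (b \<bullet> grad (f i) z) *\<^sub>R b)"
    by (auto intro!: tendsto_intros simp del: of_nat_Suc)
  moreover have "(\<Sum>b\<in>Basis. (b \<bullet> grad (f i) z) *\<^sub>R b) = grad (f i) z"
    by (simp only: inner_commute[of _ "grad (f i) z"] euclidean_representation)
  ultimately show "(\<lambda>n. ?q n x) \<longlonglongrightarrow> (case x of (i, z) \<Rightarrow> grad (f i) z)"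
    by (simp only: \<open>x = (i, z)\<close> prod.case)
qed

lemma borel_measurable_grad_w:
  fixes f :: "'i \<Rightarrow> 'w::euclidean_space \<times> 'p::euclidean_space \<Rightarrow> real"
  assumes f: "(\<lambda>(i, z). f i z) \<in> borel_measurable (T \<Otimes>\<^sub>M borel)"
    and diff: "\<And>i z. i \<in> space T \<Longrightarrow> f i differentiable at z"
  shows "(\<lambda>(i, z). grad_w (f i) z) \<in> borel_measurable (T \<Otimes>\<^sub>M borel)"
    and "(\<lambda>(i, z). grad_phi (f i) z) \<in> borel_measurable (T \<Otimes>\<^sub>M borel)"
proof -
  note g = measurable_compose[OF borel_measurable_grad[OF f diff] borel_measurable_continuous_onI]
  \<comment> \<open>Partial gradients are components of the gradient only where \<open>f i\<close>
    is differentiable, hence for tasks in the space of \<open>T\<close>; measurability sees no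
    others.\<close>
  have *: "grad_w (f i) z = fst (grad (f i) z)" "grad_phi (f i) z = snd (grad (f i) z)" if "i \<in> space T" for i z
    using GDERIV_grad_w GDERIV_grad_phi differentiable_GDERIV[OF diff[OF that]] by blast+
  show "(\<lambda>(i, z). grad_w (f i) z) \<in> borel_measurable (T \<Otimes>\<^sub>M borel)"
    by (rule measurable_cong[THEN iffD2, OF _ g[where g=fst]])
      (auto simp: space_pair_measure * intro!: continuous_intros)
  show "(\<lambda>(i, z). grad_phi (f i) z) \<in> borel_measurable (T \<Otimes>\<^sub>M borel)"
    by (rule measurable_cong[THEN iffD2, OF _ g[where g=snd]])
      (auto simp: space_pair_measure * intro!: continuous_intros)
qed

lemma borel_measurable_adapted_loss:
  fixes f g :: "'i \<Rightarrow> 'w::euclidean_space \<times> 'p::euclidean_space \<Rightarrow> real"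
  assumes f: "(\<lambda>(i, z). f i z) \<in> borel_measurable (T \<Otimes>\<^sub>M borel)"
    and g: "(\<lambda>(i, z). g i z) \<in> borel_measurable (T \<Otimes>\<^sub>M borel)"
    and diff: "\<And>i z. i \<in> space T \<Longrightarrow> f i differentiable at z"
  shows "(\<lambda>(i, z). adapted_loss \<alpha> N (f i) (g i) z) \<in> borel_measurable (T \<Otimes>\<^sub>M borel)"
proof -
  have snd_snd: "(\<lambda>x. snd (snd x)) \<in> borel_measurable (T \<Otimes>\<^sub>M (borel :: ('w \<times> 'p) measure))"
    by (rule measurable_compose[OF measurable_snd]) (intro borel_measurable_continuous_onI continuous_intros)
  have iter: "(\<lambda>x. inner_iter \<alpha> (f (fst x)) (snd x) m) \<in> borel_measurable (T \<Otimes>\<^sub>M borel)" for m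
  proof (induction m)
    case 0
    show ?case
      unfolding inner_iter.simps
      by (rule measurable_compose[OF measurable_snd]) (intro borel_measurable_continuous_onI continuous_intros)
  next
    case (Suc m)
    have "(\<lambda>x. (fst x, (inner_iter \<alpha> (f (fst x)) (snd x) m, snd (snd x)))) \<in> T \<Otimes>\<^sub>M borel \<rightarrow>\<^sub>M T \<Otimes>\<^sub>M borel"
      using Suc snd_snd by (intro measurable_Pair1' measurable_Pair borel_measurable_Pair measurable_fst)
    from measurable_compose[OF this borel_measurable_grad_w(1)[OF f diff]] Suc
    show ?case
      by simp
  qed
  have "(\<lambda>x. (fst x, (inner_iter \<alpha> (f (fst x)) (snd x) N, snd (snd x)))) \<in> T \<Otimes>\<^sub>M borel \<rightarrow>\<^sub>M T \<Otimes>\<^sub>M borel"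
    using iter snd_snd by (intro measurable_Pair borel_measurable_Pair measurable_fst)
  from measurable_compose[OF this g] show ?thesis
    by (simp add: adapted_loss_def case_prod_beta')
qed

text \<open>Redrawing the coordinate \<open>j\<close> of \<open>\<xi>\<close> from \<open>T\<close> leaves the product measure invariant.\<close>

lemma integral_PiM_resample:
  fixes h :: "'i \<Rightarrow> ('k \<Rightarrow> 'i) \<Rightarrow> real"
  assumes T: "prob_space T"
    and h: "(\<lambda>(t, \<xi>). h t \<xi>) \<in> borel_measurable (T \<Otimes>\<^sub>M PiM UNIV (\<lambda>_. T))"
    and bound: "\<And>t \<xi>. t \<in> space T \<Longrightarrow> \<xi> \<in> space (PiM UNIV (\<lambda>_. T)) \<Longrightarrow> \<bar>h t \<xi>\<bar> \<le> C"
    and indep: "\<And>s t \<xi>. h s (\<xi>(j := t)) = h s \<xi>"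
  shows "(\<integral>\<xi>. h (\<xi> j) \<xi> \<partial>PiM UNIV (\<lambda>_. T)) = (\<integral>\<xi>. (\<integral>t. h t \<xi> \<partial>T) \<partial>PiM UNIV (\<lambda>_. T))"
proof -
  let ?draws = "PiM UNIV (\<lambda>_. T) :: ('k \<Rightarrow> 'i) measure"
  interpret T: prob_space T by fact
  interpret PI: prob_space ?draws using T by (intro prob_space_PiM)
  interpret P: pair_prob_space T ?draws ..
  have upd: "(\<lambda>(t, \<xi>). \<xi>(j := t)) \<in> T \<Otimes>\<^sub>M ?draws \<rightarrow>\<^sub>M ?draws"
    by (rule measurable_PiM_single') (auto simp: space_pair_measure space_PiM case_prod_beta')
  have "(\<lambda>\<xi>. (\<xi> j, \<xi>)) \<in> ?draws \<rightarrow>\<^sub>M T \<Otimes>\<^sub>M ?draws"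
    by measurable
  from measurable_compose[OF this h] have h': "(\<lambda>\<xi>. h (\<xi> j) \<xi>) \<in> borel_measurable ?draws"
    by simp
  have "(\<integral>\<xi>. h (\<xi> j) \<xi> \<partial>?draws) = (\<integral>\<xi>. h (\<xi> j) \<xi> \<partial>distr (T \<Otimes>\<^sub>M ?draws) ?draws (\<lambda>(t, \<xi>). \<xi>(j := t)))"
    using distr_pair_PiM_eq_PiM[of UNIV "\<lambda>_. T" j] T by simp
  \<comment> \<open>After the update the coordinate \<open>j\<close> is \<open>t\<close>, and
    \<open>indep\<close> removes the update from the second argument.\<close>
  also have "\<dots> = (\<integral>(t, \<xi>). h t \<xi> \<partial>(T \<Otimes>\<^sub>M ?draws))"
    using h' upd by (subst integral_distr) (auto simp: case_prod_beta' indep)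
  also have "\<dots> = (\<integral>\<xi>. (\<integral>t. h t \<xi> \<partial>T) \<partial>?draws)"
    using h bound
    by (intro P.integral_snd[symmetric] P.integrable_const_bound[where B=C]) (auto simp: space_pair_measure)
  finally show ?thesis .
qed

text \<open>\<open>X\<close> stands for the current iterate, \<open>J\<close> for the coordinates of
  the fresh batch. Independence of the two is expressed pointwise: changing a coordinate in
  \<open>J\<close> does not move \<open>X\<close>.\<close>

locale iid_batch =
  fixes T :: "'i measure" and G :: "'i \<Rightarrow> 'z::euclidean_space \<Rightarrow> 'v::euclidean_space"
    and V :: real and X :: "('k \<Rightarrow> 'i) \<Rightarrow> 'z" and J :: "'k set"
  assumes T: "prob_space T"
    and G: "(\<lambda>(i, z). G i z) \<in> borel_measurable (T \<Otimes>\<^sub>M borel)"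
    and V: "\<And>i z. i \<in> space T \<Longrightarrow> norm (G i z) \<le> V"
    and X: "X \<in> borel_measurable (PiM UNIV (\<lambda>_. T))"
    and indep: "\<And>j \<xi> t. j \<in> J \<Longrightarrow> X (\<xi>(j := t)) = X \<xi>"
begin

abbreviation "draws \<equiv> (PiM UNIV (\<lambda>_. T) :: ('k \<Rightarrow> 'i) measure)"
abbreviation "D z \<equiv> (\<integral>i. G i z \<partial>T)"

lemma V_nonneg: "0 \<le> V"
  using V prob_space.not_empty[OF T] norm_ge_zero order_trans by (metis ex_in_conv)

lemma sample_measurable: "(\<lambda>\<xi>. G (\<xi> j) (X \<xi>)) \<in> borel_measurable draws"
proof -
  have "(\<lambda>\<xi>. (\<xi> j, X \<xi>)) \<in> draws \<rightarrow>\<^sub>M T \<Otimes>\<^sub>M borel"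
    using X by measurable
  from measurable_compose[OF this G] show ?thesis
    by simp
qed

lemma mean_measurable: "(\<lambda>z. D z) \<in> borel_measurable borel"
proof -
  interpret T: prob_space T by (rule T)
  have "(\<lambda>x. (snd x, fst x)) \<in> borel \<Otimes>\<^sub>M T \<rightarrow>\<^sub>M T \<Otimes>\<^sub>M borel"
    by measurable
  from measurable_compose[OF this G] show ?thesis
    by (intro T.borel_measurable_lebesgue_integral) (simp add: case_prod_beta')
qed

lemma G_integrable: "integrable T (\<lambda>i. G i z)"
proof -
  interpret T: prob_space T by (rule T)
  have "(\<lambda>i. (i, z)) \<in> T \<rightarrow>\<^sub>M T \<Otimes>\<^sub>M borel"
    by measurable
  from measurable_compose[OF this G] show ?thesis
    using V by (intro T.integrable_const_bound[where B=V]) auto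
qed

lemma mean_norm_le: "norm (D z) \<le> V"
proof -
  interpret T: prob_space T by (rule T)
  have "norm (D z) \<le> (\<integral>i. norm (G i z) \<partial>T)"
    by simp
  also have "\<dots> \<le> (\<integral>i. V \<partial>T)"
    using V G_integrable by (intro integral_mono) auto
  finally show ?thesis
    by (simp add: T.prob_space)
qed

lemma integrable_bounded_inner:
  assumes "Y \<in> borel_measurable draws" "Y' \<in> borel_measurable draws"
    and "\<And>\<xi>. \<xi> \<in> space draws \<Longrightarrow> norm (Y \<xi>) \<le> V" "\<And>\<xi>. \<xi> \<in> space draws \<Longrightarrow> norm (Y' \<xi>) \<le> V"
  shows "integrable draws (\<lambda>\<xi>. Y \<xi> \<bullet> (Y' \<xi> :: 'v))"
proof -
  interpret PI: prob_space draws using T by (intro prob_space_PiM)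
  have "\<bar>Y \<xi> \<bullet> Y' \<xi>\<bar> \<le> V * V" if "\<xi> \<in> space draws" for \<xi>
    using Cauchy_Schwarz_ineq2[of "Y \<xi>" "Y' \<xi>"] mult_mono[OF assms(3,4)[OF that]] V_nonneg by force
  then show ?thesis
    using assms by (intro PI.integrable_const_bound[where B="V * V"]) auto
qed

lemma sample_norm_le: "\<xi> \<in> space draws \<Longrightarrow> norm (G (\<xi> j) (X \<xi>)) \<le> V"
  using V by (auto simp: space_PiM)

text \<open>Conditioning on everything but the draw \<open>j\<close> replaces the sample by its
  mean. \<open>Y\<close> may depend on all other draws, so it can be the mean gradient as well as
  another sample of the batch.\<close>

lemma expectation_sample_inner:
  assumes j: "j \<in> J" and Y: "Y \<in> borel_measurable draws" and Y_le: "\<And>\<xi>. \<xi> \<in> space draws \<Longrightarrow> norm (Y \<xi>) \<le> V"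
    and Y_indep: "\<And>\<xi> t. Y (\<xi>(j := t)) = Y \<xi>"
  shows "(\<integral>\<xi>. G (\<xi> j) (X \<xi>) \<bullet> Y \<xi> \<partial>draws) = (\<integral>\<xi>. D (X \<xi>) \<bullet> Y \<xi> \<partial>draws)"
proof -
  have "(\<lambda>x. (fst x, X (snd x))) \<in> T \<Otimes>\<^sub>M draws \<rightarrow>\<^sub>M T \<Otimes>\<^sub>M borel"
    using X by measurable
  from measurable_compose[OF this G] have "(\<lambda>(t, \<xi>). G t (X \<xi>) \<bullet> Y \<xi>) \<in> borel_measurable (T \<Otimes>\<^sub>M draws)"
    using Y by (auto simp: case_prod_beta')
  then have "(\<integral>\<xi>. G (\<xi> j) (X \<xi>) \<bullet> Y \<xi> \<partial>draws) = (\<integral>\<xi>. (\<integral>t. G t (X \<xi>) \<bullet> Y \<xi> \<partial>T) \<partial>draws)"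
  proof (rule integral_PiM_resample[OF T])
    show "\<bar>G t (X \<xi>) \<bullet> Y \<xi>\<bar> \<le> V * V" if "t \<in> space T" "\<xi> \<in> space draws" for t \<xi>
      using Cauchy_Schwarz_ineq2[of "G t (X \<xi>)" "Y \<xi>"] mult_mono[OF V[OF that(1)] Y_le[OF that(2)]] V_nonneg
      by (meson norm_ge_zero order_trans)
  qed (simp add: Y_indep indep[OF j])
  then show ?thesis
    using G_integrable by simp
qed

lemma expectation_sample_mean:
  "j \<in> J \<Longrightarrow> (\<integral>\<xi>. G (\<xi> j) (X \<xi>) \<bullet> D (X \<xi>) \<partial>draws) = (\<integral>\<xi>. (norm (D (X \<xi>)))\<^sup>2 \<partial>draws)"
  using measurable_compose[OF X mean_measurable] mean_norm_le indep
  by (subst expectation_sample_inner) (auto simp: power2_norm_eq_inner)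

text \<open>Two averagings: the sample \<open>k\<close> does not see the coordinate
  \<open>j\<close>, and the mean that replaces the sample \<open>j\<close> does not see
  \<open>k\<close>.\<close>

lemma expectation_sample_pair:
  assumes "j \<in> J" "k \<in> J" "j \<noteq> k"
  shows "(\<integral>\<xi>. G (\<xi> j) (X \<xi>) \<bullet> G (\<xi> k) (X \<xi>) \<partial>draws) = (\<integral>\<xi>. (norm (D (X \<xi>)))\<^sup>2 \<partial>draws)"
  using assms
  by (subst expectation_sample_inner)
    (auto simp: sample_measurable sample_norm_le indep expectation_sample_mean inner_commute[of "D _"])

lemma integrable_sample_inner_mean: "integrable draws (\<lambda>\<xi>. G (\<xi> j) (X \<xi>) \<bullet> D (X \<xi>))"
  by (intro integrable_bounded_inner sample_measurable sample_norm_le mean_norm_le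
      measurable_compose[OF X mean_measurable])

lemma integrable_batch_norm: "integrable draws (\<lambda>\<xi>. (norm (\<Sum>b<B. G (\<xi> (\<sigma> b)) (X \<xi>)))\<^sup>2)" for B :: nat
  unfolding power2_norm_eq_inner inner_sum_left inner_sum_right
  by (intro Bochner_Integration.integrable_sum integrable_bounded_inner sample_measurable sample_norm_le)

lemma expectation_batch_mean:
  fixes B :: nat
  assumes "\<sigma> ` {..<B} \<subseteq> J"
  shows "(\<integral>\<xi>. (\<Sum>b<B. G (\<xi> (\<sigma> b)) (X \<xi>)) \<bullet> D (X \<xi>) \<partial>draws)
    = real B * (\<integral>\<xi>. (norm (D (X \<xi>)))\<^sup>2 \<partial>draws)"
proof -
  have "(\<integral>\<xi>. (\<Sum>b<B. G (\<xi> (\<sigma> b)) (X \<xi>)) \<bullet> D (X \<xi>) \<partial>draws)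
      = (\<Sum>b<B. \<integral>\<xi>. G (\<xi> (\<sigma> b)) (X \<xi>) \<bullet> D (X \<xi>) \<partial>draws)"
    unfolding inner_sum_left by (intro Bochner_Integration.integral_sum integrable_sample_inner_mean)
  also have "\<dots> = (\<Sum>b<B. \<integral>\<xi>. (norm (D (X \<xi>)))\<^sup>2 \<partial>draws)"
    using assms by (intro sum.cong refl expectation_sample_mean) auto
  finally show ?thesis
    by simp
qed

lemma expectation_batch_norm:
  assumes \<sigma>: "inj_on \<sigma> {..<B}" "\<sigma> ` {..<B} \<subseteq> J"
  shows "(\<integral>\<xi>. (norm (\<Sum>b<B. G (\<xi> (\<sigma> b)) (X \<xi>)))\<^sup>2 \<partial>draws)
    \<le> real B * V\<^sup>2 + (real B)\<^sup>2 * (\<integral>\<xi>. (norm (D (X \<xi>)))\<^sup>2 \<partial>draws)"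
proof -
  interpret PI: prob_space draws using T by (intro prob_space_PiM)
  let ?G = "\<lambda>b \<xi>. G (\<xi> (\<sigma> b)) (X \<xi>)" and ?E = "\<integral>\<xi>. (norm (D (X \<xi>)))\<^sup>2 \<partial>draws"
  have int: "integrable draws (\<lambda>\<xi>. ?G b \<xi> \<bullet> ?G c \<xi>)" for b c
    by (intro integrable_bounded_inner sample_measurable sample_norm_le)
  have E: "0 \<le> ?E"
    by simp
  \<comment> \<open>Off the diagonal the value is exactly \<open>?E\<close>. On the diagonal
    \<open>V\<^sup>2\<close> is enough; adding \<open>?E\<close> there as well makes the double sum
    uniform.\<close>
  have le: "(\<integral>\<xi>. ?G b \<xi> \<bullet> ?G c \<xi> \<partial>draws) \<le> (if b = c then V\<^sup>2 else 0) + ?E" if "b < B" "c < B" for b c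
  proof (cases "b = c")
    case True
    have "(\<integral>\<xi>. ?G b \<xi> \<bullet> ?G b \<xi> \<partial>draws) \<le> (\<integral>\<xi>. V\<^sup>2 \<partial>draws)"
      using int[of b b] by (intro integral_mono) (simp_all add: dot_square_norm power_mono sample_norm_le)
    then show ?thesis
      using True by (simp add: PI.prob_space add_increasing2)
  next
    case False
    then show ?thesis
      using that \<sigma> by (subst expectation_sample_pair) (auto simp: inj_on_def)
  qed
  have "(\<integral>\<xi>. (norm (\<Sum>b<B. ?G b \<xi>))\<^sup>2 \<partial>draws) = (\<integral>\<xi>. (\<Sum>b<B. \<Sum>c<B. ?G b \<xi> \<bullet> ?G c \<xi>) \<partial>draws)"
    by (simp only: power2_norm_eq_inner inner_sum_left) (simp only: inner_sum_right)
  also have "\<dots> = (\<Sum>b<B. \<Sum>c<B. \<integral>\<xi>. ?G b \<xi> \<bullet> ?G c \<xi> \<partial>draws)"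
    using int by (simp add: Bochner_Integration.integral_sum Bochner_Integration.integrable_sum)
  also have "\<dots> \<le> (\<Sum>b<B. \<Sum>c<B. (if b = c then V\<^sup>2 else 0) + ?E)"
    using le by (intro sum_mono) auto
  also have "\<dots> = real B * V\<^sup>2 + (real B)\<^sup>2 * ?E"
    by (simp add: sum.distrib power2_eq_square distrib_left)
  finally show ?thesis .
qed

end

subsection \<open>The meta objective and the ANIL iterates\<close>

locale anil_problem = prob_space T for T :: "'i measure" +
  fixes LS LD :: "'i \<Rightarrow> 'w::euclidean_space \<times> 'p::euclidean_space \<Rightarrow> real"
    and \<mu> L \<rho> \<tau> M \<alpha> \<kappa> \<theta> c r S s \<beta>w \<beta>\<phi> :: real and N :: nat and z0 :: "'w \<times> 'p"
  assumes LS_measurable: "(\<lambda>(i, z). LS i z) \<in> borel_measurable (T \<Otimes>\<^sub>M borel)"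
    and LD_measurable: "(\<lambda>(i, z). LD i z) \<in> borel_measurable (T \<Otimes>\<^sub>M borel)"
    and task: "\<And>i. i \<in> space T \<Longrightarrow> adapted_task (LS i) \<mu> L \<rho> \<tau> \<alpha> \<kappa> (LD i) M"
    and integrable_loss: "\<And>z. integrable T (\<lambda>i. adapted_loss \<alpha> N (LS i) (LD i) z)"
    and \<theta>: "0 < \<theta>" "\<theta> < 1" and N: "1 \<le> N" and \<mu>\<theta>: "N = 1 \<Longrightarrow> \<mu> \<le> \<theta> * L"
    and c: "c = 1 / sqrt (1 - \<theta>\<^sup>2)" and r: "r = sqrt \<kappa> ^ N" and S: "S = 1 + \<rho> + \<tau> + L + M"
    and s: "s = 1 / (10 ^ 4 * c\<^sup>2 * S ^ 6)" and \<beta>w: "\<beta>w = s * \<mu>\<^sup>2 / r" and \<beta>\<phi>: "\<beta>\<phi> = s * \<mu> ^ 3"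
begin

abbreviation "loss i \<equiv> adapted_loss \<alpha> N (LS i) (LD i)"
abbreviation "F \<equiv> meta_loss T \<alpha> N LS LD"
abbreviation "Dw z \<equiv> (\<integral>i. grad_w (loss i) z \<partial>T)"
abbreviation "D\<phi> z \<equiv> (\<integral>i. grad_phi (loss i) z \<partial>T)"
abbreviation "Z B \<xi> k \<equiv> anil \<alpha> N \<beta>w \<beta>\<phi> LS LD z0 B \<xi> k"
abbreviation "\<Omega> \<equiv> task_draws T"
abbreviation "Vw \<equiv> M * r\<^sup>2"
abbreviation "V\<phi> \<equiv> M * (1 + L / \<mu>)"

lemma
  shows \<mu>_pos: "0 < \<mu>" and \<mu>_less: "\<mu> < L" and M_nonneg: "0 \<le> M" and \<rho>_nonneg: "0 \<le> \<rho>" and \<tau>_nonneg: "0 \<le> \<tau>"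
    and r_pos: "0 < r" and r_le: "r \<le> 1" and \<kappa>_N: "\<kappa> ^ N = r\<^sup>2" and c_ge: "1 \<le> c"
proof -
  obtain i where i: "i \<in> space T"
    using not_empty by auto
  interpret t: adapted_task "LS i" \<mu> L \<rho> \<tau> \<alpha> \<kappa> "LD i" M
    using i by (rule task)
  show "0 < \<mu>" "\<mu> < L" "0 \<le> M" "0 \<le> \<rho>" "0 \<le> \<tau>" "1 \<le> c"
    using t.\<mu> t.M_nonneg t.\<rho>_nonneg t.\<tau>_nonneg t.c_ge_1[OF \<theta> N \<mu>\<theta> c refl] by auto
  show "0 < r" "r \<le> 1" "\<kappa> ^ N = r\<^sup>2"
    using t.\<kappa>_pos t.\<kappa>_less by (auto simp: r power_le_one power_mult power2_eq_square simp flip: power_mult_distrib)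
qed

lemma L_pos: "0 < L" and S_ge: "1 \<le> S" "L \<le> S" "M \<le> S" and S_ge_\<mu>: "\<mu> \<le> S"
  using \<mu>_pos \<mu>_less M_nonneg \<rho>_nonneg \<tau>_nonneg by (auto simp: S)

lemma s_pos: "0 < s" and \<beta>w_pos: "0 < \<beta>w" and \<beta>\<phi>_pos: "0 < \<beta>\<phi>"
  using S_ge c_ge r_pos \<mu>_pos by (auto simp: s \<beta>w \<beta>\<phi>)

lemma LS_differentiable: "i \<in> space T \<Longrightarrow> LS i differentiable at z"
  using task[of i] unfolding adapted_task_def inner_loop_def smooth_def by blast

lemma GDERIV_loss: "i \<in> space T \<Longrightarrow> GDERIV (loss i) z :> (grad_w (loss i) z, grad_phi (loss i) z)"
  by (rule adapted_task.GDERIV_adapted[OF task])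

lemma loss_measurable: "(\<lambda>(i, z). loss i z) \<in> borel_measurable (T \<Otimes>\<^sub>M borel)"
  using LS_measurable LD_measurable LS_differentiable by (rule borel_measurable_adapted_loss)

lemma loss_differentiable: "i \<in> space T \<Longrightarrow> loss i differentiable at z"
  using GDERIV_loss unfolding gderiv_def differentiable_def by blast

lemma grad_measurable:
  "(\<lambda>(i, z). grad_w (loss i) z) \<in> borel_measurable (T \<Otimes>\<^sub>M borel)"
  "(\<lambda>(i, z). grad_phi (loss i) z) \<in> borel_measurable (T \<Otimes>\<^sub>M borel)"
  by (rule borel_measurable_grad_w[OF loss_measurable loss_differentiable]; assumption)+

lemma grad_bounds:
  "i \<in> space T \<Longrightarrow> norm (grad_w (loss i) z) \<le> Vw"
  "i \<in> space T \<Longrightarrow> norm (grad_phi (loss i) z) \<le> V\<phi>"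
  using adapted_task.norm_grad_w_le[OF task] adapted_task.norm_grad_phi_le[OF task] by (auto simp flip: \<kappa>_N)

lemma iid_batch_grad:
  assumes "X \<in> borel_measurable \<Omega>" "\<And>j \<xi> t. j \<in> J \<Longrightarrow> X (\<xi>(j := t)) = X \<xi>"
  shows "iid_batch T (\<lambda>i. grad_w (loss i)) Vw X J" "iid_batch T (\<lambda>i. grad_phi (loss i)) V\<phi> X J"
  using assms prob_space_axioms grad_measurable grad_bounds by (auto simp: iid_batch_def task_draws_def)

text \<open>A constant point meets the conditions on \<open>X\<close> trivially, which frees the
  facts about the mean gradient from any assumption on \<open>X\<close>.\<close>

lemmas iid_batch_grad_const = iid_batch_grad[of "\<lambda>_. z0" UNIV, simplified]
lemmas mean_grad_measurable = iid_batch_grad_const[THEN iid_batch.mean_measurable]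
lemmas mean_grad_norm_le = iid_batch_grad_const[THEN iid_batch.mean_norm_le]
lemmas grad_integrable = iid_batch_grad_const[THEN iid_batch.G_integrable]

definition "quad a b = c * S\<^sup>2 * r / \<mu> * a\<^sup>2 + 4 * c * S ^ 3 * r / \<mu>\<^sup>2 * (a * b) + 4 * S ^ 4 / \<mu> ^ 3 * b\<^sup>2"

text \<open>The remainder bound is the same for all tasks and therefore survives integration. It
  yields both the differentiability of \<open>F\<close> and the descent inequality.\<close>

lemma F_quadratic:
  "\<bar>F (z + d) - F z - (fst d \<bullet> Dw z + snd d \<bullet> D\<phi> z)\<bar> \<le> quad (norm (fst d)) (norm (snd d))"
proof -
  have int: "integrable T (\<lambda>i. fst d \<bullet> grad_w (loss i) z)" "integrable T (\<lambda>i. snd d \<bullet> grad_phi (loss i) z)"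
    by (intro integrable_inner_right grad_integrable)+
  define h where "h i = loss i (z + d) - loss i z - (fst d \<bullet> grad_w (loss i) z + snd d \<bullet> grad_phi (loss i) z)" for i
  have h: "integrable T h"
    unfolding h_def using int integrable_loss
    by (intro Bochner_Integration.integrable_diff Bochner_Integration.integrable_add)
  have "F (z + d) - F z - (fst d \<bullet> Dw z + snd d \<bullet> D\<phi> z) = (\<integral>i. h i \<partial>T)"
    unfolding h_def meta_loss_def using int integrable_loss
    by (simp only: Bochner_Integration.integral_diff Bochner_Integration.integral_add
        Bochner_Integration.integrable_diff Bochner_Integration.integrable_add
        integral_inner_right grad_integrable)
  moreover have "\<bar>\<integral>i. h i \<partial>T\<bar> \<le> (\<integral>i. \<bar>h i\<bar> \<partial>T)"
    by (rule integral_abs_bound)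
  moreover have "(\<integral>i. \<bar>h i\<bar> \<partial>T) \<le> (\<integral>i. quad (norm (fst d)) (norm (snd d)) \<partial>T)"
  proof (rule integral_mono)
    show "\<bar>h i\<bar> \<le> quad (norm (fst d)) (norm (snd d))" if "i \<in> space T" for i
      using adapted_task.adapted_quadratic_explicit[OF task[OF that] \<theta> N \<mu>\<theta>, of z d]
      unfolding h_def quad_def unfolding c r S inner_prod_def fst_conv snd_conv by (simp only: simp_thms)
  qed (use h in auto)
  moreover have "(\<integral>i. quad (norm (fst d)) (norm (snd d)) \<partial>T) = quad (norm (fst d)) (norm (snd d))"
    by (simp add: prob_space)
  ultimately show ?thesis
    by linarith
qed

text \<open>Differentiation under the integral: the integrated first-order expansion has a remainder
  quadratic in \<open>d\<close>, so no domination argument for difference quotients is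
  involved.\<close>

lemma GDERIV_F: "GDERIV F z :> (Dw z, D\<phi> z)"
proof -
  define C where "C = c * S\<^sup>2 * r / \<mu> + 4 * c * S ^ 3 * r / \<mu>\<^sup>2 + 4 * S ^ 4 / \<mu> ^ 3"
  have quad_le: "quad (norm (fst d)) (norm (snd d)) \<le> C * (norm d)\<^sup>2" for d :: "'w \<times> 'p"
  proof -
    have "norm (fst d) \<le> norm d" "norm (snd d) \<le> norm d"
      by (metis norm_fst_le prod.collapse, metis norm_snd_le prod.collapse)
    then show ?thesis
      unfolding C_def quad_def power2_eq_square[of "norm _"] distrib_right using c_ge S_ge r_pos \<mu>_pos
      by (intro add_mono mult_left_mono mult_mono) auto
  qed
  have "((\<lambda>d. norm (F (z + d) - F z - d \<bullet> (Dw z, D\<phi> z)) / norm d) \<longlongrightarrow> 0) (at 0)"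
  proof (rule Lim_null_comparison)
    show "\<forall>\<^sub>F d in at 0. norm (norm (F (z + d) - F z - d \<bullet> (Dw z, D\<phi> z)) / norm d) \<le> C * norm d"
    proof (rule always_eventually, rule allI)
      fix d
      have "norm (F (z + d) - F z - d \<bullet> (Dw z, D\<phi> z)) \<le> C * (norm d)\<^sup>2"
        using order_trans[OF F_quadratic quad_le] by (simp add: inner_prod_def)
      then show "norm (norm (F (z + d) - F z - d \<bullet> (Dw z, D\<phi> z)) / norm d) \<le> C * norm d"
        by (cases "d = 0") (auto simp: divide_le_eq power2_eq_square mult.assoc)
    qed
    show "((\<lambda>d. C * norm d) \<longlongrightarrow> 0) (at 0)"
      by (intro tendsto_eq_intros) auto
  qed
  then show ?thesis
    unfolding gderiv_def has_derivative_at by (simp add: bounded_linear_inner_left)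
qed

lemma grad_F: "grad_w F = Dw" "grad_phi F = D\<phi>"
  using GDERIV_grad_w[OF GDERIV_F] GDERIV_grad_phi[OF GDERIV_F] by auto

lemma continuous_F: "continuous_on UNIV F"
  using GDERIV_F unfolding gderiv_def
  by (intro differentiable_imp_continuous_on) (auto simp: differentiable_on_def differentiable_def)

text \<open>The iterate \<open>k\<close> sees only the batches of earlier iterations. Hence the
  batch \<open>k\<close> is fresh, as \<open>iid_batch\<close> requires.\<close>

lemma anil_cong: "(\<And>k' b. k' < k \<Longrightarrow> \<xi> (k', b) = \<xi>' (k', b)) \<Longrightarrow> Z B \<xi> k = Z B \<xi>' k"
  by (induction k) (simp_all add: Let_def)

lemma anil_measurable: "(\<lambda>\<xi>. Z B \<xi> k) \<in> borel_measurable \<Omega>"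
proof (induction k)
  case (Suc k)
  note [measurable] = Suc
  have "(\<lambda>\<xi>. (\<xi> (k, b), Z B \<xi> k)) \<in> \<Omega> \<rightarrow>\<^sub>M T \<Otimes>\<^sub>M borel" for b
    using Suc unfolding task_draws_def by (intro measurable_Pair measurable_component_singleton) auto
  note * = measurable_compose[OF this grad_measurable(1)] measurable_compose[OF this grad_measurable(2)]
  have [measurable]: "(\<lambda>\<xi>. fst (Z B \<xi> k)) \<in> borel_measurable \<Omega>" "(\<lambda>\<xi>. snd (Z B \<xi> k)) \<in> borel_measurable \<Omega>"
    by (rule measurable_compose[OF Suc borel_measurable_continuous_onI]; intro continuous_intros)+
  show ?case
    unfolding anil.simps Let_def using *
    by (intro borel_measurable_Pair borel_measurable_diff borel_measurable_scaleR borel_measurable_sum) auto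
qed simp

text \<open>Serves integrability: an iterate stays in a fixed ball because all sampled gradients are
  bounded, and there the continuous function \<open>F\<close> is bounded.\<close>

lemma anil_bounded: "\<exists>C. \<forall>\<xi>\<in>space \<Omega>. norm (Z B \<xi> k) \<le> C"
proof (induction k)
  case 0
  show ?case by auto
next
  case (Suc k)
  then obtain C where C: "\<And>\<xi>. \<xi> \<in> space \<Omega> \<Longrightarrow> norm (Z B \<xi> k) \<le> C"
    by auto
  have "norm (Z B \<xi> (Suc k)) \<le> C + \<beta>w / B * (B * Vw) + (C + \<beta>\<phi> / B * (B * V\<phi>))" if \<xi>: "\<xi> \<in> space \<Omega>" for \<xi>
  proof -
    let ?z = "Z B \<xi> k"
    have \<xi>T: "\<xi> (k, b) \<in> space T" for b
      using \<xi> by (auto simp: task_draws_def space_PiM)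
    have "norm (fst ?z) \<le> C" "norm (snd ?z) \<le> C"
      using C[OF \<xi>] by (metis norm_fst_le norm_snd_le order_trans prod.collapse)+
    moreover have "norm ((\<beta>w / B) *\<^sub>R (\<Sum>b<B. grad_w (loss (\<xi> (k, b))) ?z)) \<le> \<beta>w / B * (B * Vw)"
      using \<beta>w_pos sum_norm_le[of "{..<B}" "\<lambda>b. grad_w (loss (\<xi> (k, b))) ?z" "\<lambda>_. Vw"] grad_bounds(1)[OF \<xi>T]
      unfolding norm_scaleR by (intro mult_mono) auto
    moreover have "norm ((\<beta>\<phi> / B) *\<^sub>R (\<Sum>b<B. grad_phi (loss (\<xi> (k, b))) ?z)) \<le> \<beta>\<phi> / B * (B * V\<phi>)"
      using \<beta>\<phi>_pos sum_norm_le[of "{..<B}" "\<lambda>b. grad_phi (loss (\<xi> (k, b))) ?z" "\<lambda>_. V\<phi>"] grad_bounds(2)[OF \<xi>T]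
      unfolding norm_scaleR by (intro mult_mono) auto
    ultimately show ?thesis
      unfolding anil.simps Let_def
      by (intro order_trans[OF norm_Pair_le] add_mono order_trans[OF norm_triangle_ineq4])
  qed
  then show ?case
    by blast
qed

lemma F_anil_integrable: "integrable \<Omega> (\<lambda>\<xi>. F (Z B \<xi> k))"
proof -
  interpret \<Omega>: prob_space \<Omega>
    unfolding task_draws_def using prob_space_axioms by (rule prob_space_PiM)
  obtain C where C: "\<And>\<xi>. \<xi> \<in> space \<Omega> \<Longrightarrow> norm (Z B \<xi> k) \<le> C"
    using anil_bounded by blast
  have "compact (F ` cball 0 C)"
    using continuous_F by (intro compact_continuous_image compact_cball) (auto intro: continuous_on_subset)
  then obtain K where K: "\<And>z. norm z \<le> C \<Longrightarrow> norm (F z) \<le> K"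
    by (meson compact_imp_bounded bounded_iff image_eqI mem_cball_0)
  have "F \<in> borel_measurable borel"
    by (rule borel_measurable_continuous_onI[OF continuous_F])
  then show ?thesis
    using C K by (intro \<Omega>.integrable_const_bound[where B=K] AE_I2 measurable_compose[OF anil_measurable]) auto
qed

end

subsection \<open>Expected descent and convergence rates\<close>

context anil_problem
begin

text \<open>\<open>Cw\<close> and \<open>C\<phi>\<close> bound the second-order cost of a step per
  squared batch gradient. \<open>noise\<close> is the part of this cost that remains at a stationary
  point; it is divided by \<open>B\<close> later.\<close>

definition "Cw = 3 * c\<^sup>2 * S\<^sup>2 * s\<^sup>2 * \<mu> ^ 3 / r"
definition "C\<phi> = 6 * S ^ 4 * s\<^sup>2 * \<mu> ^ 3"
definition "noise = Cw * Vw\<^sup>2 + C\<phi> * V\<phi>\<^sup>2"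

lemma s_eq: "s * (c\<^sup>2 * S ^ 6) = 1 / 10 ^ 4"
  using c_ge S_ge unfolding s by simp

text \<open>With these stepsizes all three terms of \<open>quad\<close> share the factor
  \<open>s\<^sup>2 * \<mu> ^ 3\<close>. The mixed term is split by the inequality of arithmetic and
  geometric means; its share in \<open>a\<^sup>2\<close> carries no \<open>1 / r\<close>, which
  \<open>r \<le> 1\<close> supplies.\<close>

lemma quad_step: "quad (\<beta>w * a) (\<beta>\<phi> * b) \<le> Cw * a\<^sup>2 + C\<phi> * b\<^sup>2"
proof -
  have "0 \<le> (c * S * a - S\<^sup>2 * b)\<^sup>2"
    by simp
  then have amgm: "4 * c * S ^ 3 * (a * b) \<le> 2 * (c\<^sup>2 * S\<^sup>2 * a\<^sup>2) + 2 * (S ^ 4 * b\<^sup>2)"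
    by (simp add: power2_eq_square power3_eq_cube power4_eq_xxxx algebra_simps)
  have "1 \<le> 1 / r"
    using r_pos r_le by simp
  then have 1: "1 * (2 * (c\<^sup>2 * S\<^sup>2 * a\<^sup>2)) \<le> 1 / r * (2 * (c\<^sup>2 * S\<^sup>2 * a\<^sup>2))"
    by (intro mult_right_mono) auto
  have "c \<le> c\<^sup>2"
    using c_ge by (simp add: power2_eq_square)
  then have 2: "c * (S\<^sup>2 * a\<^sup>2 / r) \<le> c\<^sup>2 * (S\<^sup>2 * a\<^sup>2 / r)"
    using r_pos by (intro mult_right_mono) auto
  have "c * (S\<^sup>2 * a\<^sup>2 / r) + 4 * c * S ^ 3 * (a * b) + 4 * (S ^ 4 * b\<^sup>2) \<le> 3 * c\<^sup>2 * S\<^sup>2 / r * a\<^sup>2 + 6 * S ^ 4 * b\<^sup>2"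
    using amgm 1 2 by (simp add: algebra_simps add_divide_distrib)
  then have "(s\<^sup>2 * \<mu> ^ 3) * (c * (S\<^sup>2 * a\<^sup>2 / r) + 4 * c * S ^ 3 * (a * b) + 4 * (S ^ 4 * b\<^sup>2))
      \<le> (s\<^sup>2 * \<mu> ^ 3) * (3 * c\<^sup>2 * S\<^sup>2 / r * a\<^sup>2 + 6 * S ^ 4 * b\<^sup>2)"
    using \<mu>_pos by (intro mult_left_mono) auto
  moreover have "quad (\<beta>w * a) (\<beta>\<phi> * b)
      = (s\<^sup>2 * \<mu> ^ 3) * (c * (S\<^sup>2 * a\<^sup>2 / r) + 4 * c * S ^ 3 * (a * b) + 4 * (S ^ 4 * b\<^sup>2))"
  proof -
    have "c * S\<^sup>2 * r / \<mu> * (\<beta>w * a)\<^sup>2 = (s\<^sup>2 * \<mu> ^ 3) * (c * (S\<^sup>2 * a\<^sup>2 / r))"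
      using \<mu>_pos r_pos by (simp add: \<beta>w power2_eq_square power3_eq_cube)
    moreover have "4 * c * S ^ 3 * r / \<mu>\<^sup>2 * (\<beta>w * a * (\<beta>\<phi> * b)) = (s\<^sup>2 * \<mu> ^ 3) * (4 * c * S ^ 3 * (a * b))"
      using \<mu>_pos r_pos by (simp add: \<beta>w \<beta>\<phi> power2_eq_square power3_eq_cube)
    moreover have "4 * S ^ 4 / \<mu> ^ 3 * (\<beta>\<phi> * b)\<^sup>2 = (s\<^sup>2 * \<mu> ^ 3) * (4 * (S ^ 4 * b\<^sup>2))"
      using \<mu>_pos r_pos by (simp add: \<beta>\<phi> power2_eq_square power3_eq_cube)
    ultimately show ?thesis
      unfolding quad_def by (simp only: distrib_left)
  qed
  ultimately show ?thesis
    unfolding Cw_def C\<phi>_def by (simp add: algebra_simps)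
qed

text \<open>The second-order cost may use up at most half of the first-order decrease. This is what
  \<open>c\<^sup>2\<close> and the large power of \<open>S\<close> in the denominator of
  \<open>s\<close> are for.\<close>

lemma Cw_le: "Cw \<le> \<beta>w / 2" and C\<phi>_le: "C\<phi> \<le> \<beta>\<phi> / 2" and C_nonneg: "0 \<le> Cw" "0 \<le> C\<phi>"
proof -
  have "\<mu> * S\<^sup>2 \<le> S * S\<^sup>2"
    using S_ge_\<mu> by (intro mult_right_mono) auto
  also have "\<dots> \<le> S ^ 6"
    using S_ge power_increasing[of 3 6 S] by (simp flip: power_Suc)
  finally have "s * c\<^sup>2 * (\<mu> * S\<^sup>2) \<le> s * c\<^sup>2 * S ^ 6"
    using s_pos by (intro mult_left_mono) auto
  then have "3 * (s * c\<^sup>2 * (\<mu> * S\<^sup>2)) \<le> 1 / 2"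
    using s_eq by (simp add: mult.assoc)
  then have "3 * (s * c\<^sup>2 * (\<mu> * S\<^sup>2)) * \<beta>w \<le> 1 / 2 * \<beta>w"
    using \<beta>w_pos by (intro mult_right_mono) auto
  moreover have "3 * (s * c\<^sup>2 * (\<mu> * S\<^sup>2)) * \<beta>w = Cw"
    by (simp add: Cw_def \<beta>w power2_eq_square power3_eq_cube)
  ultimately show "Cw \<le> \<beta>w / 2"
    by simp
  have "1 * S ^ 4 \<le> c\<^sup>2 * S ^ 6"
    using S_ge c_ge by (intro mult_mono power_increasing) auto
  then have "s * S ^ 4 \<le> s * (c\<^sup>2 * S ^ 6)"
    using s_pos by simp
  then have "6 * (s * S ^ 4) \<le> 1 / 2"
    unfolding s_eq by simp
  then have "6 * (s * S ^ 4) * \<beta>\<phi> \<le> 1 / 2 * \<beta>\<phi>"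
    using \<beta>\<phi>_pos by (intro mult_right_mono) auto
  moreover have "6 * (s * S ^ 4) * \<beta>\<phi> = C\<phi>"
    by (simp add: C\<phi>_def \<beta>\<phi> power2_eq_square)
  ultimately show "C\<phi> \<le> \<beta>\<phi> / 2"
    by simp
  show "0 \<le> Cw" "0 \<le> C\<phi>"
    using s_pos S_ge r_pos \<mu>_pos by (auto simp: Cw_def C\<phi>_def)
qed

lemma F_step_le:
  fixes B k \<xi>
  defines "z \<equiv> Z B \<xi> k"
  defines "W \<equiv> (\<Sum>b<B. grad_w (loss (\<xi> (k, b))) z)" and "P \<equiv> (\<Sum>b<B. grad_phi (loss (\<xi> (k, b))) z)"
  shows "F (Z B \<xi> (Suc k)) \<le> F z - \<beta>w / B * (W \<bullet> Dw z) - \<beta>\<phi> / B * (P \<bullet> D\<phi> z)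
    + Cw / (real B)\<^sup>2 * (norm W)\<^sup>2 + C\<phi> / (real B)\<^sup>2 * (norm P)\<^sup>2"
proof -
  define d where "d = (- ((\<beta>w / B) *\<^sub>R W), - ((\<beta>\<phi> / B) *\<^sub>R P))"
  have 1: "Z B \<xi> (Suc k) = z + d"
    by (simp add: z_def W_def P_def d_def Let_def plus_prod_def)
  have 2: "norm (fst d) = \<beta>w * (norm W / B)" "norm (snd d) = \<beta>\<phi> * (norm P / B)"
    using \<beta>w_pos \<beta>\<phi>_pos by (simp_all add: d_def)
  have 3: "fst d \<bullet> Dw z + snd d \<bullet> D\<phi> z = - (\<beta>w / B * (W \<bullet> Dw z)) - \<beta>\<phi> / B * (P \<bullet> D\<phi> z)"
    by (simp add: d_def)
  have 4: "Cw * (norm W / B)\<^sup>2 + C\<phi> * (norm P / B)\<^sup>2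
      = Cw / (real B)\<^sup>2 * (norm W)\<^sup>2 + C\<phi> / (real B)\<^sup>2 * (norm P)\<^sup>2"
    by (simp add: power_divide)
  show ?thesis
    using F_quadratic[of z d] quad_step[of "norm W / B" "norm P / B"] unfolding 1 2 3 4 by linarith
qed

text \<open>In the second moment of a batch sum, the part with the squared mean is charged to the
  first-order decrease, of which half survives; the rest, divided by the square of \<open>B\<close>,
  leaves \<open>noise / B\<close>.\<close>

lemma expected_descent:
  fixes B k
  assumes B: "1 \<le> B"
  shows "(\<integral>\<xi>. F (Z B \<xi> (Suc k)) \<partial>\<Omega>) \<le> (\<integral>\<xi>. F (Z B \<xi> k) \<partial>\<Omega>)
    - \<beta>w / 2 * (\<integral>\<xi>. (norm (Dw (Z B \<xi> k)))\<^sup>2 \<partial>\<Omega>) - \<beta>\<phi> / 2 * (\<integral>\<xi>. (norm (D\<phi> (Z B \<xi> k)))\<^sup>2 \<partial>\<Omega>) + noise / B"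
proof -
  define X where "X \<xi> = Z B \<xi> k" for \<xi>
  define W where "W \<xi> = (\<Sum>b<B. grad_w (loss (\<xi> (k, b))) (X \<xi>))" for \<xi>
  define P where "P \<xi> = (\<Sum>b<B. grad_phi (loss (\<xi> (k, b))) (X \<xi>))" for \<xi>
  define Ew where "Ew = (\<integral>\<xi>. (norm (Dw (X \<xi>)))\<^sup>2 \<partial>\<Omega>)"
  define E\<phi> where "E\<phi> = (\<integral>\<xi>. (norm (D\<phi> (X \<xi>)))\<^sup>2 \<partial>\<Omega>)"
  \<comment> \<open>The fresh coordinates are those with first component \<open>k\<close>, one batch
    in its entirety.\<close>
  have X: "X \<in> borel_measurable \<Omega>" "\<And>j \<xi> t. j \<in> {k} \<times> UNIV \<Longrightarrow> X (\<xi>(j := t)) = X \<xi>"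
    unfolding X_def using anil_measurable by (auto intro!: anil_cong)
  note w = iid_batch_grad(1)[OF X] and \<phi> = iid_batch_grad(2)[OF X]
  have \<sigma>: "inj_on (Pair k) {..<B}" "Pair k ` {..<B} \<subseteq> {k} \<times> UNIV"
    by (auto simp: inj_on_def)
  have intWD: "integrable \<Omega> (\<lambda>\<xi>. W \<xi> \<bullet> Dw (X \<xi>))"
    unfolding W_def inner_sum_left task_draws_def
    by (intro Bochner_Integration.integrable_sum iid_batch.integrable_sample_inner_mean[OF w])
  have intPD: "integrable \<Omega> (\<lambda>\<xi>. P \<xi> \<bullet> D\<phi> (X \<xi>))"
    unfolding P_def inner_sum_left task_draws_def
    by (intro Bochner_Integration.integrable_sum iid_batch.integrable_sample_inner_mean[OF \<phi>])
  have intW: "integrable \<Omega> (\<lambda>\<xi>. (norm (W \<xi>))\<^sup>2)"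
    unfolding W_def task_draws_def by (rule iid_batch.integrable_batch_norm[OF w])
  have intP: "integrable \<Omega> (\<lambda>\<xi>. (norm (P \<xi>))\<^sup>2)"
    unfolding P_def task_draws_def by (rule iid_batch.integrable_batch_norm[OF \<phi>])
  have WD: "(\<integral>\<xi>. W \<xi> \<bullet> Dw (X \<xi>) \<partial>\<Omega>) = B * Ew"
    unfolding W_def Ew_def task_draws_def by (rule iid_batch.expectation_batch_mean[OF w \<sigma>(2)])
  have PD: "(\<integral>\<xi>. P \<xi> \<bullet> D\<phi> (X \<xi>) \<partial>\<Omega>) = B * E\<phi>"
    unfolding P_def E\<phi>_def task_draws_def by (rule iid_batch.expectation_batch_mean[OF \<phi> \<sigma>(2)])
  have W2: "(\<integral>\<xi>. (norm (W \<xi>))\<^sup>2 \<partial>\<Omega>) \<le> B * Vw\<^sup>2 + (real B)\<^sup>2 * Ew"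
    unfolding W_def Ew_def task_draws_def by (rule iid_batch.expectation_batch_norm[OF w \<sigma>])
  have P2: "(\<integral>\<xi>. (norm (P \<xi>))\<^sup>2 \<partial>\<Omega>) \<le> B * V\<phi>\<^sup>2 + (real B)\<^sup>2 * E\<phi>"
    unfolding P_def E\<phi>_def task_draws_def by (rule iid_batch.expectation_batch_norm[OF \<phi> \<sigma>])
  have cancel_B: "C / (real B)\<^sup>2 * (B * v + (real B)\<^sup>2 * e) = C * v / B + C * e" for C v e :: real
    using B by (simp add: field_simps power2_eq_square)
  have intF: "integrable \<Omega> (\<lambda>\<xi>. F (X \<xi>))"
    unfolding X_def by (rule F_anil_integrable)
  have "(\<integral>\<xi>. F (Z B \<xi> (Suc k)) \<partial>\<Omega>) \<le> (\<integral>\<xi>. F (X \<xi>) - \<beta>w / B * (W \<xi> \<bullet> Dw (X \<xi>)) - \<beta>\<phi> / B * (P \<xi> \<bullet> D\<phi> (X \<xi>))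
    + Cw / (real B)\<^sup>2 * (norm (W \<xi>))\<^sup>2 + C\<phi> / (real B)\<^sup>2 * (norm (P \<xi>))\<^sup>2 \<partial>\<Omega>)"
  proof (rule integral_mono)
    show "integrable \<Omega> (\<lambda>\<xi>. F (X \<xi>) - \<beta>w / B * (W \<xi> \<bullet> Dw (X \<xi>)) - \<beta>\<phi> / B * (P \<xi> \<bullet> D\<phi> (X \<xi>))
      + Cw / (real B)\<^sup>2 * (norm (W \<xi>))\<^sup>2 + C\<phi> / (real B)\<^sup>2 * (norm (P \<xi>))\<^sup>2)"
      by (intro Bochner_Integration.integrable_add Bochner_Integration.integrable_diff
          integrable_mult_right intF intWD intPD intW intP)
  qed (use F_anil_integrable F_step_le in \<open>simp_all only: X_def W_def P_def\<close>)
  moreover have "(\<integral>\<xi>. F (X \<xi>) - \<beta>w / B * (W \<xi> \<bullet> Dw (X \<xi>)) - \<beta>\<phi> / B * (P \<xi> \<bullet> D\<phi> (X \<xi>))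
    + Cw / (real B)\<^sup>2 * (norm (W \<xi>))\<^sup>2 + C\<phi> / (real B)\<^sup>2 * (norm (P \<xi>))\<^sup>2 \<partial>\<Omega>)
    = (\<integral>\<xi>. F (X \<xi>) \<partial>\<Omega>) - \<beta>w / B * (\<integral>\<xi>. W \<xi> \<bullet> Dw (X \<xi>) \<partial>\<Omega>) - \<beta>\<phi> / B * (\<integral>\<xi>. P \<xi> \<bullet> D\<phi> (X \<xi>) \<partial>\<Omega>)
    + Cw / (real B)\<^sup>2 * (\<integral>\<xi>. (norm (W \<xi>))\<^sup>2 \<partial>\<Omega>) + C\<phi> / (real B)\<^sup>2 * (\<integral>\<xi>. (norm (P \<xi>))\<^sup>2 \<partial>\<Omega>)"
    using intF intWD intPD intW intP
    by (simp only: Bochner_Integration.integral_add Bochner_Integration.integral_diff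
        Bochner_Integration.integrable_add Bochner_Integration.integrable_diff
        integral_mult_right_zero integrable_mult_right)
  moreover have "\<beta>w / B * (\<integral>\<xi>. W \<xi> \<bullet> Dw (X \<xi>) \<partial>\<Omega>) = \<beta>w * Ew" "\<beta>\<phi> / B * (\<integral>\<xi>. P \<xi> \<bullet> D\<phi> (X \<xi>) \<partial>\<Omega>) = \<beta>\<phi> * E\<phi>"
    unfolding WD PD using B by simp_all
  moreover have "Cw / (real B)\<^sup>2 * (\<integral>\<xi>. (norm (W \<xi>))\<^sup>2 \<partial>\<Omega>) \<le> Cw * Vw\<^sup>2 / B + \<beta>w / 2 * Ew"
  proof -
    have "Cw / (real B)\<^sup>2 * (\<integral>\<xi>. (norm (W \<xi>))\<^sup>2 \<partial>\<Omega>) \<le> Cw / (real B)\<^sup>2 * (B * Vw\<^sup>2 + (real B)\<^sup>2 * Ew)"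
      using C_nonneg W2 by (intro mult_left_mono) auto
    also have "\<dots> = Cw * Vw\<^sup>2 / B + Cw * Ew"
      by (rule cancel_B)
    also have "Cw * Ew \<le> \<beta>w / 2 * Ew"
      using Cw_le by (intro mult_right_mono) (auto simp: Ew_def)
    finally show ?thesis by simp
  qed
  moreover have "C\<phi> / (real B)\<^sup>2 * (\<integral>\<xi>. (norm (P \<xi>))\<^sup>2 \<partial>\<Omega>) \<le> C\<phi> * V\<phi>\<^sup>2 / B + \<beta>\<phi> / 2 * E\<phi>"
  proof -
    have "C\<phi> / (real B)\<^sup>2 * (\<integral>\<xi>. (norm (P \<xi>))\<^sup>2 \<partial>\<Omega>) \<le> C\<phi> / (real B)\<^sup>2 * (B * V\<phi>\<^sup>2 + (real B)\<^sup>2 * E\<phi>)"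
      using C_nonneg P2 by (intro mult_left_mono) auto
    also have "\<dots> = C\<phi> * V\<phi>\<^sup>2 / B + C\<phi> * E\<phi>"
      by (rule cancel_B)
    also have "C\<phi> * E\<phi> \<le> \<beta>\<phi> / 2 * E\<phi>"
      using C\<phi>_le by (intro mult_right_mono) (auto simp: E\<phi>_def)
    finally show ?thesis by simp
  qed
  moreover have "noise / B = Cw * Vw\<^sup>2 / B + C\<phi> * V\<phi>\<^sup>2 / B"
    by (simp add: noise_def add_divide_distrib)
  ultimately show ?thesis
    unfolding X_def[symmetric] Ew_def[symmetric] E\<phi>_def[symmetric] by linarith
qed

lemma telescoped_descent:
  assumes B: "1 \<le> B"
  shows "\<beta>w / 2 * (\<Sum>k<K. \<integral>\<xi>. (norm (Dw (Z B \<xi> k)))\<^sup>2 \<partial>\<Omega>)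
    + \<beta>\<phi> / 2 * (\<Sum>k<K. \<integral>\<xi>. (norm (D\<phi> (Z B \<xi> k)))\<^sup>2 \<partial>\<Omega>)
    \<le> F z0 - (\<integral>\<xi>. F (Z B \<xi> K) \<partial>\<Omega>) + real K * (noise / B)"
proof (induction K)
  case 0
  interpret \<Omega>: prob_space \<Omega>
    unfolding task_draws_def using prob_space_axioms by (rule prob_space_PiM)
  show ?case
    by (simp add: \<Omega>.prob_space)
next
  case (Suc K)
  then show ?case
    using expected_descent[OF B, of K] unfolding sum.lessThan_Suc distrib_left
    by (simp only: of_nat_Suc distrib_right mult_1_left)
qed

text \<open>The first summand stems from the \<open>w\<close> gradients, where
  \<open>Vw\<^sup>2\<close> contributes \<open>r ^ 4\<close> against the \<open>1 / r\<close> of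
  \<open>Cw\<close>. The second stems from the \<phi> gradients, where
  \<open>V\<phi>\<^sup>2\<close> takes away two of the three powers of \<mu>.\<close>

lemma noise_le: "noise \<le> s\<^sup>2 * (3 * c\<^sup>2 * S ^ 4 * \<mu> ^ 3 * r ^ 3 + 24 * S ^ 8 * \<mu>)"
proof -
  have "1 + L / \<mu> \<le> 2 * (S / \<mu>)"
  proof -
    have "1 \<le> S / \<mu>" "L / \<mu> \<le> S / \<mu>"
      using S_ge_\<mu> S_ge \<mu>_pos by (auto simp: divide_right_mono)
    then show ?thesis by linarith
  qed
  then have "V\<phi> \<le> S * (2 * (S / \<mu>))"
    using S_ge M_nonneg L_pos \<mu>_pos by (intro mult_mono) auto
  then have "V\<phi>\<^sup>2 \<le> (S * (2 * (S / \<mu>)))\<^sup>2"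
    using M_nonneg L_pos \<mu>_pos by (intro power_mono) auto
  then have "C\<phi> * V\<phi>\<^sup>2 \<le> C\<phi> * (S * (2 * (S / \<mu>)))\<^sup>2"
    using C_nonneg by (intro mult_left_mono) auto
  also have "\<dots> = s\<^sup>2 * (24 * S ^ 8 * \<mu>)"
    using \<mu>_pos by (simp add: C\<phi>_def field_simps eval_nat_numeral)
  finally have 1: "C\<phi> * V\<phi>\<^sup>2 \<le> s\<^sup>2 * (24 * S ^ 8 * \<mu>)" .
  have "Vw\<^sup>2 \<le> (S * r\<^sup>2)\<^sup>2"
    using S_ge M_nonneg by (intro power_mono mult_right_mono) auto
  then have "Cw * Vw\<^sup>2 \<le> Cw * (S * r\<^sup>2)\<^sup>2"
    using C_nonneg by (intro mult_left_mono) auto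
  also have "\<dots> = s\<^sup>2 * (3 * c\<^sup>2 * S ^ 4 * \<mu> ^ 3 * r ^ 3)"
    using r_pos by (simp add: Cw_def field_simps eval_nat_numeral)
  finally show ?thesis
    using 1 unfolding noise_def distrib_left by linarith
qed

lemma c_sq_ge: "1 \<le> c\<^sup>2"
  using c_ge by simp

lemma s_S8: "s * S ^ 8 \<le> S\<^sup>2 / 10000"
proof -
  have "1 * S ^ 6 \<le> c\<^sup>2 * S ^ 6"
    using S_ge c_sq_ge by (intro mult_right_mono) auto
  then have "(s * (1 * S ^ 6)) * S\<^sup>2 \<le> (s * (c\<^sup>2 * S ^ 6)) * S\<^sup>2"
    by (rule mult_right_mono[OF mult_left_mono]) (use s_pos in auto)
  then show ?thesis
    unfolding s_eq by (simp add: mult.assoc flip: power_add)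
qed

section \<open>Absorption of all constants into the rate constant\<close>

context
  fixes \<Delta> R :: real
  assumes \<Delta>: "0 \<le> \<Delta>" and R: "R = 10 ^ 5 * S ^ 8 * (1 + \<Delta>) * c\<^sup>2"
begin

text \<open>\<open>1 + \<Delta>\<close> in place of \<Delta> keeps \<open>R\<close> at least
  \<open>1\<close> when the start is already optimal, so that \<open>R\<close> dominates the noise
  as well as the initial gap.\<close>

lemma R_ge: "2 / s * \<Delta> \<le> R" "S\<^sup>2 \<le> R" "S ^ 8 \<le> R" "1 \<le> R"
proof -
  have "2 / s * \<Delta> = 2 * 10 ^ 4 * c\<^sup>2 * S ^ 6 * \<Delta>"
    unfolding s by simp
  also have "\<dots> \<le> 10 ^ 5 * c\<^sup>2 * S ^ 8 * (1 + \<Delta>)"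
    using \<Delta> S_ge c_ge by (intro mult_mono power_increasing) auto
  finally show "2 / s * \<Delta> \<le> R"
    by (simp add: R mult_ac)
  have "1 * S ^ 8 * 1 * 1 \<le> R"
    unfolding R using \<Delta> S_ge c_ge by (intro mult_mono c_sq_ge) auto
  then show "S ^ 8 \<le> R"
    by simp
  moreover have "S\<^sup>2 \<le> S ^ 8" "1 \<le> S ^ 8"
    using S_ge by (auto intro: power_increasing)
  ultimately show "S\<^sup>2 \<le> R" "1 \<le> R"
    by linarith+
qed

text \<open>The \<phi> noise of order \<mu> decides: divided by \<beta>w it becomes
  \<open>r / \<mu>\<close>. The other part is smaller by a factor
  \<open>\<mu>\<^sup>2 * r ^ 3\<close>, which is at most \<open>S\<^sup>2\<close>.\<close>

lemma noise_rate_w: "2 / \<beta>w * noise \<le> R * (1 / \<mu> * r)"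
proof -
  have "2 / \<beta>w * noise \<le> 2 / \<beta>w * (s\<^sup>2 * (3 * c\<^sup>2 * S ^ 4 * \<mu> ^ 3 * r ^ 3 + 24 * S ^ 8 * \<mu>))"
    using noise_le \<beta>w_pos by (intro mult_left_mono) auto
  also have "\<dots> = (1 / \<mu> * r) * (6 * (s * c\<^sup>2 * S ^ 4 * (\<mu>\<^sup>2 * r ^ 3)) + 48 * (s * S ^ 8))"
    using \<mu>_pos r_pos s_pos by (simp add: \<beta>w field_simps eval_nat_numeral)
  also have "\<dots> \<le> (1 / \<mu> * r) * R"
  proof (rule mult_left_mono)
    have "\<mu>\<^sup>2 * r ^ 3 \<le> S\<^sup>2 * 1"
      using S_ge_\<mu> \<mu>_pos r_pos r_le by (intro mult_mono power_mono) (auto simp: power_le_one)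
    then have "s * c\<^sup>2 * S ^ 4 * (\<mu>\<^sup>2 * r ^ 3) \<le> s * c\<^sup>2 * S ^ 4 * S\<^sup>2"
      using s_pos S_ge by (intro mult_left_mono) auto
    also have "\<dots> = 1 / 10 ^ 4"
      unfolding s_eq[symmetric] by (simp add: mult_ac eval_nat_numeral)
    finally have 1: "s * c\<^sup>2 * S ^ 4 * (\<mu>\<^sup>2 * r ^ 3) \<le> 1 / 10 ^ 4" .
    have "1 \<le> S\<^sup>2"
      using S_ge by simp
    then show "6 * (s * c\<^sup>2 * S ^ 4 * (\<mu>\<^sup>2 * r ^ 3)) + 48 * (s * S ^ 8) \<le> R"
      using 1 s_S8 R_ge(2) by simp
  qed (use \<mu>_pos r_pos in auto)
  finally show ?thesis by (simp add: mult.commute)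
qed

lemma noise_rate_phi: "2 / \<beta>\<phi> * noise \<le> R * (1 / \<mu> * r ^ 3 + 1 / \<mu>\<^sup>2)"
proof -
  have "2 / \<beta>\<phi> * noise \<le> 2 / \<beta>\<phi> * (s\<^sup>2 * (3 * c\<^sup>2 * S ^ 4 * \<mu> ^ 3 * r ^ 3 + 24 * S ^ 8 * \<mu>))"
    using noise_le \<beta>\<phi>_pos by (intro mult_left_mono) auto
  also have "\<dots> = 6 * (s * c\<^sup>2 * S ^ 4 * \<mu>) * (1 / \<mu> * r ^ 3) + 48 * (s * S ^ 8) * (1 / \<mu>\<^sup>2)"
    using \<mu>_pos r_pos s_pos by (simp add: \<beta>\<phi> field_simps eval_nat_numeral)
  also have "\<dots> \<le> R * (1 / \<mu> * r ^ 3) + R * (1 / \<mu>\<^sup>2)"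
  proof (intro add_mono mult_right_mono)
    have "\<mu> \<le> S\<^sup>2"
      using S_ge_\<mu> S_ge by (smt (verit) self_le_power zero_less_numeral)
    then have "s * c\<^sup>2 * S ^ 4 * \<mu> \<le> s * c\<^sup>2 * S ^ 4 * S\<^sup>2"
      using s_pos S_ge by (intro mult_left_mono) auto
    also have "\<dots> = 1 / 10 ^ 4"
      unfolding s_eq[symmetric] by (simp add: mult_ac eval_nat_numeral)
    finally show "6 * (s * c\<^sup>2 * S ^ 4 * \<mu>) \<le> R"
      using R_ge(4) by simp
    have "0 \<le> S\<^sup>2"
      by simp
    then show "48 * (s * S ^ 8) \<le> R"
      using s_S8 R_ge(2) by linarith
  qed (use \<mu>_pos r_pos in auto)
  finally show ?thesis by (simp add: distrib_left)
qed

lemma convergence_rate: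
  assumes lower: "\<And>z. F z0 - \<Delta> \<le> F z" and K: "1 \<le> K" and B: "1 \<le> B"
  shows "(\<Sum>k<K. \<integral>\<xi>. (norm (Dw (Z B \<xi> k)))\<^sup>2 \<partial>\<Omega>) / K
      \<le> R * (1 / \<mu>\<^sup>2 * r / real K + 1 / \<mu> * r / real B)" (is "?Ew / K \<le> _")
    and "(\<Sum>k<K. \<integral>\<xi>. (norm (D\<phi> (Z B \<xi> k)))\<^sup>2 \<partial>\<Omega>) / K
      \<le> R * ((1 / \<mu>\<^sup>2 * r + 1 / \<mu> ^ 3) / real K + (1 / \<mu> * r ^ 3 + 1 / \<mu>\<^sup>2) / real B)" (is "?E\<phi> / K \<le> _")
proof -
  interpret \<Omega>: prob_space \<Omega>
    unfolding task_draws_def using prob_space_axioms by (rule prob_space_PiM)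
  have E: "0 \<le> \<beta>w / 2 * ?Ew" "0 \<le> \<beta>\<phi> / 2 * ?E\<phi>"
    using \<beta>w_pos \<beta>\<phi>_pos by (auto intro!: mult_nonneg_nonneg sum_nonneg)
  have "F z0 - \<Delta> = (\<integral>\<xi>. F z0 - \<Delta> \<partial>\<Omega>)"
    by (simp add: \<Omega>.prob_space)
  also have "\<dots> \<le> (\<integral>\<xi>. F (Z B \<xi> K) \<partial>\<Omega>)"
    using F_anil_integrable lower by (intro integral_mono) auto
  finally have "\<beta>w / 2 * ?Ew + \<beta>\<phi> / 2 * ?E\<phi> \<le> \<Delta> + real K * (noise / B)"
    using telescoped_descent[OF B, of K] by linarith
  \<comment> \<open>Both sums are nonnegative, so the total bounds each of them alone.\<close>
  with E have "\<beta>w / 2 * ?Ew \<le> \<Delta> + real K * (noise / B)" "\<beta>\<phi> / 2 * ?E\<phi> \<le> \<Delta> + real K * (noise / B)"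
    by linarith+
  then have le: "?Ew / K \<le> 2 / \<beta>w * \<Delta> / K + 2 / \<beta>w * noise / B"
    "?E\<phi> / K \<le> 2 / \<beta>\<phi> * \<Delta> / K + 2 / \<beta>\<phi> * noise / B"
    using K B \<beta>w_pos \<beta>\<phi>_pos by (simp_all add: field_simps)
  have "2 / \<beta>w * \<Delta> = (2 / s * \<Delta>) * (1 / \<mu>\<^sup>2 * r)"
    by (simp add: \<beta>w)
  also have "\<dots> \<le> R * (1 / \<mu>\<^sup>2 * r)"
    using R_ge(1) r_pos by (intro mult_right_mono) auto
  finally have 1: "2 / \<beta>w * \<Delta> \<le> R * (1 / \<mu>\<^sup>2 * r)" .
  have "?Ew / K \<le> R * (1 / \<mu>\<^sup>2 * r) / K + R * (1 / \<mu> * r) / B"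
    using le(1) divide_right_mono[OF 1, of "real K"] divide_right_mono[OF noise_rate_w, of "real B"] by linarith
  then show "?Ew / K \<le> R * (1 / \<mu>\<^sup>2 * r / real K + 1 / \<mu> * r / real B)"
    unfolding distrib_left by simp
  have "2 / \<beta>\<phi> * \<Delta> = (2 / s * \<Delta>) * (1 / \<mu> ^ 3)"
    by (simp add: \<beta>\<phi>)
  also have "\<dots> \<le> R * (1 / \<mu>\<^sup>2 * r + 1 / \<mu> ^ 3)"
    using R_ge(1,4) r_pos \<mu>_pos by (intro mult_mono) auto
  finally have 2: "2 / \<beta>\<phi> * \<Delta> \<le> R * (1 / \<mu>\<^sup>2 * r + 1 / \<mu> ^ 3)" .
  have "?E\<phi> / K \<le> R * (1 / \<mu>\<^sup>2 * r + 1 / \<mu> ^ 3) / K + R * (1 / \<mu> * r ^ 3 + 1 / \<mu>\<^sup>2) / B"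
    using le(2) divide_right_mono[OF 2, of "real K"] divide_right_mono[OF noise_rate_phi, of "real B"] by linarith
  then show "?E\<phi> / K \<le> R * ((1 / \<mu>\<^sup>2 * r + 1 / \<mu> ^ 3) / real K + (1 / \<mu> * r ^ 3 + 1 / \<mu>\<^sup>2) / real B)"
    by (simp add: distrib_left)
qed

end

end

subsection \<open>Random index, cost and sample sizes\<close>

text \<open>A uniform index turns averages over the iterations into mean squares, and it does so for
  both gradients at once.\<close>

lemma mean_square_uniform_index:
  fixes Y :: "'s \<Rightarrow> nat \<Rightarrow> 'v::euclidean_space"
  assumes P: "prob_space P" and K: "1 \<le> K"
    and Y: "\<And>k. (\<lambda>s. Y s k) \<in> borel_measurable P" and V: "\<And>s k. norm (Y s k) \<le> V"
  defines "Q \<equiv> P \<Otimes>\<^sub>M measure_pmf (pmf_of_set {..<K})"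
  shows "square_integrable Q (\<lambda>(s, k). Y s k)"
    and "mean_square Q (\<lambda>(s, k). Y s k) = (\<Sum>k<K. \<integral>s. (norm (Y s k))\<^sup>2 \<partial>P) / real K"
proof -
  interpret P: prob_space P by fact
  interpret Q: pair_prob_space P "measure_pmf (pmf_of_set {..<K})"
    by unfold_locales
  \<comment> \<open>The index is discrete, so measurability for each fixed \<open>k\<close> implies
    joint measurability.\<close>
  have "(\<lambda>x. (norm (Y (fst x) (snd x)))\<^sup>2) \<in> borel_measurable (P \<Otimes>\<^sub>M count_space UNIV)"
    by (rule measurable_compose_countable'[of UNIV "\<lambda>k x. (norm (Y (fst x) k))\<^sup>2" _ _ snd])
      (use Y in \<open>auto intro!: measurable_compose[OF measurable_fst]\<close>)
  moreover have "sets (P \<Otimes>\<^sub>M measure_pmf (pmf_of_set {..<K})) = sets (P \<Otimes>\<^sub>M count_space UNIV)"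
    by (intro sets_pair_measure_cong) auto
  ultimately have m: "(\<lambda>x. (norm (Y (fst x) (snd x)))\<^sup>2) \<in> borel_measurable (P \<Otimes>\<^sub>M measure_pmf (pmf_of_set {..<K}))"
    by (simp cong: measurable_cong_sets)
  have int: "integrable Q (\<lambda>x. (norm (Y (fst x) (snd x)))\<^sup>2)"
    unfolding Q_def using m V by (intro Q.P.integrable_const_bound[where B="V\<^sup>2"]) (auto intro!: power_mono)
  then show "square_integrable Q (\<lambda>(s, k). Y s k)"
    by (simp add: square_integrable_def case_prod_beta')
  have "mean_square Q (\<lambda>(s, k). Y s k) = (\<integral>k. (\<integral>s. (norm (Y s k))\<^sup>2 \<partial>P) \<partial>measure_pmf (pmf_of_set {..<K}))"
    using Q.integral_snd[of "\<lambda>s k. (norm (Y s k))\<^sup>2"] int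
    by (simp add: mean_square_def Q_def case_prod_beta')
  also have "\<dots> = (\<Sum>k<K. \<integral>s. (norm (Y s k))\<^sup>2 \<partial>P) / real K"
    using K by (subst integral_pmf_of_set) (auto simp: lessThan_empty_iff)
  finally show "mean_square Q (\<lambda>(s, k). Y s k) = (\<Sum>k<K. \<integral>s. (norm (Y s k))\<^sup>2 \<partial>P) / real K" .
qed

text \<open>The additional \<open>1\<close> for \<open>Grad_w\<close> is the gradient of the test
  loss at the last inner iterate.\<close>

lemma count_task_grad:
  "count (snd (task_grad \<alpha> f g \<phi> n w)) e = (case e of Grad_w \<Rightarrow> n + 1 | Grad_phi \<Rightarrow> 1 | _ \<Rightarrow> n)"
  by (induction n arbitrary: w) (auto simp: Let_def case_prod_beta' split: eval_kind.split)

lemma count_anil_exec: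
  "count (snd (anil_exec \<alpha> N \<beta>w \<beta>\<phi> LS LD z0 B \<xi> k)) e
     = k * (B * (case e of Grad_w \<Rightarrow> N + 1 | Grad_phi \<Rightarrow> 1 | _ \<Rightarrow> N))"
  by (induction k) (simp_all add: Let_def case_prod_beta' count_sum count_task_grad)

context anil_problem
begin

text \<open>Restricted to the sample space because the chain rule behind \<open>task_grad\<close>
  relies on the regularity of the tasks drawn.\<close>

lemma anil_exec_eq:
  assumes "\<xi> \<in> space \<Omega>"
  shows "fst (anil_exec \<alpha> N \<beta>w \<beta>\<phi> LS LD z0 B \<xi> k) = Z B \<xi> k"
proof (induction k)
  case (Suc k)
  have "\<xi> (k, b) \<in> space T" for b
    using assms by (auto simp: task_draws_def space_PiM)
  then have "fst (task_grad \<alpha> (LS (\<xi> (k, b))) (LD (\<xi> (k, b))) (snd z) N (fst z))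
      = (grad_w (loss (\<xi> (k, b))) z, grad_phi (loss (\<xi> (k, b))) z)" for b z
    by (rule adapted_task.task_grad_eq[OF task])
  with Suc show ?case
    by (simp add: Let_def case_prod_beta')
qed simp

lemma uniform_index_rate:
  assumes \<Delta>: "0 \<le> \<Delta>" and R: "R = 10 ^ 5 * S ^ 8 * (1 + \<Delta>) * c\<^sup>2"
    and lower: "\<And>z. F z0 - \<Delta> \<le> F z" and K: "1 \<le> K" and B: "1 \<le> B"
  defines "P \<equiv> \<Omega> \<Otimes>\<^sub>M measure_pmf (pmf_of_set {..<K})"
  shows "square_integrable P (\<lambda>(\<xi>, k). grad_w F (Z B \<xi> k))"
    and "mean_square P (\<lambda>(\<xi>, k). grad_w F (Z B \<xi> k)) \<le> R * (1 / \<mu>\<^sup>2 * r / real K + 1 / \<mu> * r / real B)"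
    and "square_integrable P (\<lambda>(\<xi>, k). grad_phi F (Z B \<xi> k))"
    and "mean_square P (\<lambda>(\<xi>, k). grad_phi F (Z B \<xi> k))
      \<le> R * ((1 / \<mu>\<^sup>2 * r + 1 / \<mu> ^ 3) / real K + (1 / \<mu> * r ^ 3 + 1 / \<mu>\<^sup>2) / real B)"
proof -
  have \<Omega>: "prob_space \<Omega>"
    unfolding task_draws_def using prob_space_axioms by (rule prob_space_PiM)
  note w = mean_square_uniform_index[OF \<Omega> K measurable_compose[OF anil_measurable mean_grad_measurable(1)] mean_grad_norm_le(1)]
  note \<phi> = mean_square_uniform_index[OF \<Omega> K measurable_compose[OF anil_measurable mean_grad_measurable(2)] mean_grad_norm_le(2)]
  show "square_integrable P (\<lambda>(\<xi>, k). grad_w F (Z B \<xi> k))" "square_integrable P (\<lambda>(\<xi>, k). grad_phi F (Z B \<xi> k))"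
    unfolding P_def grad_F by (rule w(1), rule \<phi>(1))
  show "mean_square P (\<lambda>(\<xi>, k). grad_w F (Z B \<xi> k)) \<le> R * (1 / \<mu>\<^sup>2 * r / real K + 1 / \<mu> * r / real B)"
    unfolding P_def grad_F w(2) by (rule convergence_rate(1)[OF \<Delta> R lower K B])
  show "mean_square P (\<lambda>(\<xi>, k). grad_phi F (Z B \<xi> k))
      \<le> R * ((1 / \<mu>\<^sup>2 * r + 1 / \<mu> ^ 3) / real K + (1 / \<mu> * r ^ 3 + 1 / \<mu>\<^sup>2) / real B)"
    unfolding P_def grad_F \<phi>(2) by (rule convergence_rate(2)[OF \<Delta> R lower K B])
qed

text \<open>\<open>K\<close> and \<open>B\<close> make each of the two summands in a rate at most
  \<open>\<epsilon> / 4\<close>, so their sum is strictly below \<epsilon>. Because of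
  \<open>r ^ 3 \<le> r\<close>, the same \<open>a\<close> and \<open>b\<close> serve both rates. The
  factor 2 in the last bound is reserved for the final count, where it covers
  \<open>N + 1 \<le> 2 * N\<close> and the two kinds of second derivatives.\<close>

lemma sample_sizes:
  assumes \<Delta>: "0 \<le> \<Delta>" and R: "R = 10 ^ 5 * S ^ 8 * (1 + \<Delta>) * c\<^sup>2" and \<epsilon>: "0 < \<epsilon>" "\<epsilon> \<le> 1"
  obtains K B :: nat where "1 \<le> K" "1 \<le> B"
    "R * (1 / \<mu>\<^sup>2 * r / real K + 1 / \<mu> * r / real B) < \<epsilon>"
    "R * ((1 / \<mu>\<^sup>2 * r + 1 / \<mu> ^ 3) / real K + (1 / \<mu> * r ^ 3 + 1 / \<mu>\<^sup>2) / real B) < \<epsilon>"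
    "2 * real K * real B \<le> 10 ^ 4 * S ^ 4 * R\<^sup>2 * (1 / \<mu> ^ 4 * r + 1 / \<mu> ^ 5) / \<epsilon>\<^sup>2"
proof -
  define a where "a = 1 / \<mu>\<^sup>2 * r + 1 / \<mu> ^ 3"
  define b where "b = 1 / \<mu> * r + 1 / \<mu>\<^sup>2"
  define x where "x = 4 * R * a / \<epsilon>"
  define y where "y = 4 * R * b / \<epsilon>"
  define K where "K = nat \<lceil>x\<rceil>"
  define B where "B = nat \<lceil>y\<rceil>"
  note \<mu> = \<mu>_pos and r = r_pos r_le
  have R8: "S ^ 8 \<le> R" and R1: "1 \<le> R"
    using R_ge[OF \<Delta> R] by auto
  have q: "1 \<le> S / \<mu>"
    using S_ge_\<mu> \<mu> by simp
  \<comment> \<open>Together with \<open>\<epsilon> \<le> 1\<close> this makes \<open>x\<close> and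
    \<open>y\<close> at least \<open>1\<close>, even for large \<mu>.\<close>
  have R_div: "1 \<le> R * (1 / \<mu> ^ n)" if "n \<le> 8" for n
  proof -
    have "1 \<le> (S / \<mu>) ^ n"
      using q by (rule one_le_power)
    also have "\<dots> = S ^ n * (1 / \<mu> ^ n)"
      by (simp add: power_divide)
    also have "\<dots> \<le> R * (1 / \<mu> ^ n)"
      using R8 power_increasing[OF that S_ge(1)] \<mu> by (intro mult_right_mono) auto
    finally show ?thesis .
  qed
  have ab: "1 / \<mu> ^ 3 \<le> a" "1 / \<mu>\<^sup>2 \<le> b" "0 < a" "0 < b"
    using \<mu> r by (auto simp: a_def b_def add_pos_pos)
  have x: "1 \<le> x"
  proof -
    have "1 * \<epsilon> \<le> 4 * (R * (1 / \<mu> ^ 3))"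
      using R_div[of 3] \<epsilon> by simp
    also have "\<dots> \<le> 4 * (R * a)"
      using ab R1 by (intro mult_left_mono) auto
    finally show ?thesis
      using \<epsilon> by (simp add: x_def le_divide_eq)
  qed
  have y: "1 \<le> y"
  proof -
    have "1 * \<epsilon> \<le> 4 * (R * (1 / \<mu>\<^sup>2))"
      using R_div[of 2] \<epsilon> by simp
    also have "\<dots> \<le> 4 * (R * b)"
      using ab R1 by (intro mult_left_mono) auto
    finally show ?thesis
      using \<epsilon> by (simp add: y_def le_divide_eq)
  qed
  \<comment> \<open>Rounding up a number that is at least \<open>1\<close> at most doubles
    it.\<close>
  have K: "x \<le> real K" "real K \<le> 2 * x" and B: "y \<le> real B" "real B \<le> 2 * y"
    unfolding K_def B_def using x y by linarith+
  have K1: "1 \<le> K" "1 \<le> B"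
    using K B x y by linarith+
  have "R * a / K \<le> R * a / x" "R * b / B \<le> R * b / y"
    using K B x y ab R1 by (auto intro!: divide_left_mono)
  then have *: "R * a / K \<le> \<epsilon> / 4" "R * b / B \<le> \<epsilon> / 4"
    using ab R1 \<epsilon> by (simp_all add: x_def y_def)
  have 1: "R * (1 / \<mu>\<^sup>2 * r) / K \<le> R * a / K" "R * (1 / \<mu> * r) / B \<le> R * b / B"
    unfolding a_def b_def by (rule divide_right_mono[OF mult_left_mono]; use R1 \<mu> in simp)+
  have "r ^ 3 \<le> r"
    using r power_decreasing[of 1 3 r] by simp
  then have 2: "R * (1 / \<mu> * r ^ 3 + 1 / \<mu>\<^sup>2) / B \<le> R * b / B"
    unfolding b_def using R1 \<mu>
    by (intro divide_right_mono[OF mult_left_mono] add_right_mono mult_left_mono) auto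
  show thesis
  proof (rule that[OF K1])
    show "R * (1 / \<mu>\<^sup>2 * r / real K + 1 / \<mu> * r / real B) < \<epsilon>"
      unfolding distrib_left times_divide_eq_right using 1 * \<epsilon> by linarith
    show "R * ((1 / \<mu>\<^sup>2 * r + 1 / \<mu> ^ 3) / real K + (1 / \<mu> * r ^ 3 + 1 / \<mu>\<^sup>2) / real B) < \<epsilon>"
      unfolding a_def[symmetric] distrib_left[of R "a / K"] times_divide_eq_right using 2 * \<epsilon> by linarith
    \<comment> \<open>Only \<open>b\<close> is coarsened to order \<open>1 / \<mu>\<^sup>2\<close>.
      Keeping \<open>a\<close> exact leaves
      \<open>a / \<mu>\<^sup>2 = r / \<mu> ^ 4 + 1 / \<mu> ^ 5\<close>, the shape of the claimed
      cost.\<close>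
    have b_le: "b \<le> 2 * S / \<mu>\<^sup>2"
    proof -
      have "1 / \<mu> * r \<le> 1 / \<mu> * (S / \<mu>)"
        using \<mu> by (intro mult_left_mono order_trans[OF r(2) q]) auto
      moreover have "1 / \<mu>\<^sup>2 \<le> S / \<mu>\<^sup>2"
        using S_ge by (intro divide_right_mono) auto
      ultimately show ?thesis
        by (simp add: b_def power2_eq_square)
    qed
    have "real K * real B \<le> (2 * x) * (2 * y)"
      using K B x y by (intro mult_mono) auto
    also have "\<dots> = 64 * R\<^sup>2 / \<epsilon>\<^sup>2 * a * b"
      by (simp add: x_def y_def power2_eq_square)
    also have "\<dots> \<le> 64 * R\<^sup>2 / \<epsilon>\<^sup>2 * a * (2 * S / \<mu>\<^sup>2)"
      using b_le ab by (intro mult_left_mono) auto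
    also have "\<dots> = 128 * S * (R\<^sup>2 * (1 / \<mu> ^ 4 * r + 1 / \<mu> ^ 5) / \<epsilon>\<^sup>2)"
      using \<mu> \<epsilon> by (simp add: a_def field_simps eval_nat_numeral)
    finally have "2 * real K * real B \<le> (2 * (128 * S)) * (R\<^sup>2 * (1 / \<mu> ^ 4 * r + 1 / \<mu> ^ 5) / \<epsilon>\<^sup>2)"
      by simp
    also have "\<dots> \<le> (10 ^ 4 * S ^ 4) * (R\<^sup>2 * (1 / \<mu> ^ 4 * r + 1 / \<mu> ^ 5) / \<epsilon>\<^sup>2)"
    proof (rule mult_right_mono)
      have "S ^ 1 \<le> S ^ 4"
        using S_ge by (intro power_increasing) auto
      then show "2 * (128 * S) \<le> 10 ^ 4 * S ^ 4"
        using S_ge by simp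
    qed (use \<mu> r in auto)
    finally show "2 * real K * real B \<le> 10 ^ 4 * S ^ 4 * R\<^sup>2 * (1 / \<mu> ^ 4 * r + 1 / \<mu> ^ 5) / \<epsilon>\<^sup>2"
      by (simp add: mult.assoc)
  qed
qed

end

text \<open>The product measure makes the random index independent of the draws. The counts are
  deterministic, so the cost bounds hold for every sequence of draws; all \<open>K\<close>
  iterations are charged although the index stays below \<open>K\<close>.\<close>

theorem theorem13:
  fixes T :: "'i measure"
    and LS LD :: "'i \<Rightarrow> 'w::euclidean_space \<times> 'p::euclidean_space \<Rightarrow> real"
    and F :: "'w \<times> 'p \<Rightarrow> real"
    and Z :: "nat \<Rightarrow> (nat \<times> nat \<Rightarrow> 'i) \<times> nat \<Rightarrow> 'w \<times> 'p"
    and z0 :: "'w \<times> 'p"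
    and L M \<rho> \<tau> \<mu> \<theta> \<alpha> \<beta>w \<beta>\<phi> \<Delta> r :: real
    and N :: nat
  assumes "prob_space T"
    and "(\<lambda>(i, z). LS i z) \<in> borel_measurable (T \<Otimes>\<^sub>M borel)"
    and "(\<lambda>(i, z). LD i z) \<in> borel_measurable (T \<Otimes>\<^sub>M borel)"
    and "0 < \<mu>" and "\<mu> < L" and "1 \<le> N"
    and "0 < \<theta>" and "\<theta> < 1" and "N = 1 \<Longrightarrow> \<mu> \<le> \<theta> * L"
    and A1: "\<And>i. i \<in> space T \<Longrightarrow> smooth L (LS i)"
      "\<And>i. i \<in> space T \<Longrightarrow> smooth L (LD i)"
      "\<And>i. i \<in> space T \<Longrightarrow> M-lipschitz_on UNIV (LD i)"
    and A2: "\<And>i. i \<in> space T \<Longrightarrow> second_order_smooth \<rho> \<tau> (LS i)"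
    and A3: "\<And>i \<phi>. i \<in> space T \<Longrightarrow> strongly_convex \<mu> (\<lambda>w. LS i (w, \<phi>))"
    and "\<alpha> = \<mu> / L\<^sup>2"
    and "\<beta>w = step_factor \<theta> \<rho> \<tau> L M * \<mu>\<^sup>2 * (1 - \<mu>\<^sup>2 / L\<^sup>2) powr (- real N / 2)"
    and "\<beta>\<phi> = step_factor \<theta> \<rho> \<tau> L M * \<mu> ^ 3"
    and "\<And>z. integrable T (\<lambda>i. adapted_loss \<alpha> N (LS i) (LD i) z)"
    and "F = meta_loss T \<alpha> N LS LD"
    and "bdd_below (range F)"
    and "\<Delta> = F z0 - (INF z. F z)"
    and "Z = (\<lambda>B (\<xi>, k). anil \<alpha> N \<beta>w \<beta>\<phi> LS LD z0 B \<xi> k)"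
    and "r = (1 - \<mu>\<^sup>2 / L\<^sup>2) powr (real N / 2)"
  shows
    "(\<forall>K \<ge> 1. \<forall>B \<ge> 1. \<exists>q :: nat pmf. set_pmf q \<subseteq> {..<K} \<and>
       (let P = task_draws T \<Otimes>\<^sub>M measure_pmf q in
         square_integrable P (\<lambda>s. grad_w F (Z B s)) \<and>
         mean_square P (\<lambda>s. grad_w F (Z B s))
           \<le> rate_const \<theta> \<rho> \<tau> L M \<Delta> * (1 / \<mu>\<^sup>2 * r / real K + 1 / \<mu> * r / real B) \<and>
         square_integrable P (\<lambda>s. grad_phi F (Z B s)) \<and>
         mean_square P (\<lambda>s. grad_phi F (Z B s))
           \<le> rate_const \<theta> \<rho> \<tau> L M \<Delta> *
               ((1 / \<mu>\<^sup>2 * r + 1 / \<mu> ^ 3) / real K + (1 / \<mu> * r ^ 3 + 1 / \<mu>\<^sup>2) / real B))) \<and>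
     (\<forall>\<epsilon>. 0 < \<epsilon> \<and> \<epsilon> \<le> 1 \<longrightarrow>
       (\<exists>K \<ge> 1. \<exists>B \<ge> 1. \<exists>q :: nat pmf. set_pmf q \<subseteq> {..<K} \<and>
          accurate_point \<epsilon> F (task_draws T \<Otimes>\<^sub>M measure_pmf q) (Z B) \<and>
          (\<forall>\<xi> \<in> space (task_draws T).
             (\<forall>k \<le> K. fst (anil_exec \<alpha> N \<beta>w \<beta>\<phi> LS LD z0 B \<xi> k) = anil \<alpha> N \<beta>w \<beta>\<phi> LS LD z0 B \<xi> k) \<and>
             (let cost = snd (anil_exec \<alpha> N \<beta>w \<beta>\<phi> LS LD z0 B \<xi> K);
                  C = cost_const \<theta> \<rho> \<tau> L M \<Delta>
              in real (count cost Grad_w) \<le> C * (N / \<mu> ^ 4 * r + N / \<mu> ^ 5) / \<epsilon>\<^sup>2 \<and>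
                 real (count cost Grad_phi) \<le> C * (1 / \<mu> ^ 4 * r + 1 / \<mu> ^ 5) / \<epsilon>\<^sup>2 \<and>
                 real (count cost Hess_ww + count cost Hess_phiw)
                   \<le> C * (N / \<mu> ^ 4 * r + N / \<mu> ^ 5) / \<epsilon>\<^sup>2))))"
proof -
  define \<kappa> c S s where "\<kappa> = 1 - \<mu>\<^sup>2 / L\<^sup>2" and "c = 1 / sqrt (1 - \<theta>\<^sup>2)"
    and "S = 1 + \<rho> + \<tau> + L + M" and "s = step_factor \<theta> \<rho> \<tau> L M"
  have \<theta>2: "0 < 1 - \<theta>\<^sup>2"
    using \<open>0 < \<theta>\<close> \<open>\<theta> < 1\<close> by (simp add: abs_square_less_1)
  \<comment> \<open>Translates between the factor \<open>1 - \<theta>\<^sup>2\<close> in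
    \<open>step_factor\<close> and \<open>rate_const\<close> and the constant \<open>c\<close> of
    the analysis.\<close>
  then have c2: "c\<^sup>2 = 1 / (1 - \<theta>\<^sup>2)"
    by (simp add: c_def power_divide)
  have "\<mu>\<^sup>2 < L\<^sup>2"
    using \<open>0 < \<mu>\<close> \<open>\<mu> < L\<close> by (intro power_strict_mono) auto
  then have \<kappa>: "0 < \<kappa>"
    using \<open>0 < \<mu>\<close> \<open>\<mu> < L\<close> by (simp add: \<kappa>_def)
  note r_def = \<open>r = (1 - \<mu>\<^sup>2 / L\<^sup>2) powr (real N / 2)\<close>
  have "\<kappa> powr (real N / 2) = (\<kappa> powr (1 / 2)) powr real N"
    by (simp add: powr_powr)
  also have "\<dots> = sqrt \<kappa> ^ N"
    using \<kappa> by (simp add: powr_half_sqrt powr_realpow)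
  finally have r: "r = sqrt \<kappa> ^ N"
    by (simp add: r_def \<kappa>_def)
  have \<beta>w: "\<beta>w = s * \<mu>\<^sup>2 / r"
    unfolding \<open>\<beta>w = _ * _ * _ powr _\<close> r_def s_def minus_divide_left[symmetric] powr_minus_divide by simp
  have \<beta>\<phi>: "\<beta>\<phi> = s * \<mu> ^ 3"
    by (simp add: \<open>\<beta>\<phi> = _\<close> s_def)
  interpret anil_problem T LS LD \<mu> L \<rho> \<tau> M \<alpha> \<kappa> \<theta> c r S s \<beta>w \<beta>\<phi> N z0
  proof (unfold anil_problem_def anil_problem_axioms_def, intro conjI allI impI)
    show "adapted_task (LS i) \<mu> L \<rho> \<tau> \<alpha> \<kappa> (LD i) M" if "i \<in> space T" for i
      using that A1 A2 A3 \<open>0 < \<mu>\<close> \<open>\<mu> < L\<close> \<open>\<alpha> = _\<close>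
      unfolding adapted_task_def adapted_task_axioms_def inner_loop_def by (auto simp: \<kappa>_def)
    show "s = 1 / (10 ^ 4 * c\<^sup>2 * S ^ 6)"
      unfolding c2 by (simp add: s_def step_factor_def S_def)
  qed (use assms r \<beta>w \<beta>\<phi> in \<open>simp_all add: c_def S_def\<close>)
  have F: "F = meta_loss T \<alpha> N LS LD"
    by fact
  have lower: "meta_loss T \<alpha> N LS LD z0 - \<Delta> \<le> meta_loss T \<alpha> N LS LD z" for z
    using cINF_lower[OF \<open>bdd_below (range F)\<close>, of z] \<open>\<Delta> = _\<close> by (simp add: F)
  have \<Delta>: "0 \<le> \<Delta>"
    using lower[of z0] by simp
  define R where "R = rate_const \<theta> \<rho> \<tau> L M \<Delta>"
  have R: "R = 10 ^ 5 * S ^ 8 * (1 + \<Delta>) * c\<^sup>2"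
    by (simp add: R_def rate_const_def S_def c2)
  have Z: "(\<lambda>x. G (Z B x)) = (\<lambda>(\<xi>, k). G (anil \<alpha> N \<beta>w \<beta>\<phi> LS LD z0 B \<xi> k))" for G :: "'w \<times> 'p \<Rightarrow> 'c" and B
    by (auto simp: \<open>Z = _\<close>)
  note rate = uniform_index_rate[OF \<Delta> R lower]
  have index: "set_pmf (pmf_of_set {..<K}) \<subseteq> {..<K}" if "1 \<le> K" for K :: nat
    using that by (subst set_pmf_of_set) (auto simp: lessThan_empty_iff)
  show ?thesis
  proof (intro conjI allI impI)
    fix K B :: nat
    assume K: "1 \<le> K" and B: "1 \<le> B"
    show "\<exists>q :: nat pmf. set_pmf q \<subseteq> {..<K} \<and>
       (let P = task_draws T \<Otimes>\<^sub>M measure_pmf q in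
         square_integrable P (\<lambda>s. grad_w F (Z B s)) \<and>
         mean_square P (\<lambda>s. grad_w F (Z B s))
           \<le> rate_const \<theta> \<rho> \<tau> L M \<Delta> * (1 / \<mu>\<^sup>2 * r / real K + 1 / \<mu> * r / real B) \<and>
         square_integrable P (\<lambda>s. grad_phi F (Z B s)) \<and>
         mean_square P (\<lambda>s. grad_phi F (Z B s))
           \<le> rate_const \<theta> \<rho> \<tau> L M \<Delta> *
               ((1 / \<mu>\<^sup>2 * r + 1 / \<mu> ^ 3) / real K + (1 / \<mu> * r ^ 3 + 1 / \<mu>\<^sup>2) / real B))"
      unfolding Let_def Z R_def[symmetric] F
      by (intro exI[of _ "pmf_of_set {..<K}"] conjI index rate K B)
  next
    fix \<epsilon> :: real
    assume \<epsilon>: "0 < \<epsilon> \<and> \<epsilon> \<le> 1"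
    obtain K B :: nat where K: "1 \<le> K" and B: "1 \<le> B"
      and w_le: "R * (1 / \<mu>\<^sup>2 * r / real K + 1 / \<mu> * r / real B) < \<epsilon>"
      and \<phi>_le: "R * ((1 / \<mu>\<^sup>2 * r + 1 / \<mu> ^ 3) / real K + (1 / \<mu> * r ^ 3 + 1 / \<mu>\<^sup>2) / real B) < \<epsilon>"
      and KB: "2 * real K * real B \<le> 10 ^ 4 * S ^ 4 * R\<^sup>2 * (1 / \<mu> ^ 4 * r + 1 / \<mu> ^ 5) / \<epsilon>\<^sup>2"
      using sample_sizes[OF \<Delta> R] \<epsilon> by blast
    define C where "C = cost_const \<theta> \<rho> \<tau> L M \<Delta>"
    have C: "C = 10 ^ 4 * S ^ 4 * R\<^sup>2"
      by (simp add: C_def cost_const_def S_def R_def)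
    have acc: "accurate_point \<epsilon> F (task_draws T \<Otimes>\<^sub>M measure_pmf (pmf_of_set {..<K})) (Z B)"
      unfolding accurate_point_def Z F
      by (intro conjI rate K B le_less_trans[OF rate(2) w_le] le_less_trans[OF rate(4) \<phi>_le])
    have KBN: "2 * real K * real B * N \<le> C * (N / \<mu> ^ 4 * r + N / \<mu> ^ 5) / \<epsilon>\<^sup>2"
      using mult_right_mono[OF KB, of "real N"] by (simp add: C algebra_simps)
    have "real K * real B \<le> 2 * real K * real B"
      by simp
    note KB1 = order_trans[OF this KB]
    \<comment> \<open>The test-loss gradient is charged to the inner steps, which is possible
      because there is at least one.\<close>
    have "real K * (real B * (real N + 1)) \<le> real K * (real B * (2 * N))"
      using \<open>1 \<le> N\<close> by (intro mult_left_mono) auto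
    also have "\<dots> = 2 * real K * real B * N"
      by simp
    also note KBN
    finally have cost_w: "real K * (real B * (real N + 1)) \<le> C * (N / \<mu> ^ 4 * r + N / \<mu> ^ 5) / \<epsilon>\<^sup>2" .
    show "\<exists>K \<ge> 1. \<exists>B \<ge> 1. \<exists>q :: nat pmf. set_pmf q \<subseteq> {..<K} \<and>
          accurate_point \<epsilon> F (task_draws T \<Otimes>\<^sub>M measure_pmf q) (Z B) \<and>
          (\<forall>\<xi> \<in> space (task_draws T).
             (\<forall>k \<le> K. fst (anil_exec \<alpha> N \<beta>w \<beta>\<phi> LS LD z0 B \<xi> k) = anil \<alpha> N \<beta>w \<beta>\<phi> LS LD z0 B \<xi> k) \<and>
             (let cost = snd (anil_exec \<alpha> N \<beta>w \<beta>\<phi> LS LD z0 B \<xi> K);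
                  C = cost_const \<theta> \<rho> \<tau> L M \<Delta>
              in real (count cost Grad_w) \<le> C * (N / \<mu> ^ 4 * r + N / \<mu> ^ 5) / \<epsilon>\<^sup>2 \<and>
                 real (count cost Grad_phi) \<le> C * (1 / \<mu> ^ 4 * r + 1 / \<mu> ^ 5) / \<epsilon>\<^sup>2 \<and>
                 real (count cost Hess_ww + count cost Hess_phiw)
                   \<le> C * (N / \<mu> ^ 4 * r + N / \<mu> ^ 5) / \<epsilon>\<^sup>2))"
      unfolding Let_def C_def[symmetric] count_anil_exec
    proof (rule exI[of _ K], rule conjI[OF K], rule exI[of _ B], rule conjI[OF B],
        rule exI[of _ "pmf_of_set {..<K}"], intro conjI ballI allI impI index[OF K] acc anil_exec_eq)
      show "real (K * (B * (case Grad_w of Grad_w \<Rightarrow> N + 1 | Grad_phi \<Rightarrow> 1 | _ \<Rightarrow> N)))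
          \<le> C * (N / \<mu> ^ 4 * r + N / \<mu> ^ 5) / \<epsilon>\<^sup>2"
        using cost_w by (simp add: distrib_left add.commute)
      show "real (K * (B * (case Grad_phi of Grad_w \<Rightarrow> N + 1 | Grad_phi \<Rightarrow> 1 | _ \<Rightarrow> N)))
          \<le> C * (1 / \<mu> ^ 4 * r + 1 / \<mu> ^ 5) / \<epsilon>\<^sup>2"
        using KB1 by (simp add: C)
      show "real (K * (B * (case Hess_ww of Grad_w \<Rightarrow> N + 1 | Grad_phi \<Rightarrow> 1 | _ \<Rightarrow> N))
           + K * (B * (case Hess_phiw of Grad_w \<Rightarrow> N + 1 | Grad_phi \<Rightarrow> 1 | _ \<Rightarrow> N)))
          \<le> C * (N / \<mu> ^ 4 * r + N / \<mu> ^ 5) / \<epsilon>\<^sup>2"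
        using KBN by (simp add: mult_ac)
    qed
  qed
qed

end
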